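(* Let $n\ge 1$, let $\Omega\subset\mathbb{R}^n$ be a strongly convex bounded domain, let $\delta:\Omega\to\mathbb{R}$ be a continuous and admissible function on $\Omega$, and let $\sigma$ be the associated averaging map. If $f\in C^0(\overline\Omega)$, then the averaging sequence $(\sigma^k(f))_{k\ge 0}$ converges uniformly on $\overline\Omega$ to a function $u\in C^0(\overline\Omega)$ that is harmonic on $\Omega$ and satisfies $u=f$ on $\partial\Omega$.
   Context: Functions are real-valued. A domain is a nonempty connected open set. $B(x,r)$ denotes the open ball of radius $r$ centered at $x$, and $\lambda$ denotes Lebesgue measure on $\mathbb{R}^n$. A function $\delta:\Omega\to\mathbb{R}$ is called admissible if $\delta(x)>0$ and $B(x,\delta(x))\subseteq\Omega$ for all $x\in\Omega$. Write $B_x=B(x,\delta(x))$. The averaging map $\sigma$ is defined by $$\sigma(f)(x)=\frac{1}{\lambda(B_x)}\int_{B_x} f(z)\,d\lambda(z)\quad (x\in\Omega),\qquad \sigma(f)(x)=f(x)\quad (x\in\partial\Omega).$$ $\sigma^k$ denotes the $k$-fold iterate: $\sigma^0(f)=f$, $\sigma^{k+1}(f)=\sigma(\sigma^k(f))$. A domain $\Omega\subset\mathbb{R}^n$ is strongly convex if any nontrivial convex linear combination of points in $\overline\Omega$ belongs to $\Omega$ (nontrivial: a convex combination of distinct points in which at least two coefficients are positive). $C^0(\overline\Omega)$ is the space of continuous functions on $\overline\Omega$. A function $u$ is harmonic on $\Omega$ if $u\in C^2(\Omega)$ and $\Delta u=0$ on $\Omega$. *)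

theory Defs
  imports "HOL-Analysis.Analysis"
begin

definition is_domain :: "'a::topological_space set \<Rightarrow> bool" where
  "is_domain \<Omega> \<longleftrightarrow> \<Omega> \<noteq> {} \<and> open \<Omega> \<and> connected \<Omega>"

text \<open>Indexing the convex combination by a set of points makes the points distinct.\<close>

definition strongly_convex :: "'a::real_normed_vector set \<Rightarrow> bool" where
  "strongly_convex \<Omega> \<longleftrightarrow>
     (\<forall>S c. finite S \<and> S \<subseteq> closure \<Omega> \<and> (\<forall>x\<in>S. 0 \<le> c x) \<and> (\<Sum>x\<in>S. c x) = 1
        \<and> (\<exists>a\<in>S. \<exists>b\<in>S. a \<noteq> b \<and> 0 < c a \<and> 0 < c b)
        \<longrightarrow> (\<Sum>x\<in>S. c x *\<^sub>R x) \<in> \<Omega>)"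

definition admissible :: "'a::metric_space set \<Rightarrow> ('a \<Rightarrow> real) \<Rightarrow> bool" where
  "admissible \<Omega> \<delta> \<longleftrightarrow> (\<forall>x\<in>\<Omega>. 0 < \<delta> x \<and> ball x (\<delta> x) \<subseteq> \<Omega>)"

text \<open>
  Functions on the closure of \<open>\<Omega>\<close> are represented by total functions. As \<open>\<Omega>\<close> is open,
  the \<open>else\<close> branch covers the frontier of \<open>\<Omega>\<close>; values outside the closure are irrelevant.
\<close>

definition averaging ::
  "'a::euclidean_space set \<Rightarrow> ('a \<Rightarrow> real) \<Rightarrow> ('a \<Rightarrow> real) \<Rightarrow> 'a \<Rightarrow> real" where
  "averaging \<Omega> \<delta> f x =
     (if x \<in> \<Omega>
      then (1 / measure lebesgue (ball x (\<delta> x))) * (LINT z:ball x (\<delta> x)|lebesgue. f z)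
      else f x)"

definition partial_deriv ::
  "'a::euclidean_space \<Rightarrow> ('a \<Rightarrow> real) \<Rightarrow> 'a \<Rightarrow> real" where
  "partial_deriv b u x = deriv (\<lambda>t. u (x + t *\<^sub>R b)) 0"

text \<open>Class \<open>C\<^sup>k\<close> on an open set \<open>\<Omega>\<close>: all partial derivatives up to order \<open>k\<close> exist and are continuous.\<close>

primrec Ck_on :: "nat \<Rightarrow> ('a::euclidean_space \<Rightarrow> real) \<Rightarrow> 'a set \<Rightarrow> bool" where
  "Ck_on 0 u \<Omega> \<longleftrightarrow> continuous_on \<Omega> u"
| "Ck_on (Suc k) u \<Omega> \<longleftrightarrow> continuous_on \<Omega> u \<and>
     (\<forall>b\<in>Basis. (\<forall>x\<in>\<Omega>. (\<lambda>t::real. u (x + t *\<^sub>R b)) differentiable (at 0))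
                 \<and> Ck_on k (partial_deriv b u) \<Omega>)"

definition laplacian :: "('a::euclidean_space \<Rightarrow> real) \<Rightarrow> 'a \<Rightarrow> real" where
  "laplacian u x = (\<Sum>b\<in>Basis. partial_deriv b (partial_deriv b u) x)"

definition harmonic_on :: "('a::euclidean_space \<Rightarrow> real) \<Rightarrow> 'a set \<Rightarrow> bool" where
  "harmonic_on u \<Omega> \<longleftrightarrow> Ck_on 2 u \<Omega> \<and> (\<forall>x\<in>\<Omega>. laplacian u x = 0)"

end

theory Submission
  imports Defs
begin

text \<open>
  The averaging map fixes every harmonic function, so the limit has to be the solution of the
  Dirichlet problem with boundary values \<open>f\<close>. The proof therefore has three parts: to solve the Dirichlet
  problem on a strongly convex domain, to show that the averages of \<open>f - u\<close> tend to zero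
  when \<open>u\<close> is the solution, and to show that \<open>u\<close> is twice continuously differentiable with \<open>\<Delta>u = 0\<close>.

  Throughout, harmonicity is replaced by the mean value property for all weights
  \<open>(1 - |z|\<^sup>2)\<^sup>m\<close> on all balls (\<open>mean_value_property\<close>), which is stable under limits.
  A \<open>C\<^sup>2\<close> function with zero Laplacian has it by the divergence theorem
  (\<open>laplacian_zero_mean_value_property\<close>); conversely, it makes the function a convolution of itself with a
  \<open>C\<^sup>2\<close> kernel and forces the Laplacian to vanish (\<open>mean_value_property_imp_harmonic_on\<close>).

  The Dirichlet problem. On a ball it is solved by polynomials: with \<open>s = a \<bullet> (x - c)\<close> and
  \<open>t = |x - c|\<^sup>2\<close>, the Laplacian can be inverted explicitly on the span of the \<open>s\<^sup>i t\<^sup>j\<close>, which yields a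
  solution with boundary values \<open>s\<^sup>k\<close> for every \<open>k\<close>; density and the maximum principle do the rest
  (\<open>dirichlet_ball\<close>). On the domain \<open>\<Omega>\<close> it is enough, again by density, to treat the convex functions
  \<open>exp (a \<bullet> x)\<close>. Such a function is subharmonic, so successive harmonic replacement in balls gives an increasing
  sequence whose limit solves the equation (\<open>perron_dirichlet\<close>). The limit attains the
  boundary values because strong convexity provides at each frontier point an affine function that vanishes there and
  is positive on the rest of the closure (\<open>strongly_convex_barrier\<close>).

  Convergence. Let \<open>v\<close> be the solution with boundary values \<open>|x|\<^sup>2\<close> and \<open>s = v - |x|\<^sup>2\<close>. Then \<open>s\<close>
  vanishes on the frontier and averaging decreases it strictly inside \<open>\<Omega>\<close>. By compactness the decrease is by a
  fixed proportion wherever \<open>s\<close> is not already small, so its iterates tend to zero uniformly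
  (\<open>strict_supersolution_decay\<close>). Every continuous function that vanishes on the frontier, in particular \<open>f - u\<close>, is
  dominated by a small constant plus a multiple of \<open>s\<close>, and averaging preserves such inequalities
  (\<open>iterate_vanishing_boundary\<close>).
\<close>

section \<open>Weighted means over balls\<close>

text \<open>
  Up to scaling and normalisation, \<open>ball_kernel m\<close> is the radial weight \<open>(1 - |z|\<^sup>2)\<^sup>m\<close> on the unit
  ball. Exponent 0 gives the plain ball average of the theorem; positive exponents give kernels that
  vanish on the sphere to higher and higher order, which is where continuity and differentiability
  of functions with the mean value property come from.
\<close>
definition ball_kernel :: "nat \<Rightarrow> 'a::euclidean_space \<Rightarrow> real" where
  "ball_kernel m z = indicator (ball 0 1) z * (1 - (norm z)\<^sup>2) ^ m"

text \<open>
  The integral runs over the fixed unit ball, so that limits in \<open>x\<close> and \<open>r\<close> are limits of the integrand only.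
\<close>
definition weighted_mean :: "nat \<Rightarrow> 'a::euclidean_space \<Rightarrow> real \<Rightarrow> ('a \<Rightarrow> real) \<Rightarrow> real" where
  "weighted_mean m x r u = (\<integral>z. ball_kernel m z * u (x + r *\<^sub>R z) \<partial>lborel) / (\<integral>z. ball_kernel m (z::'a) \<partial>lborel)"

text \<open>
  The class of functions for which all weighted means over balls inside \<open>S\<close> make sense. It has to contain
  pointwise limits of continuous functions, because the solution of the Dirichlet problem is first
  obtained as such a limit.
\<close>
definition bounded_measurable_on :: "'a::euclidean_space set \<Rightarrow> ('a \<Rightarrow> real) \<Rightarrow> bool" where
  "bounded_measurable_on S u \<longleftrightarrow> (\<lambda>x. indicator S x * u x) \<in> borel_measurable borel \<and> (\<exists>C. \<forall>x\<in>S. \<bar>u x\<bar> \<le> C)"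

lemma bounded_measurable_measurable: "bounded_measurable_on S u \<Longrightarrow> (\<lambda>x. indicator S x * u x) \<in> borel_measurable borel"
  by (simp add: bounded_measurable_on_def)

lemma ball_kernel_measurable [measurable]: "ball_kernel m \<in> borel_measurable borel"
proof -
  have "(\<lambda>z::'a. (1 - (norm z)\<^sup>2) ^ m :: real) \<in> borel_measurable borel"
    by (intro borel_measurable_continuous_onI continuous_intros)
  then show ?thesis unfolding ball_kernel_def[abs_def]
    by (intro borel_measurable_times borel_measurable_indicator) auto
qed

lemma ball_kernel_nonneg: "0 \<le> ball_kernel m z"
  unfolding ball_kernel_def by (auto simp: indicator_def power_le_one)

lemma ball_kernel_le_indicator: "ball_kernel m z \<le> indicator (ball 0 1) z"
  unfolding ball_kernel_def by (auto simp: indicator_def power_le_one)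

lemma integrable_indicator_unit_ball:
  "integrable lborel (indicator (ball (0::'a::euclidean_space) 1) :: 'a \<Rightarrow> real)"
  by (intro integrable_real_indicator emeasure_lborel_ball_finite) auto

lemma integrable_ball_kernel_mult:
  assumes g: "(\<lambda>z. indicator (ball 0 1) z * g z) \<in> borel_measurable borel"
    and C: "\<And>z. z \<in> ball 0 1 \<Longrightarrow> \<bar>g z\<bar> \<le> C"
  shows "integrable lborel (\<lambda>z::'a::euclidean_space. ball_kernel m z * g z)"
proof (rule Bochner_Integration.integrable_bound)
  show "integrable lborel (\<lambda>z::'a. C * indicator (ball 0 1) z)"
    by (intro integrable_mult_right integrable_indicator_unit_ball)
  have "(\<lambda>z. ball_kernel m z * g z) = (\<lambda>z. ball_kernel m z * (indicator (ball 0 1) z * g z))"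
    by (auto simp: ball_kernel_def indicator_def)
  then show "(\<lambda>z::'a. ball_kernel m z * g z) \<in> borel_measurable lborel"
    using g by simp
  show "AE z in lborel. norm (ball_kernel m z * g z) \<le> norm (C * indicator (ball 0 1) z :: real)"
  proof (rule AE_I2)
    fix z :: 'a
    show "norm (ball_kernel m z * g z) \<le> norm (C * indicator (ball 0 1) z :: real)"
    proof (cases "z \<in> ball 0 1")
      case True
      then have "ball_kernel m z \<le> 1" "0 \<le> ball_kernel m z"
        using ball_kernel_le_indicator[of m z] ball_kernel_nonneg[of m z] by auto
      with C[OF True] have "ball_kernel m z * \<bar>g z\<bar> \<le> 1 * C"
        by (intro mult_mono) auto
      with True \<open>0 \<le> ball_kernel m z\<close> show ?thesis by (simp add: abs_mult)
    qed (simp add: ball_kernel_def)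
  qed
qed

lemma integrable_ball_kernel: "integrable lborel (ball_kernel m :: 'a::euclidean_space \<Rightarrow> real)"
  using integrable_ball_kernel_mult[of "\<lambda>_. 1" 1 m] by (simp add: borel_measurable_indicator)

lemma integral_pos_of_ball:
  fixes g :: "'a::euclidean_space \<Rightarrow> real"
  assumes "integrable lborel g" "\<And>z. 0 \<le> g z" "0 < \<epsilon>" "0 < \<eta>" "\<And>z. z \<in> ball c \<eta> \<Longrightarrow> \<epsilon> \<le> g z"
  shows "0 < (\<integral>z. g z \<partial>lborel)"
proof -
  have "0 < \<epsilon> * measure lborel (ball c \<eta>)"
    using assms by (simp add: content_ball_pos)
  also have "\<dots> = (\<integral>z. \<epsilon> * indicator (ball c \<eta>) z \<partial>lborel)"
    by simp
  also have "\<dots> \<le> (\<integral>z. g z \<partial>lborel)"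
    using assms
    by (intro integral_mono integrable_mult_right integrable_real_indicator emeasure_lborel_ball_finite)
       (auto simp: indicator_def)
  finally show ?thesis .
qed

lemma ball_kernel_ge_half:
  assumes "z \<in> ball 0 (1/2)" shows "(1/2) ^ m \<le> ball_kernel m z"
proof -
  have n: "norm z < 1/2" using assms by simp
  then have "(norm z)\<^sup>2 \<le> (1/2)\<^sup>2" by (intro power_mono) auto
  then have "(1/2::real) ^ m \<le> (1 - (norm z)\<^sup>2) ^ m" by (intro power_mono) (auto simp: power2_eq_square)
  with n show ?thesis by (simp add: ball_kernel_def)
qed

lemma ball_kernel_integral_pos: "0 < (\<integral>z. ball_kernel m (z::'a::euclidean_space) \<partial>lborel)"
  by (rule integral_pos_of_ball[OF integrable_ball_kernel ball_kernel_nonneg, of "(1/2)^m" "1/2" 0])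
     (auto intro!: ball_kernel_ge_half)

lemma bounded_measurable_subset: "bounded_measurable_on S u \<Longrightarrow> T \<subseteq> S \<Longrightarrow> T \<in> sets borel \<Longrightarrow> bounded_measurable_on T u"
proof -
  assume a: "bounded_measurable_on S u" "T \<subseteq> S" "T \<in> sets borel"
  have "(\<lambda>x. indicator T x * u x) = (\<lambda>x. indicator T x * (indicator S x * u x))"
    using a(2) by (intro ext) (auto simp: indicator_def)
  moreover have "(\<lambda>x. indicator T x * (indicator S x * u x)) \<in> borel_measurable borel"
    using a(3) by (intro borel_measurable_times borel_measurable_indicator bounded_measurable_measurable a(1)) auto
  ultimately show "bounded_measurable_on T u" using a unfolding bounded_measurable_on_def by (metis subsetD)
qed

lemma bounded_measurable_continuous_closure:
  assumes "continuous_on (closure S) u" "bounded S" "open S"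
  shows "bounded_measurable_on S u"
proof -
  have "(\<lambda>x. indicator S x *\<^sub>R u x) \<in> borel_measurable borel"
    using assms by (intro borel_measurable_continuous_on_indicator) (auto intro: continuous_on_subset[OF _ closure_subset])
  moreover have "bounded (u ` closure S)"
    using assms by (intro compact_imp_bounded compact_continuous_image) (auto simp: compact_closure)
  ultimately show ?thesis
    unfolding bounded_measurable_on_def bounded_iff using closure_subset by fastforce
qed

lemma bounded_measurable_const: "S \<in> sets borel \<Longrightarrow> bounded_measurable_on S (\<lambda>_. c)"
  by (auto simp: bounded_measurable_on_def)

lemma bounded_measurable_add: "bounded_measurable_on S u \<Longrightarrow> bounded_measurable_on S v \<Longrightarrow> bounded_measurable_on S (\<lambda>x. u x + v x)"
proof -
  assume a: "bounded_measurable_on S u" "bounded_measurable_on S v"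
  then obtain C D where "\<And>x. x \<in> S \<Longrightarrow> \<bar>u x\<bar> \<le> C" "\<And>x. x \<in> S \<Longrightarrow> \<bar>v x\<bar> \<le> D"
    unfolding bounded_measurable_on_def by auto
  then have "\<forall>x\<in>S. \<bar>u x + v x\<bar> \<le> C + D" by (smt (verit))
  moreover have "(\<lambda>x. indicator S x * u x + indicator S x * v x) \<in> borel_measurable borel"
    by (intro borel_measurable_add bounded_measurable_measurable a)
  ultimately show ?thesis unfolding bounded_measurable_on_def by (auto simp: distrib_left)
qed

lemma bounded_measurable_cmult: "bounded_measurable_on S u \<Longrightarrow> bounded_measurable_on S (\<lambda>x. c * u x)"
proof -
  assume a: "bounded_measurable_on S u"
  then obtain C where "\<And>x. x \<in> S \<Longrightarrow> \<bar>u x\<bar> \<le> C"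
    unfolding bounded_measurable_on_def by auto
  then have "\<forall>x\<in>S. \<bar>c * u x\<bar> \<le> \<bar>c\<bar> * C" by (auto simp: abs_mult intro!: mult_left_mono)
  moreover have "(\<lambda>x. c * (indicator S x * u x)) \<in> borel_measurable borel"
    by (intro borel_measurable_times bounded_measurable_measurable a) simp
  ultimately show ?thesis unfolding bounded_measurable_on_def by (auto simp: mult.left_commute)
qed

lemma affine_unit_ball:
  fixes x :: "'a::euclidean_space"
  assumes "0 < r"
  shows "x + r *\<^sub>R z \<in> ball x r \<longleftrightarrow> z \<in> ball 0 1"
  using assms by (simp add: dist_norm)

lemma bounded_measurable_affine:
  fixes x :: "'a::euclidean_space"
  assumes "0 < r" "bounded_measurable_on (ball x r) u"
  shows "bounded_measurable_on (ball 0 1) (\<lambda>z. u (x + r *\<^sub>R z))"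
proof -
  have "(\<lambda>z. (\<lambda>y. indicator (ball x r) y * u y) (x + r *\<^sub>R z)) \<in> borel_measurable borel"
    using assms(2) unfolding bounded_measurable_on_def
    by (intro measurable_compose[where N=borel and f="\<lambda>z. x + r *\<^sub>R z" and g="\<lambda>y. indicator (ball x r) y * u y"]) simp_all
  moreover have "(\<lambda>z. (\<lambda>y. indicator (ball x r) y * u y) (x + r *\<^sub>R z))
      = (\<lambda>z. indicator (ball 0 1) z * u (x + r *\<^sub>R z))"
    using affine_unit_ball[OF assms(1), of x] by (auto simp: indicator_def)
  moreover obtain C where "\<forall>y\<in>ball x r. \<bar>u y\<bar> \<le> C" using assms(2) by (auto simp: bounded_measurable_on_def)
  then have "\<forall>z\<in>ball 0 1. \<bar>u (x + r *\<^sub>R z)\<bar> \<le> C" using affine_unit_ball[OF assms(1), of x] by blast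
  ultimately show ?thesis unfolding bounded_measurable_on_def by auto
qed

lemma weighted_mean_integrable:
  assumes "0 < r" "bounded_measurable_on (ball x r) u"
  shows "integrable lborel (\<lambda>z. ball_kernel m z * u (x + r *\<^sub>R z))"
proof -
  have b: "bounded_measurable_on (ball 0 1) (\<lambda>z. u (x + r *\<^sub>R z))" using bounded_measurable_affine[OF assms] .
  then obtain C where "\<forall>z\<in>ball 0 1. \<bar>u (x + r *\<^sub>R z)\<bar> \<le> C" by (auto simp: bounded_measurable_on_def)
  with b show ?thesis by (intro integrable_ball_kernel_mult[of _ C]) (auto simp: bounded_measurable_on_def)
qed

lemma weighted_mean_const: "weighted_mean m (x::'a::euclidean_space) r (\<lambda>_. c) = c"
  using ball_kernel_integral_pos[of m, where 'a='a] by (simp add: weighted_mean_def)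

lemma weighted_mean_cmult: "weighted_mean m x r (\<lambda>y. c * u y) = c * weighted_mean m x r u"
  by (simp add: weighted_mean_def mult.left_commute)

lemma weighted_mean_add:
  assumes "0 < r" "bounded_measurable_on (ball x r) u" "bounded_measurable_on (ball x r) v"
  shows "weighted_mean m x r (\<lambda>y. u y + v y) = weighted_mean m x r u + weighted_mean m x r v"
  using weighted_mean_integrable[OF assms(1,2), of m] weighted_mean_integrable[OF assms(1,3), of m]
  by (simp add: weighted_mean_def distrib_left add_divide_distrib)

lemma weighted_mean_diff:
  assumes "0 < r" "bounded_measurable_on (ball x r) u" "bounded_measurable_on (ball x r) v"
  shows "weighted_mean m x r (\<lambda>y. u y - v y) = weighted_mean m x r u - weighted_mean m x r v"
  using weighted_mean_integrable[OF assms(1,2), of m] weighted_mean_integrable[OF assms(1,3), of m]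
  by (simp add: weighted_mean_def right_diff_distrib diff_divide_distrib)

lemma weighted_mean_cong:
  assumes "0 < r" "\<And>y. y \<in> ball x r \<Longrightarrow> u y = v y"
  shows "weighted_mean m x r u = weighted_mean m x r v"
proof -
  have "ball_kernel m z * u (x + r *\<^sub>R z) = ball_kernel m z * v (x + r *\<^sub>R z)" for z
    using assms affine_unit_ball[OF assms(1), of x z] by (cases "z \<in> ball 0 1") (auto simp: ball_kernel_def)
  then show ?thesis by (simp only: weighted_mean_def)
qed

lemma weighted_mean_mono:
  assumes "0 < r" "bounded_measurable_on (ball x r) u" "bounded_measurable_on (ball x r) v" "\<And>y. y \<in> ball x r \<Longrightarrow> u y \<le> v y"
  shows "weighted_mean m x r u \<le> weighted_mean m x r v"
proof -
  have "ball_kernel m z * u (x + r *\<^sub>R z) \<le> ball_kernel m z * v (x + r *\<^sub>R z)" for z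
    using assms(4) affine_unit_ball[OF assms(1), of x z] ball_kernel_nonneg[of m z]
    by (cases "z \<in> ball 0 1") (auto simp: ball_kernel_def intro!: mult_left_mono)
  then show ?thesis unfolding weighted_mean_def
    using ball_kernel_integral_pos[of m] weighted_mean_integrable[OF assms(1,2), of m] weighted_mean_integrable[OF assms(1,3), of m]
    by (intro divide_right_mono integral_mono) (auto intro: less_imp_le)
qed

text \<open>
  The strict form of monotonicity behind the maximum principle: a mean reaches an upper bound only if
  the (continuous) function equals that bound throughout the ball.
\<close>
lemma weighted_mean_less_of_continuous:
  fixes x :: "'a::euclidean_space"
  assumes "0 < r" "bounded_measurable_on (ball x r) u" "continuous_on (ball x r) u"
    "\<And>y. y \<in> ball x r \<Longrightarrow> u y \<le> M" "y \<in> ball x r" "u y < M"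
  shows "weighted_mean 0 x r u < M"
proof -
  let ?g = "\<lambda>z. ball_kernel 0 z * (M - u (x + r *\<^sub>R z))"
  have int: "integrable lborel ?g"
    unfolding right_diff_distrib
    by (intro Bochner_Integration.integrable_diff weighted_mean_integrable[OF assms(1,2)] integrable_mult_left integrable_ball_kernel)
  obtain z0 where z0: "z0 \<in> ball 0 1" "y = x + r *\<^sub>R z0"
    using assms(1,5) affine_unit_ball[OF assms(1), of x "(1/r) *\<^sub>R (y - x)"] by fastforce
  have "continuous_on (ball 0 1) (\<lambda>z. u (x + r *\<^sub>R z))"
    using affine_unit_ball[OF assms(1), of x]
    by (intro continuous_on_compose2[OF assms(3)]) (auto intro!: continuous_intros)
  then have "continuous (at z0) (\<lambda>z. u (x + r *\<^sub>R z))"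
    using z0 continuous_on_eq_continuous_at open_ball by blast
  then have "((\<lambda>z. u (x + r *\<^sub>R z)) \<longlongrightarrow> u (x + r *\<^sub>R z0)) (nhds z0)"
    using tendsto_at_iff_tendsto_nhds[of "\<lambda>z. u (x + r *\<^sub>R z)" z0] by (simp add: continuous_at)
  moreover have "u (x + r *\<^sub>R z0) < (u y + M) / 2" using assms z0 by simp
  ultimately have "\<forall>\<^sub>F z in nhds z0. u (x + r *\<^sub>R z) < (u y + M) / 2"
    by (rule order_tendstoD(2))
  moreover have "\<forall>\<^sub>F z in nhds z0. z \<in> ball 0 1" using z0 by (intro eventually_nhds_in_open) auto
  ultimately have "\<forall>\<^sub>F z in nhds z0. u (x + r *\<^sub>R z) < (u y + M) / 2 \<and> z \<in> ball 0 1"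
    by eventually_elim auto
  then obtain \<eta> where \<eta>: "0 < \<eta>" "\<And>z. dist z z0 < \<eta> \<Longrightarrow> u (x + r *\<^sub>R z) < (u y + M) / 2 \<and> z \<in> ball 0 1"
    unfolding eventually_nhds_metric by auto
  have "0 < (\<integral>z. ?g z \<partial>lborel)"
  proof (rule integral_pos_of_ball[OF int])
    show "0 \<le> ?g z" for z
      using assms(4) affine_unit_ball[OF assms(1), of x z] ball_kernel_nonneg[of 0 z]
      by (cases "z \<in> ball 0 1") (auto simp: ball_kernel_def)
    show "0 < (M - u y) / 2" "0 < \<eta>" using assms \<eta> by auto
    show "z \<in> ball z0 \<eta> \<Longrightarrow> (M - u y) / 2 \<le> ?g z" for z
      using \<eta>(2)[of z] by (simp add: ball_kernel_def dist_commute)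
  qed
  then have "0 < M * (\<integral>z. ball_kernel 0 (z::'a) \<partial>lborel) - (\<integral>z. ball_kernel 0 z * u (x + r *\<^sub>R z) \<partial>lborel)"
    using Bochner_Integration.integral_diff[OF integrable_mult_right[OF integrable_ball_kernel, of M 0]
        weighted_mean_integrable[OF assms(1,2), of 0]]
    by (simp add: right_diff_distrib mult.commute[of _ M])
  then show ?thesis
    using ball_kernel_integral_pos[of 0, where 'a='a] by (simp add: weighted_mean_def field_simps)
qed

text \<open>
  Dominated convergence, with centre, radius and function all allowed to vary. A fixed function with
  varying ball gives continuity of the averaging map; a fixed ball with varying functions gives
  stability of the mean value property.
\<close>
lemma weighted_mean_tendsto:
  fixes x :: "'a::euclidean_space"
  assumes "\<And>k. (\<lambda>z. indicator (ball 0 1) z * u k (y k + s k *\<^sub>R z)) \<in> borel_measurable borel"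
    and "(\<lambda>z. indicator (ball 0 1) z * v (x + r *\<^sub>R z)) \<in> borel_measurable borel"
    and C: "\<And>k z. z \<in> ball 0 1 \<Longrightarrow> \<bar>u k (y k + s k *\<^sub>R z)\<bar> \<le> C"
    and lim: "\<And>z. z \<in> ball 0 1 \<Longrightarrow> (\<lambda>k. u k (y k + s k *\<^sub>R z)) \<longlonglongrightarrow> v (x + r *\<^sub>R z)"
  shows "(\<lambda>k. weighted_mean m (y k) (s k) (u k)) \<longlonglongrightarrow> weighted_mean m x r v"
proof -
  have eq: "(\<lambda>z. ball_kernel m z * g z) = (\<lambda>z. ball_kernel m z * (indicator (ball 0 1) z * g z))" for g :: "'a \<Rightarrow> real"
    by (auto simp: ball_kernel_def indicator_def)
  have "(\<lambda>k. \<integral>z. ball_kernel m z * u k (y k + s k *\<^sub>R z) \<partial>lborel)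
      \<longlonglongrightarrow> (\<integral>z. ball_kernel m z * v (x + r *\<^sub>R z) \<partial>lborel)"
  proof (rule integral_dominated_convergence)
    show "integrable lborel (\<lambda>z::'a. C * indicator (ball 0 1) z)"
      by (intro integrable_mult_right integrable_indicator_unit_ball)
    show "(\<lambda>z. ball_kernel m z * v (x + r *\<^sub>R z)) \<in> borel_measurable lborel"
      "(\<lambda>z. ball_kernel m z * u k (y k + s k *\<^sub>R z)) \<in> borel_measurable lborel" for k
      by (subst eq, use assms(1,2) in simp)+
    show "AE z in lborel. (\<lambda>k. ball_kernel m z * u k (y k + s k *\<^sub>R z)) \<longlonglongrightarrow> ball_kernel m z * v (x + r *\<^sub>R z)"
    proof (rule AE_I2)
      fix z :: 'a
      show "(\<lambda>k. ball_kernel m z * u k (y k + s k *\<^sub>R z)) \<longlonglongrightarrow> ball_kernel m z * v (x + r *\<^sub>R z)"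
        using lim[of z] by (cases "z \<in> ball 0 1") (auto simp: ball_kernel_def intro!: tendsto_intros)
    qed
    show "AE z in lborel. norm (ball_kernel m z * u k (y k + s k *\<^sub>R z)) \<le> C * indicator (ball 0 1) z" for k
    proof (rule AE_I2)
      fix z :: 'a
      show "norm (ball_kernel m z * u k (y k + s k *\<^sub>R z)) \<le> C * indicator (ball 0 1) z"
      proof (cases "z \<in> ball 0 1")
        case True
        then have "ball_kernel m z \<le> 1" "0 \<le> ball_kernel m z"
          using ball_kernel_le_indicator[of m z] ball_kernel_nonneg[of m z] by auto
        then have "ball_kernel m z * \<bar>u k (y k + s k *\<^sub>R z)\<bar> \<le> 1 * C"
          using C[OF True, of k] by (intro mult_mono) auto
        with True \<open>0 \<le> ball_kernel m z\<close> show ?thesis by (simp add: abs_mult)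
      qed (simp add: ball_kernel_def)
    qed
  qed
  then show ?thesis unfolding weighted_mean_def
    using ball_kernel_integral_pos[of m, where 'a='a] by (intro tendsto_divide) auto
qed

lemma lborel_integral_affine:
  fixes x :: "'a::euclidean_space" and g :: "'a \<Rightarrow> real"
  assumes "0 < r" "g \<in> borel_measurable borel"
  shows "(\<integral>y. g y \<partial>lborel) = r ^ DIM('a) * (\<integral>z. g (x + r *\<^sub>R z) \<partial>lborel)"
proof -
  have "(\<integral>y. g y \<partial>lborel) = (\<integral>y. g y \<partial>density (distr lborel borel (\<lambda>z. x + r *\<^sub>R z)) (\<lambda>_. ennreal (r ^ DIM('a))))"
    using lborel_affine[of r x] assms by simp
  also have "\<dots> = (\<integral>y. r ^ DIM('a) *\<^sub>R g y \<partial>distr lborel borel (\<lambda>z. x + r *\<^sub>R z))"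
    using assms by (intro integral_density) auto
  also have "\<dots> = (\<integral>z. r ^ DIM('a) *\<^sub>R g (x + r *\<^sub>R z) \<partial>lborel)"
    using assms by (intro integral_distr) auto
  finally show ?thesis by simp
qed

text \<open>
  In this form the point \<open>x\<close> enters through the kernel alone, so the smoothness of the
  kernel is inherited by the mean as a function of \<open>x\<close>, however rough \<open>u\<close> is.
\<close>
lemma weighted_mean_conv:
  fixes x :: "'a::euclidean_space"
  assumes "0 < r" "bounded_measurable_on (ball x r) u"
  shows "weighted_mean m x r u = (\<integral>y. ball_kernel m ((1/r) *\<^sub>R (y - x)) * u y \<partial>lborel)
     / (r ^ DIM('a) * (\<integral>z. ball_kernel m (z::'a) \<partial>lborel))"
proof -
  have mem: "(1/r) *\<^sub>R (y - x) \<in> ball 0 1 \<longleftrightarrow> y \<in> ball x r" for y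
    using affine_unit_ball[OF assms(1), of x "(1/r) *\<^sub>R (y - x)"] assms(1) by simp
  have "(\<lambda>y. ball_kernel m ((1/r) *\<^sub>R (y - x)) * u y)
      = (\<lambda>y. ball_kernel m ((1/r) *\<^sub>R (y - x)) * (indicator (ball x r) y * u y))"
    using mem by (fastforce simp: ball_kernel_def indicator_def)
  moreover have "(\<lambda>y. ball_kernel m ((1/r) *\<^sub>R (y - x)) * (indicator (ball x r) y * u y)) \<in> borel_measurable borel"
    by (intro borel_measurable_times measurable_compose[OF _ ball_kernel_measurable] bounded_measurable_measurable assms) simp
  ultimately have "(\<lambda>y. ball_kernel m ((1/r) *\<^sub>R (y - x)) * u y) \<in> borel_measurable borel"
    by simp
  from lborel_integral_affine[OF assms(1) this, of x] assms(1)
  show ?thesis by (simp add: weighted_mean_def)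
qed

lemma averaging_eq_weighted_mean:
  fixes x :: "'a::euclidean_space"
  assumes "x \<in> \<Omega>" "0 < \<delta> x" "bounded_measurable_on (ball x (\<delta> x)) f"
  shows "averaging \<Omega> \<delta> f x = weighted_mean 0 x (\<delta> x) f"
proof -
  let ?r = "\<delta> x"
  have mem: "(1/?r) *\<^sub>R (y - x) \<in> ball 0 1 \<longleftrightarrow> y \<in> ball x ?r" for y
    using affine_unit_ball[OF assms(2), of x "(1/?r) *\<^sub>R (y - x)"] assms(2) by simp
  have k: "ball_kernel 0 ((1/?r) *\<^sub>R (y - x)) = indicator (ball x ?r) y" for y
    using mem[of y] by (simp only: ball_kernel_def indicator_def) simp
  have "(\<integral>y. ball_kernel 0 ((1/?r) *\<^sub>R (y - x)) \<partial>lborel) = ?r ^ DIM('a) * (\<integral>z. ball_kernel 0 (z::'a) \<partial>lborel)"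
    using lborel_integral_affine[OF assms(2), of "\<lambda>y. ball_kernel 0 ((1/?r) *\<^sub>R (y - x))" x] assms(2)
    by (simp add: measurable_compose[OF _ ball_kernel_measurable])
  then have den: "?r ^ DIM('a) * (\<integral>z. ball_kernel 0 (z::'a) \<partial>lborel) = measure lebesgue (ball x ?r)"
    by (simp add: k)
  have "(LINT z:ball x ?r|lebesgue. f z) = (\<integral>z. indicator (ball x ?r) z * f z \<partial>lborel)"
    using assms(3) unfolding set_lebesgue_integral_def bounded_measurable_on_def
    by (subst integral_completion) auto
  then show ?thesis
    unfolding weighted_mean_conv[OF assms(2,3)] den k using assms(1) by (simp add: averaging_def)
qed

section \<open>The mean value property of functions with zero Laplacian\<close>

text \<open>
  The working substitute for harmonicity: a linear condition that survives uniform limits and bounded pointwise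
  limits. Asking for all exponents at once supplies both the plain average and the smooth kernels.
\<close>
definition mean_value_property :: "'a::euclidean_space set \<Rightarrow> ('a \<Rightarrow> real) \<Rightarrow> bool" where
  "mean_value_property S u \<longleftrightarrow> (\<forall>x r m. 0 < r \<and> ball x r \<subseteq> S \<longrightarrow> weighted_mean m x r u = u x)"

text \<open>
  \<open>G\<close> is the gradient of \<open>h\<close>, and \<open>H b\<close> is the second derivative of \<open>h\<close> in
  the coordinate direction \<open>b\<close>, so \<open>L\<close> is the Laplacian. Carrying the gradient explicitly lets the
  product rule \<open>\<Delta>(f g) = f \<Delta>g + g \<Delta>f + 2 \<nabla>f \<bullet> \<nabla>g\<close> be stated without differentiating again.
\<close>
definition has_laplacian :: "('a::euclidean_space \<Rightarrow> real) \<Rightarrow> ('a \<Rightarrow> 'a) \<Rightarrow> ('a \<Rightarrow> real) \<Rightarrow> bool" where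
  "has_laplacian h G L \<longleftrightarrow> (\<forall>x. (h has_derivative (\<lambda>v. G x \<bullet> v)) (at x)) \<and> continuous_on UNIV G \<and>
     (\<exists>H. (\<forall>b\<in>Basis. continuous_on UNIV (H b) \<and>
             (\<forall>x \<tau>. ((\<lambda>t. G (x + t *\<^sub>R b) \<bullet> b) has_field_derivative H b (x + \<tau> *\<^sub>R b)) (at \<tau>))) \<and>
          (\<forall>x. L x = (\<Sum>b\<in>Basis. H b x)))"

lemma ball_kernel_eq_max:
  assumes "m \<noteq> 0" shows "ball_kernel m z = (max 0 (1 - (norm z)\<^sup>2)) ^ m"
proof (cases "norm z < 1")
  case True
  then have "(norm z)\<^sup>2 \<le> 1" by (simp add: power_le_one)
  with True show ?thesis by (simp add: ball_kernel_def)
next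
  case False
  then have "1 \<le> (norm z)\<^sup>2" by (simp add: one_le_power)
  with False assms show ?thesis by (simp add: ball_kernel_def max_absorb1)
qed

lemma lborel_integral_eq_integral_on:
  fixes f :: "'a::euclidean_space \<Rightarrow> real"
  assumes "continuous_on (cbox a b) f" "\<And>z. z \<notin> cbox a b \<Longrightarrow> f z = 0"
  shows "integrable lborel f" "(\<integral>z. f z \<partial>lborel) = integral (cbox a b) f"
proof -
  have eq: "(\<lambda>z. indicator (cbox a b) z *\<^sub>R f z) = f"
    using assms(2) by (intro ext) (auto simp: indicator_def)
  have "set_integrable lborel (cbox a b) f"
    unfolding set_integrable_def
    by (intro borel_integrable_compact compact_cbox assms(1))
  with set_borel_integral_eq_integral(2)[OF this]
  show "integrable lborel f" "(\<integral>z. f z \<partial>lborel) = integral (cbox a b) f"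
    by (simp_all only: set_integrable_def set_lebesgue_integral_def eq)
qed

lemma lborel_integral_eq_integral:
  fixes f :: "'a::euclidean_space \<Rightarrow> real"
  assumes "continuous_on UNIV f" "\<And>z. z \<notin> cbox a b \<Longrightarrow> f z = 0"
  shows "integrable lborel f" "(\<integral>z. f z \<partial>lborel) = integral (cbox a b) f"
  using lborel_integral_eq_integral_on[OF continuous_on_subset[OF assms(1) subset_UNIV] assms(2)] by blast+

lemma norm_gt_of_not_in_cbox:
  fixes z :: "'a::euclidean_space"
  assumes "z \<notin> cbox (- (c *\<^sub>R One)) (c *\<^sub>R One)" shows "c < norm z"
proof (rule ccontr)
  assume "\<not> c < norm z"
  then have "\<bar>z \<bullet> i\<bar> \<le> c" if "i \<in> Basis" for i using Basis_le_norm[OF that, of z] by linarith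
  then show False using assms by (auto simp: mem_box abs_le_iff minus_le_iff)
qed

text \<open>
  Integration by parts in its simplest form. By translation invariance the integral of \<open>F (z + t b)\<close>
  does not depend on \<open>t\<close>; differentiating under the integral sign at \<open>t = 0\<close> gives the claim.
\<close>
lemma integral_partial_zero:
  fixes F F' :: "'a::euclidean_space \<Rightarrow> real"
  assumes F: "continuous_on UNIV F" "continuous_on UNIV F'"
    and d: "\<And>x \<tau>. ((\<lambda>t. F (x + t *\<^sub>R b)) has_field_derivative F' (x + \<tau> *\<^sub>R b)) (at \<tau>)"
    and zero: "\<And>z. 1 \<le> norm z \<Longrightarrow> F z = 0" "\<And>z. 1 \<le> norm z \<Longrightarrow> F' z = 0"
    and b: "b \<in> Basis"
  shows "(\<integral>z. F' z \<partial>lborel) = 0"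
proof -
  define Q where "Q = cbox (- (2 *\<^sub>R One)) (2 *\<^sub>R One :: 'a)"
  let ?\<phi> = "\<lambda>t. integral Q (\<lambda>z. F (z + t *\<^sub>R b))"
  have cont: "continuous_on UNIV (\<lambda>z. F (z + t *\<^sub>R b))" for t
    by (intro continuous_on_compose2[OF F(1)] continuous_intros) auto
  have const: "?\<phi> t = (\<integral>z. F z \<partial>lborel)" if t: "\<bar>t\<bar> < 1" for t
  proof -
    have "F (z + t *\<^sub>R b) = 0" if "z \<notin> Q" for z
    proof (rule zero)
      have "2 < norm z" using that norm_gt_of_not_in_cbox unfolding Q_def by blast
      moreover have "norm (t *\<^sub>R b) < 1" using t b by simp
      ultimately show "1 \<le> norm (z + t *\<^sub>R b)" using norm_triangle_ineq2[of z "- (t *\<^sub>R b)"] by simp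
    qed
    then have "?\<phi> t = (\<integral>z. F (z + t *\<^sub>R b) \<partial>lborel)"
      unfolding Q_def by (subst lborel_integral_eq_integral(2)[OF cont]) auto
    also have "\<dots> = (\<integral>z. F z \<partial>lborel)"
      using lborel_integral_affine[of 1 F "t *\<^sub>R b"] F(1)
      by (simp add: borel_measurable_continuous_onI add.commute)
    finally show ?thesis .
  qed
  have "(?\<phi> has_field_derivative integral Q (\<lambda>z. F' (z + 0 *\<^sub>R b))) (at 0 within UNIV)"
    unfolding Q_def
  proof (rule leibniz_rule_field_derivative)
    show "((\<lambda>t. F (z + t *\<^sub>R b)) has_real_derivative F' (z + \<tau> *\<^sub>R b)) (at \<tau>)" for z \<tau>
      using d .
    show "(\<lambda>z. F (z + t *\<^sub>R b)) integrable_on cbox (- (2 *\<^sub>R One)) (2 *\<^sub>R One)" for t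
      by (intro integrable_continuous continuous_on_subset[OF cont]) auto
    show "continuous_on (UNIV \<times> cbox (- (2 *\<^sub>R One)) (2 *\<^sub>R One)) (\<lambda>(t, z). F' (z + t *\<^sub>R b))"
      unfolding split_beta by (intro continuous_on_compose2[OF F(2)] continuous_intros) auto
  qed auto
  moreover have "(?\<phi> has_field_derivative 0) (at 0)"
  proof (rule DERIV_cong_ev[THEN iffD1, of 0 0 "\<lambda>_. \<integral>z. F z \<partial>lborel" _ 0])
    have "\<forall>\<^sub>F t in nhds (0::real). t \<in> {-1<..<1}" by (intro eventually_nhds_in_open) auto
    then show "\<forall>\<^sub>F t in nhds 0. (\<integral>z. F z \<partial>lborel) = ?\<phi> t"
      by eventually_elim (use const in auto)
  qed auto
  ultimately have "integral Q F' = 0" using DERIV_unique by fastforce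
  moreover have "F' z = 0" if "z \<notin> Q" for z
    using norm_gt_of_not_in_cbox[of z 2] that zero(2)[of z] unfolding Q_def by auto
  ultimately show ?thesis
    using lborel_integral_eq_integral(2)[OF F(2), of "- (2 *\<^sub>R One)" "2 *\<^sub>R One"]
    unfolding Q_def by simp
qed

lemma continuous_antiderivative_vanishing:
  fixes w :: "real \<Rightarrow> real"
  assumes "continuous_on UNIV w" "\<And>t. t \<le> 0 \<Longrightarrow> w t = 0"
  obtains W where "\<And>t. (W has_field_derivative w t) (at t)" "\<And>t. t \<le> 0 \<Longrightarrow> W t = 0"
proof -
  have "\<exists>F. \<forall>x. (-\<infinity>::ereal) < ereal x \<longrightarrow> ereal x < \<infinity> \<longrightarrow> (F has_vector_derivative w x) (at x)"
    using assms(1) by (intro einterval_antiderivative) (auto simp: continuous_on_eq_continuous_at)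
  then obtain F where F: "\<And>x. (F has_field_derivative w x) (at x)"
    by (auto simp: has_real_derivative_iff_has_vector_derivative)
  have "F t = F 0" if "t \<le> 0" for t
  proof (cases "t = 0")
    case False
    then have "t < 0" using that by simp
    have "continuous_on {t..0} F"
      using F by (meson DERIV_isCont continuous_at_imp_continuous_on)
    moreover have "(F has_field_derivative 0) (at y)" if "t < y" "y < 0" for y
      using F[of y] assms(2)[of y] that by simp
    ultimately show ?thesis using DERIV_isconst_end[OF \<open>t < 0\<close>, of F] by fastforce
  qed simp
  note const = this
  show thesis
  proof (intro that[of "\<lambda>t. F t - F 0"])
    show "((\<lambda>t. F t - F 0) has_field_derivative w t) (at t)" for t
      using DERIV_diff[OF F DERIV_const] by simp
    show "F t - F 0 = 0" if "t \<le> 0" for t using const[OF that] by (simp only: diff_self)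
  qed
qed

lemma has_laplacian_line:
  assumes "has_laplacian h G L"
  shows "((\<lambda>t. h (x + t *\<^sub>R v)) has_field_derivative G (x + \<tau> *\<^sub>R v) \<bullet> v) (at \<tau>)"
proof -
  have "((\<lambda>t. h (x + t *\<^sub>R v)) has_derivative (\<lambda>t. G (x + \<tau> *\<^sub>R v) \<bullet> (t *\<^sub>R v))) (at \<tau>)"
    using assms unfolding has_laplacian_def
    by (intro has_derivative_compose[where f="\<lambda>t. x + t *\<^sub>R v" and g=h]) (auto intro!: derivative_eq_intros)
  then show ?thesis by (simp add: has_field_derivative_def mult.commute[of _ "_ \<bullet> _"] ) 
qed

lemma has_laplacian_continuous: "has_laplacian h G L \<Longrightarrow> continuous_on A h"
  unfolding has_laplacian_def by (meson continuous_at_imp_continuous_on has_derivative_continuous)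

text \<open>
  Let \<open>\<phi> \<rho>\<close> be the weighted integral over the ball of radius \<open>\<rho>\<close>. With \<open>W' = w\<close>, the
  derivative of \<open>\<phi>\<close> is the integral of \<open>w(1 - |z|\<^sup>2) (\<nabla>h \<bullet> z)\<close>, and up to the factor \<open>-1/2\<close> this
  integrand differs from the divergence of \<open>W(1 - |z|\<^sup>2) \<nabla>h(x + \<rho> z)\<close> only by a
  multiple of \<open>\<Delta>h = 0\<close>. The field vanishes on the unit sphere, so \<open>\<phi>\<close> is constant and
  \<open>\<phi> r = \<phi> 0\<close>.
\<close>
lemma laplacian_zero_radial_mean:
  fixes h :: "'a::euclidean_space \<Rightarrow> real"
  assumes h: "has_laplacian h G (\<lambda>_. 0)"
    and w: "continuous_on UNIV w" "\<And>t. t \<le> 0 \<Longrightarrow> w t = 0"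
  shows "(\<integral>z. w (1 - (norm z)\<^sup>2) * h (x + r *\<^sub>R z) \<partial>lborel) = h x * (\<integral>z. w (1 - (norm (z::'a))\<^sup>2) \<partial>lborel)"
proof -
  obtain W where W: "\<And>t. (W has_field_derivative w t) (at t)" "\<And>t. t \<le> 0 \<Longrightarrow> W t = 0"
    using continuous_antiderivative_vanishing[OF w] by blast
  have contW: "continuous_on UNIV W"
    using W(1) by (meson DERIV_isCont continuous_at_imp_continuous_on)
  obtain H where H: "\<And>b. b \<in> Basis \<Longrightarrow> continuous_on UNIV (H b)"
     "\<And>b x \<tau>. b \<in> Basis \<Longrightarrow> ((\<lambda>t. G (x + t *\<^sub>R b) \<bullet> b) has_field_derivative H b (x + \<tau> *\<^sub>R b)) (at \<tau>)"
     "\<And>x. (\<Sum>b\<in>Basis. H b x) = 0" and G: "continuous_on UNIV G"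
    using h unfolding has_laplacian_def by metis
  have contq: "continuous_on UNIV (\<lambda>z::'a. w (1 - (norm z)\<^sup>2))" "continuous_on UNIV (\<lambda>z::'a. W (1 - (norm z)\<^sup>2))"
    by (intro continuous_on_compose2[OF w(1)] continuous_on_compose2[OF contW] continuous_intros; simp)+
  have contG: "continuous_on UNIV (\<lambda>z. G (x + \<rho> *\<^sub>R z))" for \<rho>
    by (intro continuous_on_compose2[OF G] continuous_intros) auto
  have conth: "continuous_on UNIV (\<lambda>z. h (x + \<rho> *\<^sub>R z))" for \<rho>
    by (intro continuous_on_compose2[OF has_laplacian_continuous[OF h, of UNIV]] continuous_intros) auto
  have contH: "continuous_on UNIV (\<lambda>z. H b (x + \<rho> *\<^sub>R z))" if "b \<in> Basis" for \<rho> b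
    by (intro continuous_on_compose2[OF H(1)[OF that]] continuous_intros) auto
  have q0: "1 - (norm z)\<^sup>2 \<le> 0" if "1 \<le> norm z" for z :: 'a
    using that by (simp add: one_le_power)
  \<comment> \<open>the terms of the divergence of \<open>W(1 - |z|\<^sup>2) \<nabla>h(x + \<rho> z)\<close>, one for each direction \<open>b\<close>\<close>
  define D where "D = (\<lambda>\<rho> b z. w (1 - (norm z)\<^sup>2) * (-2 * (z \<bullet> b)) * (G (x + \<rho> *\<^sub>R z) \<bullet> b)
      + W (1 - (norm z)\<^sup>2) * (\<rho> * H b (x + \<rho> *\<^sub>R z)))"
  have D0: "(\<integral>z. D \<rho> b z \<partial>lborel) = 0" and Dint: "integrable lborel (D \<rho> b)" if b: "b \<in> Basis" for \<rho> b
  proof -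
    have contD: "continuous_on UNIV (D \<rho> b)"
      unfolding D_def by (intro continuous_intros contq contG contH b)
    have "D \<rho> b z = 0" if "1 \<le> norm z" for z
      unfolding D_def using q0[OF that] w(2) W(2) by simp
    note zD = this
    show "(\<integral>z. D \<rho> b z \<partial>lborel) = 0"
    proof (rule integral_partial_zero[OF _ contD _ _ zD b])
      show "continuous_on UNIV (\<lambda>z. W (1 - (norm z)\<^sup>2) * (G (x + \<rho> *\<^sub>R z) \<bullet> b))"
        by (intro continuous_intros contq contG)
      show "W (1 - (norm z)\<^sup>2) * (G (x + \<rho> *\<^sub>R z) \<bullet> b) = 0" if "1 \<le> norm z" for z
        using q0[OF that] W(2) by simp
      fix y :: 'a and \<tau> :: real
      have 1: "((\<lambda>t. 1 - (norm (y + t *\<^sub>R b))\<^sup>2) has_field_derivative -2 * ((y + \<tau> *\<^sub>R b) \<bullet> b)) (at \<tau>)"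
        unfolding power2_norm_eq_inner inner_add_left inner_add_right inner_scaleR_left inner_scaleR_right
        by (auto intro!: derivative_eq_intros simp: inner_commute algebra_simps)
      have 2: "((\<lambda>t. W (1 - (norm (y + t *\<^sub>R b))\<^sup>2)) has_field_derivative
          w (1 - (norm (y + \<tau> *\<^sub>R b))\<^sup>2) * (-2 * ((y + \<tau> *\<^sub>R b) \<bullet> b))) (at \<tau>)"
        by (rule DERIV_chain2[OF W(1) 1])
      have "((\<lambda>t. G ((x + \<rho> *\<^sub>R y) + (\<rho> * t) *\<^sub>R b) \<bullet> b) has_field_derivative
          H b ((x + \<rho> *\<^sub>R y) + (\<rho> * \<tau>) *\<^sub>R b) * \<rho>) (at \<tau>)"
        by (rule DERIV_chain2[OF H(2)[OF b]]) (auto intro!: derivative_eq_intros)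
      then have 3: "((\<lambda>t. G (x + \<rho> *\<^sub>R (y + t *\<^sub>R b)) \<bullet> b) has_field_derivative
          \<rho> * H b (x + \<rho> *\<^sub>R (y + \<tau> *\<^sub>R b))) (at \<tau>)"
        by (simp add: algebra_simps)
      show "((\<lambda>t. W (1 - (norm (y + t *\<^sub>R b))\<^sup>2) * (G (x + \<rho> *\<^sub>R (y + t *\<^sub>R b)) \<bullet> b)) has_field_derivative
          D \<rho> b (y + \<tau> *\<^sub>R b)) (at \<tau>)"
        using DERIV_mult[OF 2 3] by (simp add: D_def algebra_simps)
    qed
    show "integrable lborel (D \<rho> b)"
      by (rule lborel_integral_eq_integral(1)[OF contD, of "- One" One])
         (use norm_gt_of_not_in_cbox[of _ 1] zD in \<open>auto intro: less_imp_le\<close>)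
  qed
  define Q where "Q = cbox (- (1 *\<^sub>R One)) (1 *\<^sub>R One :: 'a)"
  have zQ: "w (1 - (norm z)\<^sup>2) = 0" if "z \<notin> Q" for z
    using norm_gt_of_not_in_cbox[of z 1] that q0[of z] w(2) unfolding Q_def by auto
  define \<phi> where "\<phi> = (\<lambda>\<rho>. integral Q (\<lambda>z. w (1 - (norm z)\<^sup>2) * h (x + \<rho> *\<^sub>R z)))"
  have \<phi>: "\<phi> \<rho> = (\<integral>z. w (1 - (norm z)\<^sup>2) * h (x + \<rho> *\<^sub>R z) \<partial>lborel)" for \<rho>
    unfolding \<phi>_def Q_def
    by (rule lborel_integral_eq_integral(2)[symmetric])
       (use zQ in \<open>auto simp: Q_def intro!: continuous_intros contq conth\<close>)
  have "(\<phi> has_field_derivative 0) (at \<rho>)" for \<rho>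
  proof -
    let ?d = "\<lambda>z. w (1 - (norm z)\<^sup>2) * (G (x + \<rho> *\<^sub>R z) \<bullet> z)"
    have "?d z = (\<Sum>b\<in>Basis. -(1/2) * D \<rho> b z)" for z
    proof -
      have "-(1/2) * D \<rho> b z = w (1 - (norm z)\<^sup>2) * ((G (x + \<rho> *\<^sub>R z) \<bullet> b) * (z \<bullet> b))
          - (W (1 - (norm z)\<^sup>2) * \<rho> / 2) * H b (x + \<rho> *\<^sub>R z)" for b
        by (simp add: D_def algebra_simps)
      then have "(\<Sum>b\<in>Basis. -(1/2) * D \<rho> b z) = w (1 - (norm z)\<^sup>2) * (\<Sum>b\<in>Basis. (G (x + \<rho> *\<^sub>R z) \<bullet> b) * (z \<bullet> b))
          - W (1 - (norm z)\<^sup>2) * \<rho> / 2 * (\<Sum>b\<in>Basis. H b (x + \<rho> *\<^sub>R z))"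
        by (simp only: sum_subtractf sum_distrib_left)
      then show ?thesis
        using euclidean_inner[of "G (x + \<rho> *\<^sub>R z)" z] by (simp only: H(3) mult_zero_right diff_zero)
    qed
    then have "(\<integral>z. ?d z \<partial>lborel) = (\<Sum>b\<in>Basis. -(1/2) * (\<integral>z. D \<rho> b z \<partial>lborel))"
      using Dint by (simp add: Bochner_Integration.integral_sum sum_negf sum_divide_distrib[symmetric])
    then have d0: "(\<integral>z. ?d z \<partial>lborel) = 0" using D0 by simp
    have "integral Q ?d = (\<integral>z. ?d z \<partial>lborel)"
      unfolding Q_def
      by (rule lborel_integral_eq_integral(2)[symmetric])
         (use zQ in \<open>auto simp: Q_def intro!: continuous_intros contq contG\<close>)
    moreover have "(\<phi> has_field_derivative integral Q ?d) (at \<rho> within UNIV)"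
      unfolding \<phi>_def Q_def
    proof (rule leibniz_rule_field_derivative)
      show "((\<lambda>\<rho>. w (1 - (norm z)\<^sup>2) * h (x + \<rho> *\<^sub>R z)) has_real_derivative
         w (1 - (norm z)\<^sup>2) * (G (x + \<rho> *\<^sub>R z) \<bullet> z)) (at \<rho>)" for z \<rho>
        by (rule DERIV_cmult[OF has_laplacian_line[OF h]])
      show "(\<lambda>z. w (1 - (norm z)\<^sup>2) * h (x + \<rho> *\<^sub>R z)) integrable_on cbox (- (1 *\<^sub>R One)) (1 *\<^sub>R One)" for \<rho>
        by (rule integrable_continuous, rule continuous_on_subset[of UNIV])
           (auto intro!: continuous_intros contq conth)
      show "continuous_on (UNIV \<times> cbox (- (1 *\<^sub>R One)) (1 *\<^sub>R One)) (\<lambda>(\<rho>, z). w (1 - (norm z)\<^sup>2) * (G (x + \<rho> *\<^sub>R z) \<bullet> z))"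
        unfolding split_beta
        by (intro continuous_on_compose2[OF G] continuous_on_compose2[OF w(1)] continuous_intros) auto
    qed auto
    ultimately show ?thesis using d0 by simp
  qed
  then have "\<phi> r = \<phi> 0" using DERIV_isconst_all by blast
  then show ?thesis by (simp add: \<phi> mult.commute)
qed

text \<open>
  For \<open>m > 0\<close> the kernel is a continuous function of \<open>1 - |z|\<^sup>2\<close>. For \<open>m = 0\<close> it is the indicator of the
  ball, which is the bounded limit of the continuous weights \<open>min 1 (max 0 (j t))\<close>.
\<close>
lemma laplacian_zero_weighted_mean:
  fixes h :: "'a::euclidean_space \<Rightarrow> real"
  assumes h: "has_laplacian h G (\<lambda>_. 0)"
  shows "weighted_mean m x r h = h x"
proof -
  have "(\<integral>z. ball_kernel m z * h (x + r *\<^sub>R z) \<partial>lborel) = h x * (\<integral>z. ball_kernel m (z::'a) \<partial>lborel)"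
  proof (cases "m = 0")
    case False
    note k = ball_kernel_eq_max[OF False]
    have "continuous_on UNIV (\<lambda>t::real. (max 0 t) ^ m)" by (intro continuous_intros)
    then show ?thesis unfolding k
      using False by (intro laplacian_zero_radial_mean[OF h]) auto
  next
    case True
    define w where "w = (\<lambda>j t. min 1 (max 0 (real j * t)))"
    have lim: "(\<lambda>j. w j (1 - (norm z)\<^sup>2)) \<longlonglongrightarrow> ball_kernel m z" for z :: 'a
    proof (cases "norm z < 1")
      case T: True
      then have "0 < 1 - (norm z)\<^sup>2" by (simp add: abs_square_less_1)
      then obtain N where "1 < real N * (1 - (norm z)\<^sup>2)" using reals_Archimedean3 by blast
      have "w j (1 - (norm z)\<^sup>2) = 1" if "N \<le> j" for j
      proof -
        have "real N * (1 - (norm z)\<^sup>2) \<le> real j * (1 - (norm z)\<^sup>2)"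
          using that \<open>0 < 1 - (norm z)\<^sup>2\<close> by (intro mult_right_mono) auto
        with \<open>1 < real N * (1 - (norm z)\<^sup>2)\<close> have "1 \<le> real j * (1 - (norm z)\<^sup>2)" by linarith
        then show ?thesis unfolding w_def by linarith
      qed
      then have "\<forall>\<^sub>F j in sequentially. w j (1 - (norm z)\<^sup>2) = ball_kernel m z"
        using T True by (auto simp: eventually_sequentially ball_kernel_def)
      then show ?thesis by (rule tendsto_eventually)
    next
      case F: False
      then have "1 \<le> (norm z)\<^sup>2" by (simp add: one_le_power)
      then have "real j * (1 - (norm z)\<^sup>2) \<le> 0" for j by (intro mult_nonneg_nonpos) auto
      then show ?thesis using F True by (simp add: ball_kernel_def w_def max_absorb1)
    qed
    have wb: "\<bar>w j (1 - (norm z)\<^sup>2)\<bar> \<le> indicator (cbox (- (1 *\<^sub>R One)) (1 *\<^sub>R One)) z" for j and z :: 'a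
    proof (cases "z \<in> cbox (- (1 *\<^sub>R One)) (1 *\<^sub>R One :: 'a)")
      case False
      then have "1 \<le> (norm z)\<^sup>2" using norm_gt_of_not_in_cbox[OF False] by (simp add: one_le_power)
      then have "real j * (1 - (norm z)\<^sup>2) \<le> 0" by (intro mult_nonneg_nonpos) auto
      then show ?thesis by (simp add: w_def max_absorb1)
    qed (auto simp: w_def)
    have contw: "continuous_on UNIV (\<lambda>z::'a. w j (1 - (norm z)\<^sup>2))" for j
      unfolding w_def by (intro continuous_intros)
    have lim_integral: "(\<lambda>j. \<integral>z. w j (1 - (norm z)\<^sup>2) * g z \<partial>lborel) \<longlonglongrightarrow> (\<integral>z. ball_kernel m z * g z \<partial>lborel)"
      if g: "continuous_on UNIV g" for g :: "'a \<Rightarrow> real"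
    proof -
      have "bounded (g ` cbox (- (1 *\<^sub>R One)) (1 *\<^sub>R One))"
        by (intro compact_imp_bounded compact_continuous_image continuous_on_subset[OF g]) auto
      then obtain C where C: "\<And>z. z \<in> cbox (- (1 *\<^sub>R One)) (1 *\<^sub>R One) \<Longrightarrow> \<bar>g z\<bar> \<le> C"
        by (auto simp: bounded_iff)
      show ?thesis
      proof (rule integral_dominated_convergence)
      show "integrable lborel (\<lambda>z::'a. \<bar>C\<bar> * indicator (cbox (- (1 *\<^sub>R One)) (1 *\<^sub>R One)) z)"
        by (intro integrable_mult_right integrable_real_indicator) (auto simp: emeasure_lborel_cbox_finite)
      show "AE z in lborel. norm (w j (1 - (norm z)\<^sup>2) * g z) \<le> \<bar>C\<bar> * indicator (cbox (- (1 *\<^sub>R One)) (1 *\<^sub>R One)) z" for j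
      proof (rule AE_I2)
        fix z :: 'a
        show "norm (w j (1 - (norm z)\<^sup>2) * g z) \<le> \<bar>C\<bar> * indicator (cbox (- (1 *\<^sub>R One)) (1 *\<^sub>R One)) z"
        proof (cases "z \<in> cbox (- (1 *\<^sub>R One)) (1 *\<^sub>R One)")
          case True
          with wb[of j z] C[OF True] have "\<bar>w j (1 - (norm z)\<^sup>2)\<bar> * \<bar>g z\<bar> \<le> 1 * \<bar>C\<bar>"
            by (intro mult_mono) auto
          with True show ?thesis by (simp add: abs_mult)
        next
          case False
          with wb[of j z] show ?thesis by simp
        qed
      qed
      show "AE z in lborel. (\<lambda>j. w j (1 - (norm z)\<^sup>2) * g z) \<longlonglongrightarrow> ball_kernel m z * g z"
        by (intro AE_I2 tendsto_intros lim)
      show "(\<lambda>z. ball_kernel m z * g z) \<in> borel_measurable lborel" "(\<lambda>z. w j (1 - (norm z)\<^sup>2) * g z) \<in> borel_measurable lborel" for j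
        using borel_measurable_continuous_onI[OF g] borel_measurable_continuous_onI[OF contw[of j]] by simp_all
      qed
    qed
    have conth: "continuous_on UNIV (\<lambda>z. h (x + r *\<^sub>R z))"
      by (intro continuous_on_compose2[OF has_laplacian_continuous[OF h, of UNIV]] continuous_intros) auto
    have "(\<integral>z. w j (1 - (norm z)\<^sup>2) * h (x + r *\<^sub>R z) \<partial>lborel) = h x * (\<integral>z. w j (1 - (norm (z::'a))\<^sup>2) \<partial>lborel)" for j
    proof (rule laplacian_zero_radial_mean[OF h])
      show "continuous_on UNIV (w j)" unfolding w_def by (intro continuous_intros)
      show "t \<le> 0 \<Longrightarrow> w j t = 0" for t by (auto simp: w_def max_absorb1 mult_nonneg_nonpos)
    qed
    then have "(\<lambda>j. \<integral>z. w j (1 - (norm z)\<^sup>2) * h (x + r *\<^sub>R z) \<partial>lborel)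
        \<longlonglongrightarrow> h x * (\<integral>z. ball_kernel m (z::'a) \<partial>lborel)"
      using tendsto_mult[OF tendsto_const lim_integral[of "\<lambda>_. 1"], of "h x"] by simp
    with lim_integral[OF conth] show ?thesis by (rule LIMSEQ_unique)
  qed
  then show ?thesis using ball_kernel_integral_pos[of m, where 'a='a] by (simp add: weighted_mean_def)
qed

lemma laplacian_zero_mean_value_property: "has_laplacian h G (\<lambda>_. 0) \<Longrightarrow> mean_value_property S h"
  by (simp add: mean_value_property_def laplacian_zero_weighted_mean)

section \<open>The Laplacian on polynomials\<close>

lemma has_laplacian_const: "has_laplacian (\<lambda>_. k) (\<lambda>_. 0) (\<lambda>_. 0)"
  unfolding has_laplacian_def inner_zero_left by (auto intro!: exI[of _ "\<lambda>_ _. 0"])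

lemma has_laplacian_inner: "has_laplacian (\<lambda>x. a \<bullet> (x - c)) (\<lambda>_. a) (\<lambda>_. 0)"
  unfolding has_laplacian_def
  by (auto intro!: exI[of _ "\<lambda>_ _. 0"] derivative_eq_intros)

lemma has_laplacian_sqdist:
  "has_laplacian (\<lambda>x::'a::euclidean_space. (x - c) \<bullet> (x - c)) (\<lambda>x. 2 *\<^sub>R (x - c)) (\<lambda>_. 2 * DIM('a))"
proof -
  have "((\<lambda>t. (2 *\<^sub>R (x + t *\<^sub>R b - c)) \<bullet> b) has_field_derivative 2) (at \<tau>)" if "b \<in> Basis" for b x :: 'a and \<tau>
  proof -
    have "((\<lambda>t. 2 * ((x - c) \<bullet> b) + 2 * t) has_field_derivative 2) (at \<tau>)"
      by (auto intro!: derivative_eq_intros)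
    moreover have "(2 *\<^sub>R (x + t *\<^sub>R b - c)) \<bullet> b = 2 * ((x - c) \<bullet> b) + 2 * t" for t
      using that by (simp add: inner_diff_left inner_add_left algebra_simps)
    ultimately show ?thesis by simp
  qed
  note H = this
  show ?thesis
    unfolding has_laplacian_def
  proof (intro conjI allI exI[of _ "\<lambda>_ _. 2"] ballI)
    show "((\<lambda>x. (x - c) \<bullet> (x - c)) has_derivative (\<bullet>) (2 *\<^sub>R (x - c))) (at x)" for x :: 'a
      by (auto intro!: derivative_eq_intros simp: inner_commute)
  qed (auto intro!: continuous_intros H simp del: inner_scaleR_left)
qed

lemma has_laplacian_add:
  assumes "has_laplacian h1 G1 L1" "has_laplacian h2 G2 L2"
  shows "has_laplacian (\<lambda>x. h1 x + h2 x) (\<lambda>x. G1 x + G2 x) (\<lambda>x. L1 x + L2 x)"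
proof -
  obtain H1 H2 where
    H: "\<And>b. b \<in> Basis \<Longrightarrow> continuous_on UNIV (H1 b)" "\<And>b. b \<in> Basis \<Longrightarrow> continuous_on UNIV (H2 b)"
     "\<And>b x \<tau>. b \<in> Basis \<Longrightarrow> ((\<lambda>t. G1 (x + t *\<^sub>R b) \<bullet> b) has_field_derivative H1 b (x + \<tau> *\<^sub>R b)) (at \<tau>)"
     "\<And>b x \<tau>. b \<in> Basis \<Longrightarrow> ((\<lambda>t. G2 (x + t *\<^sub>R b) \<bullet> b) has_field_derivative H2 b (x + \<tau> *\<^sub>R b)) (at \<tau>)"
     "\<And>x. L1 x = (\<Sum>b\<in>Basis. H1 b x)" "\<And>x. L2 x = (\<Sum>b\<in>Basis. H2 b x)"
    using assms unfolding has_laplacian_def by metis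
  show ?thesis
    unfolding has_laplacian_def
  proof (intro conjI allI exI[of _ "\<lambda>b x. H1 b x + H2 b x"] ballI)
    show "((\<lambda>x. h1 x + h2 x) has_derivative (\<lambda>v. (G1 x + G2 x) \<bullet> v)) (at x)" for x
      using assms unfolding has_laplacian_def inner_add_left by (intro has_derivative_add) auto
    show "continuous_on UNIV (\<lambda>x. G1 x + G2 x)"
      using assms unfolding has_laplacian_def by (intro continuous_on_add) auto
    show "continuous_on UNIV (\<lambda>x. H1 b x + H2 b x)" if "b \<in> Basis" for b
      using H(1,2)[OF that] by (intro continuous_on_add)
    show "((\<lambda>t. (G1 (x + t *\<^sub>R b) + G2 (x + t *\<^sub>R b)) \<bullet> b) has_field_derivative H1 b (x + \<tau> *\<^sub>R b) + H2 b (x + \<tau> *\<^sub>R b)) (at \<tau>)"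
      if "b \<in> Basis" for b x \<tau>
      using DERIV_add[OF H(3,4)[OF that]] by (simp add: inner_add_left)
    show "L1 x + L2 x = (\<Sum>b\<in>Basis. H1 b x + H2 b x)" for x
      by (simp add: H sum.distrib)
  qed
qed

lemma has_laplacian_mult:
  assumes "has_laplacian h1 G1 L1" "has_laplacian h2 G2 L2"
  shows "has_laplacian (\<lambda>x. h1 x * h2 x) (\<lambda>x. h1 x *\<^sub>R G2 x + h2 x *\<^sub>R G1 x)
     (\<lambda>x. h1 x * L2 x + h2 x * L1 x + 2 * (G1 x \<bullet> G2 x))"
proof -
  obtain H1 H2 where
    H: "\<And>b. b \<in> Basis \<Longrightarrow> continuous_on UNIV (H1 b)" "\<And>b. b \<in> Basis \<Longrightarrow> continuous_on UNIV (H2 b)"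
     "\<And>b x \<tau>. b \<in> Basis \<Longrightarrow> ((\<lambda>t. G1 (x + t *\<^sub>R b) \<bullet> b) has_field_derivative H1 b (x + \<tau> *\<^sub>R b)) (at \<tau>)"
     "\<And>b x \<tau>. b \<in> Basis \<Longrightarrow> ((\<lambda>t. G2 (x + t *\<^sub>R b) \<bullet> b) has_field_derivative H2 b (x + \<tau> *\<^sub>R b)) (at \<tau>)"
     "\<And>x. L1 x = (\<Sum>b\<in>Basis. H1 b x)" "\<And>x. L2 x = (\<Sum>b\<in>Basis. H2 b x)"
    using assms unfolding has_laplacian_def by metis
  have cont: "continuous_on UNIV h1" "continuous_on UNIV h2" "continuous_on UNIV G1" "continuous_on UNIV G2"
    using has_laplacian_continuous[OF assms(1)] has_laplacian_continuous[OF assms(2)] assms unfolding has_laplacian_def by blast+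
  show ?thesis
    unfolding has_laplacian_def
  proof (intro conjI allI exI[of _ "\<lambda>b x. h1 x * H2 b x + h2 x * H1 b x + 2 * ((G1 x \<bullet> b) * (G2 x \<bullet> b))"] ballI)
    show "((\<lambda>x. h1 x * h2 x) has_derivative (\<lambda>v. (h1 x *\<^sub>R G2 x + h2 x *\<^sub>R G1 x) \<bullet> v)) (at x)" for x
    proof -
      have "((\<lambda>x. h1 x * h2 x) has_derivative (\<lambda>v. h1 x * (G2 x \<bullet> v) + (G1 x \<bullet> v) * h2 x)) (at x)"
        using assms unfolding has_laplacian_def by (intro has_derivative_mult) auto
      then show ?thesis by (simp add: inner_add_left mult.commute)
    qed
    show "continuous_on UNIV (\<lambda>x. h1 x *\<^sub>R G2 x + h2 x *\<^sub>R G1 x)"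
      by (intro continuous_intros cont)
    show "continuous_on UNIV (\<lambda>x. h1 x * H2 b x + h2 x * H1 b x + 2 * ((G1 x \<bullet> b) * (G2 x \<bullet> b)))" if "b \<in> Basis" for b
      by (intro continuous_intros cont H that)
    show "((\<lambda>t. (h1 (x + t *\<^sub>R b) *\<^sub>R G2 (x + t *\<^sub>R b) + h2 (x + t *\<^sub>R b) *\<^sub>R G1 (x + t *\<^sub>R b)) \<bullet> b) has_field_derivative
        h1 (x + \<tau> *\<^sub>R b) * H2 b (x + \<tau> *\<^sub>R b) + h2 (x + \<tau> *\<^sub>R b) * H1 b (x + \<tau> *\<^sub>R b)
        + 2 * ((G1 (x + \<tau> *\<^sub>R b) \<bullet> b) * (G2 (x + \<tau> *\<^sub>R b) \<bullet> b))) (at \<tau>)"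
      if b: "b \<in> Basis" for b x \<tau>
      unfolding inner_add_left inner_scaleR_left
      by (rule DERIV_cong[OF DERIV_add[OF DERIV_mult[OF has_laplacian_line[OF assms(1), of x b \<tau>] H(4)[OF b, of x \<tau>]]
          DERIV_mult[OF has_laplacian_line[OF assms(2), of x b \<tau>] H(3)[OF b, of x \<tau>]]]])
         (simp add: algebra_simps)
    show "h1 x * L2 x + h2 x * L1 x + 2 * (G1 x \<bullet> G2 x)
        = (\<Sum>b\<in>Basis. h1 x * H2 b x + h2 x * H1 b x + 2 * ((G1 x \<bullet> b) * (G2 x \<bullet> b)))" for x
      unfolding H(5,6) euclidean_inner[of "G1 x" "G2 x"]
      by (simp only: sum.distrib sum_distrib_left)
  qed
qed

lemma has_laplacian_cmult:
  assumes "has_laplacian h G L" shows "has_laplacian (\<lambda>x. k * h x) (\<lambda>x. k *\<^sub>R G x) (\<lambda>x. k * L x)"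
  using has_laplacian_mult[OF has_laplacian_const[of k] assms] by simp

lemma has_laplacian_power:
  assumes "has_laplacian h G L"
  shows "has_laplacian (\<lambda>x. h x ^ k) (\<lambda>x. (real k * h x ^ (k - 1)) *\<^sub>R G x)
    (\<lambda>x. real k * real (k - 1) * h x ^ (k - 2) * (G x \<bullet> G x) + real k * h x ^ (k - 1) * L x)"
proof (induction k)
  case 0
  then show ?case using has_laplacian_const[of 1] by simp
next
  case (Suc k)
  have 1: "h x *\<^sub>R ((real k * h x ^ (k - 1)) *\<^sub>R G x) + h x ^ k *\<^sub>R G x = (real (Suc k) * h x ^ (Suc k - 1)) *\<^sub>R G x" for x
  proof -
    have "h x * (real k * h x ^ (k - 1)) + h x ^ k = real (Suc k) * h x ^ (Suc k - 1)"
      by (cases k) (simp_all add: algebra_simps)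
    then show ?thesis by (metis scaleR_add_left scaleR_scaleR)
  qed
  have 2: "h x * (real k * real (k - 1) * h x ^ (k - 2) * (G x \<bullet> G x) + real k * h x ^ (k - 1) * L x) + h x ^ k * L x
      + 2 * (G x \<bullet> ((real k * h x ^ (k - 1)) *\<^sub>R G x))
      = real (Suc k) * real (Suc k - 1) * h x ^ (Suc k - 2) * (G x \<bullet> G x) + real (Suc k) * h x ^ (Suc k - 1) * L x" for x
  proof (cases k)
    case (Suc j)
    then show ?thesis by (cases j) (simp_all add: algebra_simps)
  qed simp
  show ?case
    using has_laplacian_mult[OF assms Suc.IH] unfolding 1 2 by simp
qed

text \<open>
  With \<open>s = a \<bullet> (x - c)\<close> and \<open>t = |x - c|\<^sup>2\<close>, the Laplacian maps \<open>s\<^sup>i t\<^sup>j\<close> into the span of monomials of the same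
  shape. These two variables are all that is needed to solve the Dirichlet problem on balls.
\<close>
lemma has_laplacian_monomial:
  fixes a c :: "'a::euclidean_space"
  shows "\<exists>G. has_laplacian (\<lambda>x. (a \<bullet> (x - c)) ^ i * ((x - c) \<bullet> (x - c)) ^ j) G
    (\<lambda>x. real i * (real i - 1) * (a \<bullet> a) * (a \<bullet> (x - c)) ^ (i - 2) * ((x - c) \<bullet> (x - c)) ^ j
      + (4 * real i * real j + 2 * real j * DIM('a) + 4 * real j * (real j - 1))
          * (a \<bullet> (x - c)) ^ i * ((x - c) \<bullet> (x - c)) ^ (j - 1))"
proof -
  have eq: "s ^ i * (real j * real (j - 1) * t ^ (j - 2) * (4 * t) + real j * t ^ (j - 1) * real (2 * DIM('a)))
      + t ^ j * (real i * real (i - 1) * s ^ (i - 2) * A)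
      + 2 * (real i * s ^ (i - 1) * (real j * t ^ (j - 1) * (2 * s)))
     = real i * (real i - 1) * A * s ^ (i - 2) * t ^ j
      + (4 * real i * real j + 2 * real j * DIM('a) + 4 * real j * (real j - 1)) * s ^ i * t ^ (j - 1)"
    for s t A :: real
  proof -
    have "real j * real (j - 1) * t ^ (j - 2) * t = real j * (real j - 1) * t ^ (j - 1)"
      by (cases j; cases "j - 1") auto
    moreover have "real i * real (i - 1) = real i * (real i - 1)" by (cases i) auto
    moreover have "real i * s ^ (i - 1) * s = real i * s ^ i" by (cases i) auto
    moreover have "s ^ i * (real j * real (j - 1) * t ^ (j - 2) * (4 * t) + real j * t ^ (j - 1) * real (2 * DIM('a)))
      + t ^ j * (real i * real (i - 1) * s ^ (i - 2) * A)
      + 2 * (real i * s ^ (i - 1) * (real j * t ^ (j - 1) * (2 * s)))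
      = 4 * s ^ i * (real j * real (j - 1) * t ^ (j - 2) * t) + 2 * real j * DIM('a) * s ^ i * t ^ (j - 1)
      + (real i * real (i - 1)) * (A * s ^ (i - 2) * t ^ j)
      + 4 * (real i * s ^ (i - 1) * s) * (real j * t ^ (j - 1))"
      by (simp add: algebra_simps)
    ultimately show ?thesis by (simp only:) (simp add: algebra_simps)
  qed
  show ?thesis
    using has_laplacian_mult[OF has_laplacian_power[OF has_laplacian_inner, of a c i] has_laplacian_power[OF has_laplacian_sqdist, of c j]]
    unfolding eq[symmetric] by (intro exI) (simp add: inner_commute mult.commute mult.left_commute)
qed


text \<open>
  The second term of the Laplacian of \<open>s\<^sup>i t\<^sup>j\<^sup>+\<^sup>1\<close> is a positive multiple of \<open>s\<^sup>i t\<^sup>j\<close>, and the first has two powers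
  of \<open>s\<close> less, so \<open>\<Delta> w = s\<^sup>i t\<^sup>j\<close> is solved by induction on \<open>i\<close>. On a sphere \<open>t\<close> is constant; hence \<open>w\<close>
  restricts there to a polynomial in \<open>s\<close> of degree at most \<open>i\<close>.
\<close>
lemma inverse_laplacian_monomial:
  fixes a c :: "'a::euclidean_space"
  shows "\<exists>w G p. has_laplacian w G (\<lambda>x. (a \<bullet> (x - c)) ^ i * ((x - c) \<bullet> (x - c)) ^ j) \<and>
    (\<forall>x. (x - c) \<bullet> (x - c) = T \<longrightarrow> w x = (\<Sum>m\<le>i. p m * (a \<bullet> (x - c)) ^ m))"
proof (induction i arbitrary: j rule: less_induct)
  case (less i)
  \<comment> \<open>the coefficient of \<open>s\<^sup>i t\<^sup>j\<close> in the Laplacian of \<open>s\<^sup>i t\<^sup>j\<^sup>+\<^sup>1\<close>\<close>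
  define C where "C = 4 * real i * real (Suc j) + 2 * real (Suc j) * DIM('a) + 4 * real (Suc j) * real j"
  have C: "0 < C" unfolding C_def by (intro add_nonneg_pos add_pos_nonneg mult_pos_pos) auto
  obtain G1 where G1: "has_laplacian (\<lambda>x. (a \<bullet> (x - c)) ^ i * ((x - c) \<bullet> (x - c)) ^ Suc j) G1
    (\<lambda>x. real i * (real i - 1) * (a \<bullet> a) * (a \<bullet> (x - c)) ^ (i - 2) * ((x - c) \<bullet> (x - c)) ^ Suc j
      + C * (a \<bullet> (x - c)) ^ i * ((x - c) \<bullet> (x - c)) ^ j)"
    using has_laplacian_monomial[of a c i "Suc j"] by (auto simp: C_def)
  \<comment> \<open>for \<open>i < 2\<close> the right-hand side is zero, and \<open>i - 2\<close> is truncated\<close>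
  obtain w G p where w: "has_laplacian w G (\<lambda>x. real i * (real i - 1) * (a \<bullet> (x - c)) ^ (i - 2) * ((x - c) \<bullet> (x - c)) ^ Suc j)"
    "\<And>x. (x - c) \<bullet> (x - c) = T \<Longrightarrow> w x = (\<Sum>m\<le>i. p m * (a \<bullet> (x - c)) ^ m)"
  proof (cases "i < 2")
    case True
    then have "i = 0 \<or> i = 1" by auto
    then show ?thesis using has_laplacian_const[of 0] by (intro that[of "\<lambda>_. 0" "\<lambda>_. 0" "\<lambda>_. 0"]) auto
  next
    case False
    then obtain w G p where w: "has_laplacian w G (\<lambda>x. (a \<bullet> (x - c)) ^ (i - 2) * ((x - c) \<bullet> (x - c)) ^ Suc j)"
      "\<And>x. (x - c) \<bullet> (x - c) = T \<Longrightarrow> w x = (\<Sum>m\<le>i - 2. p m * (a \<bullet> (x - c)) ^ m)"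
      using less.IH[of "i - 2" "Suc j"] by auto
    let ?k = "real i * (real i - 1)"
    show ?thesis
    proof (rule that)
      show "has_laplacian (\<lambda>x. ?k * w x) (\<lambda>x. ?k *\<^sub>R G x) (\<lambda>x. ?k * (a \<bullet> (x - c)) ^ (i - 2) * ((x - c) \<bullet> (x - c)) ^ Suc j)"
        using has_laplacian_cmult[OF w(1), of ?k] by (simp only: mult.assoc)
      fix x assume x: "(x - c) \<bullet> (x - c) = T"
      have "(\<Sum>m\<le>i. (if m \<le> i - 2 then ?k * p m else 0) * (a \<bullet> (x - c)) ^ m)
         = (\<Sum>m\<le>i - 2. (if m \<le> i - 2 then ?k * p m else 0) * (a \<bullet> (x - c)) ^ m)"
        by (rule sum.mono_neutral_right) auto
      then show "?k * w x = (\<Sum>m\<le>i. (if m \<le> i - 2 then ?k * p m else 0) * (a \<bullet> (x - c)) ^ m)"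
        using w(2)[OF x] by (simp add: sum_distrib_left mult.assoc)
    qed
  qed
  let ?w = "\<lambda>x. (1/C) * ((a \<bullet> (x - c)) ^ i * ((x - c) \<bullet> (x - c)) ^ Suc j + (- (a \<bullet> a)) * w x)"
  let ?p = "\<lambda>m. (1/C) * ((if m = i then T ^ Suc j else 0) + (- (a \<bullet> a)) * p m)"
  have "has_laplacian ?w (\<lambda>x. (1/C) *\<^sub>R (G1 x + (- (a \<bullet> a)) *\<^sub>R G x))
     (\<lambda>x. (a \<bullet> (x - c)) ^ i * ((x - c) \<bullet> (x - c)) ^ j)"
    using has_laplacian_cmult[OF has_laplacian_add[OF G1 has_laplacian_cmult[OF w(1), of "- (a \<bullet> a)"]], of "1/C"] C
    by (simp add: algebra_simps)
  moreover have "?w x = (\<Sum>m\<le>i. ?p m * (a \<bullet> (x - c)) ^ m)" if x: "(x - c) \<bullet> (x - c) = T" for x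
  proof -
    have "(\<Sum>m\<le>i. (if m = i then T ^ Suc j else 0) * (a \<bullet> (x - c)) ^ m)
        = (\<Sum>m\<le>i. if m = i then T ^ Suc j * (a \<bullet> (x - c)) ^ m else 0)"
      by (intro sum.cong) auto
    also have "\<dots> = T ^ Suc j * (a \<bullet> (x - c)) ^ i"
      by simp
    finally have 1: "(\<Sum>m\<le>i. (if m = i then T ^ Suc j else 0) * (a \<bullet> (x - c)) ^ m) = T ^ Suc j * (a \<bullet> (x - c)) ^ i" .
    have "(\<Sum>m\<le>i. ?p m * (a \<bullet> (x - c)) ^ m)
      = (1/C) * ((\<Sum>m\<le>i. (if m = i then T ^ Suc j else 0) * (a \<bullet> (x - c)) ^ m) + (- (a \<bullet> a)) * (\<Sum>m\<le>i. p m * (a \<bullet> (x - c)) ^ m))"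
      unfolding sum_distrib_left sum.distrib[symmetric] by (intro sum.cong refl) (simp add: algebra_simps)
    then show ?thesis unfolding 1 x w(2)[OF x] by (simp only: mult.commute[of "(a \<bullet> (x - c)) ^ i"])
  qed
  ultimately show ?case by (intro exI[of _ ?w] exI[of _ ?p] exI conjI) auto
qed

section \<open>The maximum principle and the Dirichlet problem\<close>

text \<open>
  One ball per point suffices. At a maximum point the value equals its mean over a ball, so the
  function is constant on that ball; choosing the maximum point that lies farthest in a coordinate
  direction gives a contradiction, unless the maximum is attained on the frontier.
\<close>
lemma max_principle:
  fixes v :: "'a::euclidean_space \<Rightarrow> real"
  assumes U: "bounded U" "open U" and v: "continuous_on (closure U) v"
    and sub: "\<And>x. x \<in> U \<Longrightarrow> \<exists>r>0. ball x r \<subseteq> U \<and> v x \<le> weighted_mean 0 x r v"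
    and bdry: "\<And>x. x \<in> frontier U \<Longrightarrow> v x \<le> c"
    and x: "x \<in> closure U"
  shows "v x \<le> c"
proof (rule ccontr)
  assume gt: "\<not> v x \<le> c"
  have comp: "compact (closure U)" using U by (simp add: compact_closure)
  have "closure U \<noteq> {}" using x by auto
  from continuous_attains_sup[OF comp this v]
  obtain x1 where x1: "x1 \<in> closure U" "\<And>y. y \<in> closure U \<Longrightarrow> v y \<le> v x1"
    by auto
  define K where "K = {y \<in> closure U. v y = v x1}"
  have KU: "K \<subseteq> U"
  proof
    fix y assume "y \<in> K"
    then have "y \<in> closure U" "c < v y" using gt x1(2)[OF x] by (auto simp: K_def)
    then show "y \<in> U" using bdry[of y] U(2) by (force simp: frontier_def interior_open)
  qed
  have "closed K"
    using continuous_closed_preimage_constant[OF v] unfolding K_def by simp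
  then have "compact K" using compact_Int_closed[OF comp, of K] unfolding K_def by (simp add: Int_def)
  obtain e :: 'a where e: "e \<in> Basis" using nonempty_Basis by blast
  have "K \<noteq> {}" using x1(1) by (auto simp: K_def)
  moreover have "continuous_on K (\<lambda>z. z \<bullet> e)" by (intro continuous_intros)
  ultimately obtain y where y: "y \<in> K" "\<And>z. z \<in> K \<Longrightarrow> z \<bullet> e \<le> y \<bullet> e"
    using continuous_attains_sup[OF \<open>compact K\<close>] by metis
  obtain r where r: "0 < r" "ball y r \<subseteq> U" "v y \<le> weighted_mean 0 y r v" using sub y(1) KU by blast
  have rcl: "ball y r \<subseteq> closure U" using r(2) closure_subset by blast
  have "v z = v y" if "z \<in> ball y r" for z
  proof (rule ccontr)
    assume "v z \<noteq> v y"
    then have "v z < v y" using x1(2)[of z] that rcl y(1) by (force simp: K_def)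
    have "weighted_mean 0 y r v < v y"
    proof (rule weighted_mean_less_of_continuous[where y=z])
      show "bounded_measurable_on (ball y r) v"
        using bounded_measurable_subset[OF bounded_measurable_continuous_closure[OF v U] r(2)] by simp
      show "0 < r" "z \<in> ball y r" "v z < v y" by fact+
      show "continuous_on (ball y r) v" using continuous_on_subset[OF v rcl] .
      show "v z \<le> v y" if "z \<in> ball y r" for z using x1(2)[of z] that rcl y(1) by (auto simp: K_def)
    qed
    then show False using r(3) by simp
  qed
  moreover have m: "y + (r/2) *\<^sub>R e \<in> ball y r" using r(1) e by (simp add: dist_norm)
  ultimately have "y + (r/2) *\<^sub>R e \<in> K" using y(1) rcl by (auto simp: K_def)
  then have "(y + (r/2) *\<^sub>R e) \<bullet> e \<le> y \<bullet> e" by (rule y(2))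
  then show False using r(1) e by (simp add: inner_add_left)
qed

definition dirichlet_solvable :: "'a::euclidean_space set \<Rightarrow> ('a \<Rightarrow> real) \<Rightarrow> bool" where
  "dirichlet_solvable U f \<longleftrightarrow> (\<exists>u. continuous_on (closure U) u \<and> mean_value_property U u \<and> (\<forall>x\<in>frontier U. u x = f x))"

lemma mean_value_propertyD: "mean_value_property S u \<Longrightarrow> 0 < r \<Longrightarrow> ball x r \<subseteq> S \<Longrightarrow> weighted_mean m x r u = u x"
  by (simp add: mean_value_property_def)

lemma mean_value_property_subset: "mean_value_property S u \<Longrightarrow> T \<subseteq> S \<Longrightarrow> mean_value_property T u"
  unfolding mean_value_property_def by blast

lemma mean_value_property_add:
  assumes "mean_value_property S u" "mean_value_property S v" "bounded_measurable_on S u" "bounded_measurable_on S v"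
  shows "mean_value_property S (\<lambda>x. u x + v x)"
  unfolding mean_value_property_def
proof (intro allI impI, elim conjE)
  fix x :: 'a and r :: real and m :: nat assume r: "0 < r" "ball x r \<subseteq> S"
  then have "bounded_measurable_on (ball x r) u" "bounded_measurable_on (ball x r) v" using assms bounded_measurable_subset by (metis borel_open open_ball)+
  then show "weighted_mean m x r (\<lambda>x. u x + v x) = u x + v x"
    using weighted_mean_add[OF r(1), of x u v m] mean_value_propertyD[OF assms(1) r, of m] mean_value_propertyD[OF assms(2) r, of m] by simp
qed

lemma mean_value_property_cmult: "mean_value_property S u \<Longrightarrow> mean_value_property S (\<lambda>x. c * u x)"
  by (simp add: mean_value_property_def weighted_mean_cmult)

lemma mean_value_property_diff:
  assumes "mean_value_property S u" "mean_value_property S v" "bounded_measurable_on S u" "bounded_measurable_on S v"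
  shows "mean_value_property S (\<lambda>x. u x - v x)"
  using mean_value_property_add[OF assms(1) mean_value_property_cmult[OF assms(2), of "-1"] assms(3) bounded_measurable_cmult[OF assms(4), of "-1"]] by simp

lemma mean_value_property_max_principle:
  fixes v :: "'a::euclidean_space \<Rightarrow> real"
  assumes U: "bounded U" "open U" and v: "continuous_on (closure U) v" "mean_value_property U v"
    and bdry: "\<And>x. x \<in> frontier U \<Longrightarrow> v x \<le> c" and x: "x \<in> closure U"
  shows "v x \<le> c"
proof (rule max_principle[OF U v(1) _ bdry x])
  fix y assume "y \<in> U"
  then obtain r where "0 < r" "ball y r \<subseteq> U" using U(2) openE by blast
  then show "\<exists>r>0. ball y r \<subseteq> U \<and> v y \<le> weighted_mean 0 y r v" using mean_value_propertyD[OF v(2)] by auto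
qed

lemma dirichlet_cong: "dirichlet_solvable U f \<Longrightarrow> (\<And>x. x \<in> frontier U \<Longrightarrow> f x = g x) \<Longrightarrow> dirichlet_solvable U g"
  unfolding dirichlet_solvable_def by auto

lemma dirichlet_mean_value_property: "continuous_on (closure U) u \<Longrightarrow> mean_value_property U u \<Longrightarrow> dirichlet_solvable U u"
  unfolding dirichlet_solvable_def by auto

lemma dirichlet_laplacian_zero: "has_laplacian h G (\<lambda>_. 0) \<Longrightarrow> dirichlet_solvable U h"
  using laplacian_zero_mean_value_property has_laplacian_continuous by (blast intro: dirichlet_mean_value_property)

lemma dirichlet_add:
  assumes U: "bounded U" "open U" and "dirichlet_solvable U f" "dirichlet_solvable U g"
  shows "dirichlet_solvable U (\<lambda>x. f x + g x)"
proof -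
  obtain u v where u: "continuous_on (closure U) u" "mean_value_property U u" "\<forall>x\<in>frontier U. u x = f x"
    and v: "continuous_on (closure U) v" "mean_value_property U v" "\<forall>x\<in>frontier U. v x = g x"
    using assms unfolding dirichlet_solvable_def by metis
  then have "mean_value_property U (\<lambda>x. u x + v x)" using U by (intro mean_value_property_add bounded_measurable_continuous_closure)
  with u v show ?thesis unfolding dirichlet_solvable_def
    by (intro exI[of _ "\<lambda>x. u x + v x"]) (auto intro!: continuous_intros)
qed

lemma dirichlet_cmult: "dirichlet_solvable U f \<Longrightarrow> dirichlet_solvable U (\<lambda>x. c * f x)"
  unfolding dirichlet_solvable_def
proof (elim exE conjE)
  fix u assume "continuous_on (closure U) u" "mean_value_property U u" "\<forall>x\<in>frontier U. u x = f x"
  then show "\<exists>v. continuous_on (closure U) v \<and> mean_value_property U v \<and> (\<forall>x\<in>frontier U. v x = c * f x)"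
    by (intro exI[of _ "\<lambda>x. c * u x"]) (auto intro!: continuous_intros mean_value_property_cmult)
qed

lemma dirichlet_sum:
  assumes U: "bounded U" "open U" and "finite I" "\<And>i. i \<in> I \<Longrightarrow> dirichlet_solvable U (f i)"
  shows "dirichlet_solvable U (\<lambda>x. \<Sum>i\<in>I. f i x)"
  using assms(3,4)
proof (induction I rule: finite_induct)
  case empty
  then show ?case using dirichlet_laplacian_zero[OF has_laplacian_const[of 0]] by simp
qed (auto intro: dirichlet_add[OF U])

lemma weighted_mean_close:
  assumes "0 < r" "bounded_measurable_on (ball x r) u" "bounded_measurable_on (ball x r) v" "\<And>y. y \<in> ball x r \<Longrightarrow> \<bar>u y - v y\<bar> \<le> e"
  shows "\<bar>weighted_mean m x r u - weighted_mean m x r v\<bar> \<le> e"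
proof -
  have b: "bounded_measurable_on (ball x r) (\<lambda>_. e)" by (intro bounded_measurable_const) auto
  have "weighted_mean m x r u \<le> weighted_mean m x r (\<lambda>y. v y + e)"
    using assms(4) by (intro weighted_mean_mono bounded_measurable_add b assms) (smt (verit))
  moreover have "weighted_mean m x r v \<le> weighted_mean m x r (\<lambda>y. u y + e)"
    using assms(4) by (intro weighted_mean_mono bounded_measurable_add b assms) (smt (verit))
  ultimately show ?thesis
    using weighted_mean_add[OF assms(1) _ b] assms(2,3) by (simp add: weighted_mean_const)
qed

lemma mean_value_property_uniform_limit:
  fixes u :: "'a::euclidean_space \<Rightarrow> real"
  assumes "\<And>k. mean_value_property S (v k)" "\<And>k. bounded_measurable_on S (v k)" "bounded_measurable_on S u" "uniform_limit S v u sequentially"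
  shows "mean_value_property S u"
  unfolding mean_value_property_def
proof (intro allI impI, elim conjE)
  fix x :: 'a and r :: real and m :: nat assume r: "0 < r" "ball x r \<subseteq> S"
  then have bm: "bounded_measurable_on (ball x r) u" "\<And>k. bounded_measurable_on (ball x r) (v k)"
    using assms bounded_measurable_subset by (metis borel_open open_ball)+
  have x: "x \<in> S" using r by auto
  have "\<bar>weighted_mean m x r u - u x\<bar> \<le> 0 + e" if "0 < e" for e
  proof -
    have "0 < e / 2" using that by simp
    then obtain k where k: "\<And>y. y \<in> S \<Longrightarrow> dist (v k y) (u y) < e / 2"
      using uniform_limitD[OF assms(4)] eventually_sequentially by (metis (no_types, lifting) order_refl)
    have "\<bar>weighted_mean m x r (v k) - weighted_mean m x r u\<bar> \<le> e / 2"
    proof (rule weighted_mean_close[OF r(1) bm(2,1)])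
      show "\<bar>v k y - u y\<bar> \<le> e / 2" if "y \<in> ball x r" for y
        using k[of y] that r(2) by (auto simp: dist_real_def)
    qed
    moreover have "weighted_mean m x r (v k) = v k x" using mean_value_propertyD[OF assms(1) r] .
    moreover have "\<bar>v k x - u x\<bar> \<le> e / 2" using k[OF x] by (simp add: dist_real_def)
    ultimately show ?thesis by linarith
  qed
  then have "\<bar>weighted_mean m x r u - u x\<bar> \<le> 0" by (rule field_le_epsilon)
  then show "weighted_mean m x r u = u x" by simp
qed

text \<open>
  By the maximum principle, solutions whose boundary values are uniformly close are uniformly close, so the
  solutions of the approximating problems form a Cauchy sequence.
\<close>
lemma dirichlet_approx:
  fixes f :: "'a::euclidean_space \<Rightarrow> real"
  assumes U: "bounded U" "open U"
    and approx: "\<And>e. 0 < e \<Longrightarrow> \<exists>g. dirichlet_solvable U g \<and> (\<forall>x\<in>frontier U. \<bar>f x - g x\<bar> \<le> e)"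
  shows "dirichlet_solvable U f"
proof -
  have "\<exists>u. continuous_on (closure U) u \<and> mean_value_property U u \<and> (\<forall>x\<in>frontier U. \<bar>f x - u x\<bar> \<le> inverse (real (Suc k)))" for k
    using approx[of "inverse (real (Suc k))"] unfolding dirichlet_solvable_def by force
  then obtain u where u: "\<And>k. continuous_on (closure U) (u k)" "\<And>k. mean_value_property U (u k)"
    "\<And>k x. x \<in> frontier U \<Longrightarrow> \<bar>f x - u k x\<bar> \<le> inverse (real (Suc k))"
    by metis
  have bm: "bounded_measurable_on U (u k)" for k using bounded_measurable_continuous_closure[OF u(1) U] .
  have close: "u k x - u l x \<le> inverse (real (Suc k)) + inverse (real (Suc l))" if "x \<in> closure U" for k l x
  proof (rule mean_value_property_max_principle[OF U _ _ _ that])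
    show "continuous_on (closure U) (\<lambda>x. u k x - u l x)" by (intro continuous_intros u)
    show "mean_value_property U (\<lambda>x. u k x - u l x)" by (intro mean_value_property_diff u bm)
    show "u k y - u l y \<le> inverse (real (Suc k)) + inverse (real (Suc l))" if "y \<in> frontier U" for y
      using u(3)[OF that, of k] u(3)[OF that, of l] by linarith
  qed
  have "uniformly_Cauchy_on (closure U) u"
  proof (rule uniformly_Cauchy_onI)
    fix e :: real assume "0 < e"
    then obtain N where N: "inverse (real (Suc N)) < e / 2" using reals_Archimedean[of "e/2"] by auto
    have "dist (u k x) (u l x) < e" if "x \<in> closure U" "k \<ge> N" "l \<ge> N" for x k l
    proof -
      have "inverse (real (Suc k)) \<le> inverse (real (Suc N))" "inverse (real (Suc l)) \<le> inverse (real (Suc N))"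
        using that by auto
      then show ?thesis using close[OF that(1), of k l] close[OF that(1), of l k] N by (simp only: dist_real_def; linarith)
    qed
    then show "\<exists>M. \<forall>x\<in>closure U. \<forall>m\<ge>M. \<forall>n\<ge>M. dist (u m x) (u n x) < e" by blast
  qed
  then obtain v where v: "uniform_limit (closure U) u v sequentially"
    using Cauchy_uniformly_convergent uniformly_convergent_on_def by blast
  have cont: "continuous_on (closure U) v"
    by (rule uniform_limit_theorem[OF _ v]) (use u in auto)
  have "mean_value_property U v"
    by (rule mean_value_property_uniform_limit[OF u(2) bm bounded_measurable_continuous_closure[OF cont U]])
       (rule uniform_limit_on_subset[OF v closure_subset])
  moreover have "v x = f x" if x: "x \<in> frontier U" for x
  proof (rule LIMSEQ_unique)
    have "x \<in> closure U" using x by (simp add: frontier_def)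
    then show "(\<lambda>k. u k x) \<longlonglongrightarrow> v x" using tendsto_uniform_limitI[OF v] by blast
    have "(\<lambda>k. u k x - f x) \<longlonglongrightarrow> 0"
      using u(3)[OF x] by (intro Lim_null_comparison[OF _ LIMSEQ_inverse_real_of_nat]) (auto simp: abs_minus_commute)
    then show "(\<lambda>k. u k x) \<longlonglongrightarrow> f x" using LIM_zero_iff by blast
  qed
  ultimately show ?thesis using cont unfolding dirichlet_solvable_def by blast
qed

text \<open>
  The exponentials \<open>exp (a \<bullet> x)\<close> are convex, and their span is an algebra that separates points. So by the
  Stone-Weierstrass theorem it is enough to solve the Dirichlet problem for them.
\<close>
inductive_set exp_span :: "('a::euclidean_space \<Rightarrow> real) set" where
  exp_span_base: "(\<lambda>x. c * exp (a \<bullet> x)) \<in> exp_span"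
| exp_span_add: "f \<in> exp_span \<Longrightarrow> g \<in> exp_span \<Longrightarrow> (\<lambda>x. f x + g x) \<in> exp_span"

lemma exp_span_mult:
  assumes "f \<in> exp_span" "g \<in> exp_span" shows "(\<lambda>x. f x * g x) \<in> exp_span"
  using assms
proof (induction f rule: exp_span.induct)
  case (exp_span_base c a)
  from exp_span_base.prems show ?case
  proof (induction g rule: exp_span.induct)
    case (exp_span_base d b)
    have "(\<lambda>x. c * exp (a \<bullet> x) * (d * exp (b \<bullet> x))) = (\<lambda>x. (c * d) * exp ((a + b) \<bullet> x))"
      by (auto simp: inner_add_left exp_add)
    then show ?case using exp_span.exp_span_base[of "c * d" "a + b"] by simp
  next
    case (exp_span_add f g)
    then show ?case using exp_span.exp_span_add[of "\<lambda>x. c * exp (a \<bullet> x) * f x" "\<lambda>x. c * exp (a \<bullet> x) * g x"]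
      by (simp add: distrib_left)
  qed
next
  case (exp_span_add f h)
  then show ?case using exp_span.exp_span_add[of "\<lambda>x. f x * g x" "\<lambda>x. h x * g x"] by (simp add: distrib_right)
qed

lemma exp_span_continuous: "f \<in> exp_span \<Longrightarrow> continuous_on S f"
  by (induction f rule: exp_span.induct) (auto intro!: continuous_intros)

lemma exp_span_ring:
  fixes S :: "'a::euclidean_space set"
  assumes "compact S" shows "function_ring_on exp_span S"
proof
  show "\<exists>f\<in>exp_span. f x \<noteq> f y" if "x \<noteq> y" for x y :: 'a
  proof (rule bexI)
    have "(x - y) \<bullet> (x - y) \<noteq> 0" using that by simp
    then have "(x - y) \<bullet> x \<noteq> (x - y) \<bullet> y" by (simp add: inner_diff_right)
    then show "1 * exp ((x - y) \<bullet> x) \<noteq> 1 * exp ((x - y) \<bullet> y)" by simp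
  qed (rule exp_span_base)
  show "(\<lambda>_. c) \<in> (exp_span :: ('a \<Rightarrow> real) set)" for c
    using exp_span_base[of c 0] by simp
qed (auto intro: assms exp_span_add exp_span_mult exp_span_continuous)

lemma dirichlet_from_exponentials:
  fixes f :: "'a::euclidean_space \<Rightarrow> real"
  assumes U: "bounded U" "open U" and exps: "\<And>a. dirichlet_solvable U (\<lambda>x. exp (a \<bullet> x))"
    and f: "continuous_on (frontier U) f"
  shows "dirichlet_solvable U f"
proof (rule dirichlet_approx[OF U])
  fix e :: real assume "0 < e"
  interpret function_ring_on exp_span "frontier U"
    using U by (intro exp_span_ring compact_frontier_bounded)
  obtain g where "g \<in> exp_span" "\<forall>x\<in>frontier U. \<bar>f x - g x\<bar> < e"
    using Stone_Weierstrass_basic[OF f \<open>0 < e\<close>] by blast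
  moreover have "dirichlet_solvable U g" if "g \<in> exp_span" for g
    using that by (induction g rule: exp_span.induct) (auto intro: dirichlet_add[OF U] dirichlet_cmult exps)
  ultimately show "\<exists>g. dirichlet_solvable U g \<and> (\<forall>x\<in>frontier U. \<bar>f x - g x\<bar> \<le> e)"
    by (meson less_imp_le)
qed

section \<open>The Dirichlet problem on balls\<close>

text \<open>
  Subtracting from \<open>s\<^sup>k\<close> a function \<open>w\<close> with the same Laplacian leaves a harmonic polynomial. What has to be added
  back is the solution with the boundary values of \<open>w\<close>, a polynomial of degree at
  most \<open>k - 2\<close> in \<open>s\<close>, which exists by induction.
\<close>
lemma dirichlet_ball_power:
  fixes a c :: "'a::euclidean_space"
  assumes "0 < R"
  shows "dirichlet_solvable (ball c R) (\<lambda>x. (a \<bullet> (x - c)) ^ k)"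
proof (induction k rule: less_induct)
  case (less k)
  let ?k = "real k * (real k - 1) * (a \<bullet> a)"
  obtain w G p where w: "has_laplacian w G (\<lambda>x. (a \<bullet> (x - c)) ^ (k - 2) * ((x - c) \<bullet> (x - c)) ^ 0)"
    "\<And>x. (x - c) \<bullet> (x - c) = R\<^sup>2 \<Longrightarrow> w x = (\<Sum>m\<le>k - 2. p m * (a \<bullet> (x - c)) ^ m)"
    using inverse_laplacian_monomial[of a c "k - 2" 0 "R\<^sup>2"] by blast
  obtain G1 where G1: "has_laplacian (\<lambda>x. (a \<bullet> (x - c)) ^ k * ((x - c) \<bullet> (x - c)) ^ 0) G1
      (\<lambda>x. ?k * (a \<bullet> (x - c)) ^ (k - 2))"
    using has_laplacian_monomial[of a c k 0] by auto
  have "has_laplacian (\<lambda>x. (a \<bullet> (x - c)) ^ k + (- ?k) * w x) (\<lambda>x. G1 x + (- ?k) *\<^sub>R G x) (\<lambda>_. 0)"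
    using has_laplacian_add[OF G1 has_laplacian_cmult[OF w(1), of "- ?k"]] by simp
  then have 1: "dirichlet_solvable (ball c R) (\<lambda>x. (a \<bullet> (x - c)) ^ k + (- ?k) * w x)" by (rule dirichlet_laplacian_zero)
  have sphere: "(x - c) \<bullet> (x - c) = R\<^sup>2" if "x \<in> frontier (ball c R)" for x
    using that assms by (simp add: frontier_ball dist_norm power2_norm_eq_inner[symmetric] norm_minus_commute)
  have 2: "dirichlet_solvable (ball c R) (\<lambda>x. ?k * w x)"
  proof (cases "k < 2")
    case True
    then have "?k = 0" by (cases "k = 0") (auto simp: less_2_cases_iff)
    have "dirichlet_solvable (ball c R) (\<lambda>x. 0)" by (rule dirichlet_laplacian_zero[OF has_laplacian_const])
    then show ?thesis using \<open>?k = 0\<close> by (simp only: mult_zero_left)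
  next
    case False
    have "dirichlet_solvable (ball c R) (\<lambda>x. \<Sum>m\<le>k - 2. p m * (a \<bullet> (x - c)) ^ m)"
      using False by (intro dirichlet_sum dirichlet_cmult less.IH) auto
    then have "dirichlet_solvable (ball c R) w" by (rule dirichlet_cong) (use w(2) sphere in auto)
    then show ?thesis by (rule dirichlet_cmult)
  qed
  show ?case using dirichlet_add[OF _ _ 1 2] by simp
qed

text \<open>
  On a ball, exponentials \<open>exp (a \<bullet> (x - c))\<close> are uniform limits of polynomials in the single
  variable \<open>a \<bullet> (x - c)\<close>, and their monomials have already been treated.
\<close>
lemma dirichlet_ball:
  fixes f :: "'a::euclidean_space \<Rightarrow> real"
  assumes R: "0 < R" and f: "continuous_on (frontier (ball c R)) f"
  shows "dirichlet_solvable (ball c R) f"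
proof (rule dirichlet_from_exponentials[OF bounded_ball open_ball _ f])
  fix a
  have "dirichlet_solvable (ball c R) (\<lambda>x. exp (a \<bullet> (x - c)))"
  proof (rule dirichlet_approx[OF bounded_ball open_ball])
    fix e :: real assume e: "0 < e"
    let ?I = "{- (norm a * R) .. norm a * R}"
    obtain g where g: "real_polynomial_function g" "\<And>t. t \<in> ?I \<Longrightarrow> \<bar>exp t - g t\<bar> < e"
      using Stone_Weierstrass_real_polynomial_function[of ?I exp e] e continuous_on_exp[OF continuous_on_id] by auto
    then obtain q n where q: "g = (\<lambda>t. \<Sum>i\<le>n. q i * t ^ i)"
      using real_polynomial_function_iff_sum by blast
    have "dirichlet_solvable (ball c R) (\<lambda>x. g (a \<bullet> (x - c)))"
      unfolding q using R by (intro dirichlet_sum dirichlet_cmult dirichlet_ball_power) auto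
    moreover have "\<bar>exp (a \<bullet> (x - c)) - g (a \<bullet> (x - c))\<bar> \<le> e" if "x \<in> frontier (ball c R)" for x
    proof -
      have "norm (x - c) = R" using that R by (simp add: frontier_ball dist_norm norm_minus_commute)
      then have "\<bar>a \<bullet> (x - c)\<bar> \<le> norm a * R" using Cauchy_Schwarz_ineq2[of a "x - c"] by simp
      then show ?thesis 
        by (intro less_imp_le g(2)) (simp add: abs_le_iff minus_le_iff)
    qed
    ultimately show "\<exists>g. dirichlet_solvable (ball c R) g \<and> (\<forall>x\<in>frontier (ball c R). \<bar>exp (a \<bullet> (x - c)) - g x\<bar> \<le> e)"
      by blast
  qed
  then show "dirichlet_solvable (ball c R) (\<lambda>x. exp (a \<bullet> x))"
    by (rule dirichlet_cmult[of _ _ "exp (a \<bullet> c)", THEN dirichlet_cong])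
       (simp add: inner_diff_right exp_diff)
qed

section \<open>Limits of functions with the mean value property\<close>

text \<open>
  Near a given point, \<open>u\<close> is a fixed multiple of its convolution with the continuous kernel of
  exponent 1, hence continuous even if only measurability is known.
\<close>
lemma mean_value_property_continuous:
  fixes u :: "'a::euclidean_space \<Rightarrow> real"
  assumes S: "open S" and bm: "bounded_measurable_on S u" and mean_value_property: "mean_value_property S u"
  shows "continuous_on S u"
proof -
  have "continuous (at x0) u" if x0S: "x0 \<in> S" for x0
  proof -
    obtain \<rho> where \<rho>: "0 < \<rho>" "ball x0 \<rho> \<subseteq> S" using openE[OF S x0S] by metis
    define r where "r = \<rho> / 2"
    have r: "0 < r" using \<rho> by (simp add: r_def)
    have sub: "ball x r \<subseteq> ball x0 \<rho>" if "x \<in> ball x0 r" for x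
    proof
      fix y assume "y \<in> ball x r"
      then show "y \<in> ball x0 \<rho>" using that dist_triangle[of x0 y x] by (simp add: r_def)
    qed
    define w where "w = (\<lambda>y. indicator S y * u y)"
    obtain C where C: "\<And>y. y \<in> S \<Longrightarrow> \<bar>u y\<bar> \<le> C" using bm unfolding bounded_measurable_on_def by auto
    have wmeas: "w \<in> borel_measurable borel" using bounded_measurable_measurable[OF bm] by (simp add: w_def)
    define J where "J = (\<lambda>x. \<integral>y. ball_kernel 1 ((1/r) *\<^sub>R (y - x)) * w y \<partial>lborel)"
    define c where "c = r ^ DIM('a) * (\<integral>z. ball_kernel 1 (z::'a) \<partial>lborel)"
    have c: "0 < c" unfolding c_def by (intro mult_pos_pos zero_less_power r ball_kernel_integral_pos)
    have supp: "ball_kernel 1 ((1/r) *\<^sub>R (y - x)) = 0" if "y \<notin> ball x r" for x y :: 'a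
      using affine_unit_ball[OF r, of x "(1/r) *\<^sub>R (y - x)"] r that by (simp add: ball_kernel_def)
    have uJ: "u x = J x / c" if x: "x \<in> ball x0 r" for x
    proof -
      have xS: "ball x r \<subseteq> S" using sub[OF x] \<rho> by blast
      have "u x = weighted_mean 1 x r u" using mean_value_propertyD[OF mean_value_property r xS] by simp
      also have "\<dots> = (\<integral>y. ball_kernel 1 ((1/r) *\<^sub>R (y - x)) * u y \<partial>lborel) / c"
        unfolding c_def using bounded_measurable_subset[OF bm xS] by (intro weighted_mean_conv r) simp
      also have "(\<lambda>y. ball_kernel 1 ((1/r) *\<^sub>R (y - x)) * u y) = (\<lambda>y. ball_kernel 1 ((1/r) *\<^sub>R (y - x)) * w y)"
      proof
        show "ball_kernel 1 ((1/r) *\<^sub>R (y - x)) * u y = ball_kernel 1 ((1/r) *\<^sub>R (y - x)) * w y" for y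
          using supp[of y x] xS by (cases "y \<in> ball x r") (auto simp: w_def)
      qed
      finally show ?thesis by (simp add: J_def)
    qed
    have contk: "continuous_on UNIV (\<lambda>x. ball_kernel 1 ((1/r) *\<^sub>R (y - x)))" for y :: 'a
      unfolding ball_kernel_eq_max[OF one_neq_zero] using r by (intro continuous_intros) auto
    have "continuous_on (ball x0 r) J"
      unfolding continuous_on_sequentially o_def
    proof (intro allI ballI impI, elim conjE)
      fix X :: "nat \<Rightarrow> 'a" and a assume X: "\<forall>n. X n \<in> ball x0 r" "X \<longlonglongrightarrow> a" and a: "a \<in> ball x0 r"
      show "(\<lambda>n. J (X n)) \<longlonglongrightarrow> J a"
        unfolding J_def
      proof (rule integral_dominated_convergence)
        show "integrable lborel (\<lambda>y. C * indicator (ball x0 \<rho>) y)"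
          by (intro integrable_mult_right integrable_real_indicator emeasure_lborel_ball_finite) auto
        show "(\<lambda>y. ball_kernel 1 ((1/r) *\<^sub>R (y - a)) * w y) \<in> borel_measurable lborel"
          "(\<lambda>y. ball_kernel 1 ((1/r) *\<^sub>R (y - X n)) * w y) \<in> borel_measurable lborel" for n
          using wmeas by (simp_all add: measurable_compose[OF _ ball_kernel_measurable])
        show "AE y in lborel. (\<lambda>n. ball_kernel 1 ((1/r) *\<^sub>R (y - X n)) * w y) \<longlonglongrightarrow> ball_kernel 1 ((1/r) *\<^sub>R (y - a)) * w y"
          using contk X(2) by (intro AE_I2 tendsto_intros) (auto simp: continuous_on_eq_continuous_at intro: isCont_tendsto_compose)
        show "AE y in lborel. norm (ball_kernel 1 ((1/r) *\<^sub>R (y - X n)) * w y) \<le> C * indicator (ball x0 \<rho>) y" for n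
        proof (rule AE_I2)
          fix y
          show "norm (ball_kernel 1 ((1/r) *\<^sub>R (y - X n)) * w y) \<le> C * indicator (ball x0 \<rho>) y"
          proof (cases "y \<in> ball (X n) r")
            case True
            then have y: "y \<in> ball x0 \<rho>" using sub X(1) by blast
            have "ball_kernel 1 ((1/r) *\<^sub>R (y - X n)) * \<bar>w y\<bar> \<le> 1 * C"
            proof (rule mult_mono)
              show "ball_kernel 1 ((1/r) *\<^sub>R (y - X n)) \<le> 1"
                by (rule order_trans[OF ball_kernel_le_indicator indicator_le_1])
              show "\<bar>w y\<bar> \<le> C" using C[of y] y \<rho>(2) by (auto simp: w_def)
            qed auto
            then show ?thesis using y by (simp add: abs_mult ball_kernel_nonneg)
          next
            case False
            have "0 \<le> C" using C[OF x0S] by linarith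
            then show ?thesis using supp[OF False] by (simp add: indicator_def)
          qed
        qed
      qed
    qed
    then have "continuous_on (ball x0 r) (\<lambda>x. J x / c)"
      using c by (intro continuous_intros) auto
    then have "continuous_on (ball x0 r) u"
      by (rule continuous_on_eq) (use uJ in auto)
    then show ?thesis using r continuous_on_eq_continuous_at[OF open_ball, of x0 r u] by (metis centre_in_ball)
  qed
  then show ?thesis by (simp add: continuous_at_imp_continuous_on)
qed

lemma mean_value_property_pointwise_limit:
  fixes u :: "'a::euclidean_space \<Rightarrow> real"
  assumes v: "\<And>k. mean_value_property S (v k)" "\<And>k. bounded_measurable_on S (v k)"
    and C: "\<And>k x. x \<in> S \<Longrightarrow> \<bar>v k x\<bar> \<le> C"
    and lim: "\<And>x. x \<in> S \<Longrightarrow> (\<lambda>k. v k x) \<longlonglongrightarrow> u x"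
  shows "mean_value_property S u" "bounded_measurable_on S u"
proof -
  have "(\<lambda>x. indicator S x * u x) \<in> borel_measurable borel"
  proof (rule borel_measurable_LIMSEQ_real)
    show "(\<lambda>k. indicator S x * v k x) \<longlonglongrightarrow> indicator S x * u x" for x
      using lim[of x] by (cases "x \<in> S") auto
  qed (rule bounded_measurable_measurable[OF v(2)])
  moreover have "\<bar>u x\<bar> \<le> C" if "x \<in> S" for x
    using tendsto_rabs[OF lim[OF that]] C[OF that] by (intro LIMSEQ_le_const2) auto
  ultimately show bm: "bounded_measurable_on S u" unfolding bounded_measurable_on_def by blast
  show "mean_value_property S u"
    unfolding mean_value_property_def
  proof (intro allI impI, elim conjE)
    fix x :: 'a and r :: real and m :: nat assume r: "0 < r" "ball x r \<subseteq> S"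
    have sub: "bounded_measurable_on (ball x r) u" "\<And>k. bounded_measurable_on (ball x r) (v k)"
      using bounded_measurable_subset[OF _ r(2)] bm v(2) by auto
    have mem: "x + r *\<^sub>R z \<in> S" if "z \<in> ball 0 1" for z
      using affine_unit_ball[OF r(1), of x z] that r(2) by blast
    have "(\<lambda>k. weighted_mean m x r (v k)) \<longlonglongrightarrow> weighted_mean m x r u"
      by (rule weighted_mean_tendsto[where C=C])
         (use bounded_measurable_measurable[OF bounded_measurable_affine[OF r(1) sub(1)]] bounded_measurable_measurable[OF bounded_measurable_affine[OF r(1) sub(2)]]
           C mem lim in auto)
    then have "(\<lambda>k. v k x) \<longlonglongrightarrow> weighted_mean m x r u" by (simp add: mean_value_propertyD[OF v(1) r])
    moreover have "(\<lambda>k. v k x) \<longlonglongrightarrow> u x" using r by (intro lim) auto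
    ultimately show "weighted_mean m x r u = u x" by (rule LIMSEQ_unique)
  qed
qed

section \<open>Perron's method by successive harmonic replacement\<close>

text \<open>
  Only small balls are tested. This local version is what survives harmonic replacement: a ball that
  straddles the boundary of the replaced ball would otherwise have to be compared with both pieces.
\<close>
definition subharmonic_on :: "'a::euclidean_space set \<Rightarrow> ('a \<Rightarrow> real) \<Rightarrow> bool" where
  "subharmonic_on \<Omega> v \<longleftrightarrow> (\<forall>x\<in>\<Omega>. \<exists>\<rho>>0. ball x \<rho> \<subseteq> \<Omega> \<and> (\<forall>r. 0 < r \<and> r < \<rho> \<longrightarrow> v x \<le> weighted_mean 0 x r v))"

lemma subharmonic_le_mean_value_property:
  fixes v g :: "'a::euclidean_space \<Rightarrow> real"
  assumes U: "bounded U" "open U" and v: "continuous_on (closure U) v" "subharmonic_on U v"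
    and g: "continuous_on (closure U) g" "mean_value_property U g"
    and bdry: "\<And>x. x \<in> frontier U \<Longrightarrow> v x \<le> g x" and x: "x \<in> closure U"
  shows "v x \<le> g x"
proof -
  have "v x - g x \<le> 0"
  proof (rule max_principle[OF U _ _ _ x])
    show "continuous_on (closure U) (\<lambda>x. v x - g x)" by (intro continuous_intros v g)
    show "v y - g y \<le> 0" if "y \<in> frontier U" for y using bdry[OF that] by simp
    fix y assume "y \<in> U"
    then obtain \<rho> where \<rho>: "0 < \<rho>" "ball y \<rho> \<subseteq> U" "\<And>r. 0 < r \<Longrightarrow> r < \<rho> \<Longrightarrow> v y \<le> weighted_mean 0 y r v"
      using v(2) unfolding subharmonic_on_def by blast
    have r: "0 < \<rho>/2" "ball y (\<rho>/2) \<subseteq> U" using \<rho> subset_ball[of "\<rho>/2" \<rho> y] by auto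
    have "bounded_measurable_on (ball y (\<rho>/2)) v" "bounded_measurable_on (ball y (\<rho>/2)) g"
      using bounded_measurable_subset[OF bounded_measurable_continuous_closure[OF _ U] r(2)] v g by auto
    then have "weighted_mean 0 y (\<rho>/2) (\<lambda>x. v x - g x) = weighted_mean 0 y (\<rho>/2) v - g y"
      using weighted_mean_diff[OF r(1), of y v g 0] mean_value_propertyD[OF g(2) r, of 0] by simp
    then have "v y - g y \<le> weighted_mean 0 y (\<rho>/2) (\<lambda>x. v x - g x)" using \<rho>(3)[OF r(1)] \<rho>(1) by simp
    with r show "\<exists>r>0. ball y r \<subseteq> U \<and> v y - g y \<le> weighted_mean 0 y r (\<lambda>x. v x - g x)" by blast
  qed
  then show ?thesis by simp
qed

lemma subharmonic_subset:
  assumes "subharmonic_on S v" "T \<subseteq> S" "open T" shows "subharmonic_on T v"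
  unfolding subharmonic_on_def
proof
  fix x assume x: "x \<in> T"
  obtain \<rho> where \<rho>: "0 < \<rho>" "\<And>r. 0 < r \<Longrightarrow> r < \<rho> \<Longrightarrow> v x \<le> weighted_mean 0 x r v"
    using assms x unfolding subharmonic_on_def by blast
  obtain \<sigma> where \<sigma>: "0 < \<sigma>" "ball x \<sigma> \<subseteq> T" using openE[OF assms(3) x] by metis
  have "ball x (min \<rho> \<sigma>) \<subseteq> T" using \<sigma>(2) by auto
  with \<rho> \<sigma> show "\<exists>\<rho>>0. ball x \<rho> \<subseteq> T \<and> (\<forall>r. 0 < r \<and> r < \<rho> \<longrightarrow> v x \<le> weighted_mean 0 x r v)"
    by (intro exI[of _ "min \<rho> \<sigma>"]) auto
qed

lemma mean_value_property_imp_subharmonic: "open S \<Longrightarrow> mean_value_property S u \<Longrightarrow> subharmonic_on S u"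
  unfolding subharmonic_on_def
proof
  fix x assume S: "open S" "mean_value_property S u" and x: "x \<in> S"
  obtain \<sigma> where \<sigma>: "0 < \<sigma>" "ball x \<sigma> \<subseteq> S" using openE[OF S(1) x] by metis
  have "weighted_mean 0 x r u = u x" if "0 < r" "r < \<sigma>" for r
    using that \<sigma>(2) subset_ball[of r \<sigma> x] by (intro mean_value_propertyD[OF S(2)]) auto
  with \<sigma> show "\<exists>\<rho>>0. ball x \<rho> \<subseteq> S \<and> (\<forall>r. 0 < r \<and> r < \<rho> \<longrightarrow> u x \<le> weighted_mean 0 x r u)" by force
qed

text \<open>
  Replacing \<open>v\<close> inside a ball by the solution of the Dirichlet problem with boundary values \<open>v\<close> increases \<open>v\<close>,
  by the maximum principle. Outside the ball \<open>v' = v\<close> and \<open>v' \<ge> v\<close> everywhere, so the mean value inequality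
  persists there; inside it holds with equality for small radii.
\<close>
lemma harmonic_replacement:
  fixes v :: "'a::euclidean_space \<Rightarrow> real"
  assumes U: "bounded U" "open U" and v: "continuous_on (closure U) v" "subharmonic_on U v"
    and R: "0 < R" "ball c R \<subseteq> U"
  obtains v' where "continuous_on (closure U) v'" "subharmonic_on U v'" "mean_value_property (ball c R) v'"
    "\<And>x. x \<in> closure U \<Longrightarrow> v x \<le> v' x" "\<And>x. x \<in> frontier U \<Longrightarrow> v' x = v x"
proof -
  have cb: "closure (ball c R) = cball c R" using R by simp
  have cbU: "cball c R \<subseteq> closure U" using closure_mono[OF R(2)] cb by simp
  have fr: "frontier (ball c R) \<subseteq> closure U" using cbU cb by (auto simp: frontier_def)
  obtain h where h: "continuous_on (cball c R) h" "mean_value_property (ball c R) h" "\<And>x. x \<in> frontier (ball c R) \<Longrightarrow> h x = v x"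
    using dirichlet_ball[OF R(1) continuous_on_subset[OF v(1) fr]] unfolding dirichlet_solvable_def cb by blast
  have le: "v x \<le> h x" if "x \<in> cball c R" for x
  proof (rule subharmonic_le_mean_value_property[OF bounded_ball open_ball _ subharmonic_subset[OF v(2) R(2) open_ball] _ h(2)])
    show "continuous_on (closure (ball c R)) v" "continuous_on (closure (ball c R)) h"
      using continuous_on_subset[OF v(1) cbU] h(1) by (simp_all only: cb)
    show "x \<in> closure (ball c R)" using that by (simp only: cb)
    show "v y \<le> h y" if "y \<in> frontier (ball c R)" for y using h(3)[OF that] by simp
  qed
  define v' where "v' = (\<lambda>x. if x \<in> ball c R then h x else v x)"
  have ge: "v x \<le> v' x" for x using le[of x] by (auto simp: v'_def)
  have cont: "continuous_on (closure U) v'"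
  proof -
    have "continuous_on (cball c R \<union> (closure U - ball c R)) v'"
      unfolding v'_def
    proof (rule continuous_on_cases)
      show "\<forall>x. x \<in> cball c R \<and> x \<notin> ball c R \<or> x \<in> closure U - ball c R \<and> x \<in> ball c R \<longrightarrow> h x = v x"
        using h(3) cb by (auto simp: frontier_def interior_open)
      show "continuous_on (closure U - ball c R) v" using continuous_on_subset[OF v(1)] by blast
    qed (auto intro: h)
    moreover have "cball c R \<union> (closure U - ball c R) = closure U" using cbU by auto
    ultimately show ?thesis by simp
  qed
  have mean_value_property': "mean_value_property (ball c R) v'"
    unfolding mean_value_property_def
  proof (intro allI impI, elim conjE)
    fix x :: 'a and r :: real and m :: nat assume r: "0 < r" "ball x r \<subseteq> ball c R"
    have "weighted_mean m x r v' = weighted_mean m x r h" using r by (intro weighted_mean_cong) (auto simp: v'_def)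
    moreover have "x \<in> ball c R" using r by (meson centre_in_ball subsetD)
    ultimately show "weighted_mean m x r v' = v' x" using mean_value_propertyD[OF h(2) r, of m] by (simp add: v'_def)
  qed
  have sub': "subharmonic_on U v'"
    unfolding subharmonic_on_def
  proof
    fix x assume x: "x \<in> U"
    show "\<exists>\<rho>>0. ball x \<rho> \<subseteq> U \<and> (\<forall>r. 0 < r \<and> r < \<rho> \<longrightarrow> v' x \<le> weighted_mean 0 x r v')"
    proof (cases "x \<in> ball c R")
      case True
      then show ?thesis
        using mean_value_property_imp_subharmonic[OF open_ball mean_value_property'] R(2) unfolding subharmonic_on_def by (meson order_trans)
    next
      case False
      obtain \<rho> where \<rho>: "0 < \<rho>" "ball x \<rho> \<subseteq> U" "\<And>r. 0 < r \<Longrightarrow> r < \<rho> \<Longrightarrow> v x \<le> weighted_mean 0 x r v"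
        using v(2) x unfolding subharmonic_on_def by blast
      have "v' x \<le> weighted_mean 0 x r v'" if r: "0 < r" "r < \<rho>" for r
      proof -
        have s: "ball x r \<subseteq> U" using r \<rho>(2) subset_ball[of r \<rho> x] by auto
        have "v' x \<le> weighted_mean 0 x r v" using False \<rho>(3)[OF r] by (simp only: v'_def if_False)
        also have "\<dots> \<le> weighted_mean 0 x r v'"
          using bounded_measurable_subset[OF bounded_measurable_continuous_closure[OF _ U] s] v(1) cont ge
          by (intro weighted_mean_mono r) auto
        finally show ?thesis .
      qed
      with \<rho> show ?thesis by blast
    qed
  qed
  have "v' x = v x" if "x \<in> frontier U" for x
    using that R(2) U(2) by (auto simp: v'_def frontier_def interior_open)
  with that[OF cont sub' mean_value_property' ge] show thesis by blast
qed

text \<open>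
  On any ball inside \<open>S\<close>, compare \<open>u\<close> with the solution of the Dirichlet problem that has the same boundary
  values. The difference satisfies the maximum principle in both directions, because that principle only looks
  at small balls; so \<open>u\<close> coincides with the solution.
\<close>
lemma mean_value_property_of_local:
  fixes u :: "'a::euclidean_space \<Rightarrow> real"
  assumes u: "continuous_on (closure S) u" and loc: "\<And>x. x \<in> S \<Longrightarrow> \<exists>T. open T \<and> x \<in> T \<and> mean_value_property T u"
  shows "mean_value_property S u"
  unfolding mean_value_property_def
proof (intro allI impI, elim conjE)
  fix c :: 'a and R :: real and m :: nat assume R: "0 < R" "ball c R \<subseteq> S"
  have cb: "closure (ball c R) = cball c R" using R by simp
  have cbS: "cball c R \<subseteq> closure S" using closure_mono[OF R(2)] cb by simp
  have cu: "continuous_on (cball c R) u" using continuous_on_subset[OF u cbS] .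
  then have "continuous_on (frontier (ball c R)) u"
    by (rule continuous_on_subset) (auto simp: frontier_def cb)
  then obtain h where h: "continuous_on (cball c R) h" "mean_value_property (ball c R) h" "\<And>x. x \<in> frontier (ball c R) \<Longrightarrow> h x = u x"
    using dirichlet_ball[OF R(1), of c u] unfolding dirichlet_solvable_def cb by blast
  have sub: "subharmonic_on (ball c R) (\<lambda>x. k * u x)" for k
    unfolding subharmonic_on_def
  proof
    fix x assume x: "x \<in> ball c R"
    then obtain T where T: "open T" "x \<in> T" "mean_value_property T u" using loc R(2) by blast
    have "open (T \<inter> ball c R)" "x \<in> T \<inter> ball c R" "mean_value_property (T \<inter> ball c R) (\<lambda>x. k * u x)"
      using T x by (auto intro: mean_value_property_cmult mean_value_property_subset)
    then show "\<exists>\<rho>>0. ball x \<rho> \<subseteq> ball c R \<and> (\<forall>r. 0 < r \<and> r < \<rho> \<longrightarrow> k * u x \<le> weighted_mean 0 x r (\<lambda>x. k * u x))"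
      using mean_value_property_imp_subharmonic[of "T \<inter> ball c R" "\<lambda>x. k * u x"] unfolding subharmonic_on_def by (meson le_inf_iff)
  qed
  have le: "k * u x \<le> k * h x" if "x \<in> cball c R" for x k
  proof (rule subharmonic_le_mean_value_property[OF bounded_ball open_ball _ sub _ mean_value_property_cmult[OF h(2)]])
    show "continuous_on (closure (ball c R)) (\<lambda>x. k * u x)" "continuous_on (closure (ball c R)) (\<lambda>x. k * h x)"
      unfolding cb by (intro continuous_intros cu h(1))+
    show "x \<in> closure (ball c R)" using that by (simp only: cb)
    show "k * u y \<le> k * h y" if "y \<in> frontier (ball c R)" for y using h(3)[OF that] by simp
  qed
  have eq: "u x = h x" if "x \<in> cball c R" for x
    using le[OF that, of 1] le[OF that, of "-1"] by simp
  have "weighted_mean m c R u = weighted_mean m c R h" using R eq by (intro weighted_mean_cong) auto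
  also have "\<dots> = h c" using mean_value_propertyD[OF h(2) R(1)] by blast
  finally show "weighted_mean m c R u = u c" using eq[of c] R by simp
qed

text \<open>
  Choose countably many balls covering \<open>U\<close> and replace \<open>f\<close> harmonically in one ball after the other, returning to
  each ball infinitely often. The functions increase and stay below every barrier; on each ball the limit is a
  limit of functions with the mean value property. The barriers force the limit to take the
  boundary values \<open>f\<close> continuously.
\<close>
lemma perron_dirichlet:
  fixes f :: "'a::euclidean_space \<Rightarrow> real"
  assumes U: "bounded U" "open U" "U \<noteq> {}" and f: "continuous_on (closure U) f" "subharmonic_on U f"
    and barrier: "\<And>\<xi> e. \<xi> \<in> frontier U \<Longrightarrow> 0 < e \<Longrightarrow>
      \<exists>g. continuous_on (closure U) g \<and> mean_value_property U g \<and> (\<forall>x\<in>frontier U. f x \<le> g x) \<and> g \<xi> \<le> f \<xi> + e"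
  shows "dirichlet_solvable U f"
proof -
  define F where "F = {B. \<exists>x r. 0 < r \<and> B = ball x r \<and> B \<subseteq> U}"
  have "\<Union>F = U"
  proof
    show "U \<subseteq> \<Union>F"
    proof
      fix x assume "x \<in> U"
      then obtain r where "0 < r" "ball x r \<subseteq> U" using openE[OF U(2)] by metis
      then show "x \<in> \<Union>F" by (auto simp: F_def intro!: exI[of _ "ball x r"])
    qed
  qed (auto simp: F_def)
  moreover have "\<And>B. B \<in> F \<Longrightarrow> open B" by (auto simp: F_def)
  ultimately obtain F' where F': "F' \<subseteq> F" "countable F'" "\<Union>F' = U" by (metis Lindelof)
  then have "F' \<noteq> {}" using U(3) by auto
  define E where "E = from_nat_into F'"
  have EF: "range E = F'" unfolding E_def using \<open>F' \<noteq> {}\<close> F'(2) by (rule range_from_nat_into)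
  \<comment> \<open>the first component of the Cantor pairing takes every value infinitely often\<close>
  define B where "B = (\<lambda>k. E (fst (prod_decode k)))"
  have Eball: "\<exists>x r. 0 < r \<and> E i = ball x r \<and> ball x r \<subseteq> U" for i
  proof -
    have "E i \<in> F" using EF F'(1) by blast
    then show ?thesis by (auto simp: F_def)
  qed
  have "\<exists>v. \<forall>k. (continuous_on (closure U) (v k) \<and> subharmonic_on U (v k) \<and> (\<forall>x\<in>frontier U. v k x = f x) \<and> (\<forall>x\<in>closure U. f x \<le> v k x))
     \<and> (mean_value_property (B k) (v (Suc k)) \<and> (\<forall>x\<in>closure U. v k x \<le> v (Suc k) x))"
  proof (rule dependent_nat_choice)
    show "\<exists>v. continuous_on (closure U) v \<and> subharmonic_on U v \<and> (\<forall>x\<in>frontier U. v x = f x) \<and> (\<forall>x\<in>closure U. f x \<le> v x)"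
      using f by blast
    fix v :: "'a \<Rightarrow> real" and k
    assume v: "continuous_on (closure U) v \<and> subharmonic_on U v \<and> (\<forall>x\<in>frontier U. v x = f x) \<and> (\<forall>x\<in>closure U. f x \<le> v x)"
    obtain x r where B: "0 < r" "B k = ball x r" "ball x r \<subseteq> U" using Eball unfolding B_def by blast
    obtain v' where v': "continuous_on (closure U) v'" "subharmonic_on U v'" "mean_value_property (ball x r) v'"
      "\<And>x. x \<in> closure U \<Longrightarrow> v x \<le> v' x" "\<And>x. x \<in> frontier U \<Longrightarrow> v' x = v x"
      using harmonic_replacement[OF U(1,2), of v r x] v B by blast
    with v B(2) show "\<exists>v'. (continuous_on (closure U) v' \<and> subharmonic_on U v' \<and> (\<forall>x\<in>frontier U. v' x = f x) \<and> (\<forall>x\<in>closure U. f x \<le> v' x))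
       \<and> mean_value_property (B k) v' \<and> (\<forall>x\<in>closure U. v x \<le> v' x)"
      by (intro exI[of _ v']) (auto intro: order_trans)
  qed
  then obtain v where seq: "\<And>k. (continuous_on (closure U) (v k) \<and> subharmonic_on U (v k) \<and> (\<forall>x\<in>frontier U. v k x = f x) \<and> (\<forall>x\<in>closure U. f x \<le> v k x))
     \<and> (mean_value_property (B k) (v (Suc k)) \<and> (\<forall>x\<in>closure U. v k x \<le> v (Suc k) x))" by (elim exE) metis
  have v: "continuous_on (closure U) (v k)" "subharmonic_on U (v k)" "mean_value_property (B k) (v (Suc k))" for k
    using seq[of k] by simp_all
  have v_bdry: "v k x = f x" if "x \<in> frontier U" for k x
    using seq[of k] that by simp
  have v_ge: "f x \<le> v k x" and v_mono: "v k x \<le> v (Suc k) x" if "x \<in> closure U" for k x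
    using seq[of k] that by simp_all
  have upper: "v k x \<le> g x" if "continuous_on (closure U) g" "mean_value_property U g" "\<And>x. x \<in> frontier U \<Longrightarrow> f x \<le> g x" "x \<in> closure U" for g k x
    using subharmonic_le_mean_value_property[OF U(1,2) v(1)[of k] v(2)[of k] that(1,2) _ that(4)] that(3) v_bdry[of _ k] by metis
  have "compact (f ` closure U)"
    using f U by (intro compact_continuous_image) (auto simp: compact_closure)
  then obtain C where C: "\<And>x. x \<in> closure U \<Longrightarrow> \<bar>f x\<bar> \<le> C"
    using compact_imp_bounded bounded_iff by (metis imageI real_norm_def)
  have vC: "\<bar>v k x\<bar> \<le> C" if "x \<in> closure U" for k x
  proof -
    have "v k x \<le> C"
      by (rule upper[of "\<lambda>_. C"])
         (use that C laplacian_zero_mean_value_property[OF has_laplacian_const] in \<open>auto simp: frontier_def abs_le_iff\<close>)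
    then show ?thesis using v_ge[OF that, of k] C[OF that] by linarith
  qed
  define u where "u = (\<lambda>x. SUP k. v k x)"
  have lim: "(\<lambda>k. v k x) \<longlonglongrightarrow> u x" if "x \<in> closure U" for x
    unfolding u_def
  proof (rule LIMSEQ_incseq_SUP)
    show "bdd_above (range (\<lambda>k. v k x))" using vC[OF that] by (intro bdd_aboveI[of _ C]) (auto simp: abs_le_iff)
    show "incseq (\<lambda>k. v k x)" using v_mono[OF that] by (rule incseq_SucI)
  qed
  have ge: "f x \<le> u x" if "x \<in> closure U" for x
    using lim[OF that] v_ge[OF that] by (intro LIMSEQ_le_const) auto
  have le: "u x \<le> g x" if "continuous_on (closure U) g" "mean_value_property U g" "\<And>x. x \<in> frontier U \<Longrightarrow> f x \<le> g x" "x \<in> closure U" for g x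
    using lim[OF that(4)] upper[OF that] by (intro LIMSEQ_le_const2) auto
  have ubd: "u x = f x" if "x \<in> frontier U" for x
    using v_bdry[OF that] by (simp add: u_def)
  have mvpE: "mean_value_property (E i) u" and bmE: "bounded_measurable_on (E i) u" for i
  proof -
    \<comment> \<open>the stages right after a replacement in \<open>E i\<close>\<close>
    define \<kappa> where "\<kappa> = (\<lambda>j. Suc (prod_encode (i, j)))"
    have "filterlim \<kappa> at_top sequentially"
      by (rule filterlim_at_top_mono[OF filterlim_ident])
         (auto simp: \<kappa>_def le_SucI le_prod_encode_2)
    note sub = filterlim_compose[OF lim this]
    have BE: "B (prod_encode (i, j)) = E i" for j by (simp add: B_def)
    obtain x r where Ei: "0 < r" "E i = ball x r" "ball x r \<subseteq> U" using Eball by blast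
    have EU: "E i \<subseteq> closure U" using Ei closure_subset by blast
    have m: "mean_value_property (E i) (v (\<kappa> j))" for j using v(3)[of "prod_encode (i, j)"] by (simp add: BE \<kappa>_def)
    have b: "bounded_measurable_on (E i) (v (\<kappa> j))" for j
      using bounded_measurable_subset[OF bounded_measurable_continuous_closure[OF v(1) U(1,2)]] Ei by simp
    have c: "\<bar>v (\<kappa> j) y\<bar> \<le> C" if "y \<in> E i" for j y
      using vC EU that by blast
    have l: "(\<lambda>j. v (\<kappa> j) y) \<longlonglongrightarrow> u y" if "y \<in> E i" for y
      using sub EU that by blast
    show "mean_value_property (E i) u" by (rule mean_value_property_pointwise_limit(1)[OF m b c l])
    show "bounded_measurable_on (E i) u" by (rule mean_value_property_pointwise_limit(2)[OF m b c l])
  qed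
  have loc: "\<exists>T. open T \<and> x \<in> T \<and> mean_value_property T u \<and> bounded_measurable_on T u" if xU: "x \<in> U" for x
  proof -
    obtain i where i: "x \<in> E i"
      using xU unfolding F'(3)[symmetric] EF[symmetric] by auto
    moreover have "open (E i)" using Eball[of i] by auto
    ultimately show ?thesis using mvpE bmE by blast
  qed
  have "continuous_on (closure U) u"
    unfolding continuous_on_eq_continuous_within
  proof
    fix x assume x: "x \<in> closure U"
    show "continuous (at x within closure U) u"
    proof (cases "x \<in> U")
      case True
      then obtain T where "open T" "x \<in> T" "mean_value_property T u" "bounded_measurable_on T u" using loc by blast
      then have "continuous (at x) u"
        using mean_value_property_continuous continuous_on_eq_continuous_at by blast
      then show ?thesis by (rule continuous_at_imp_continuous_within)
    next
      case False
      then have xf: "x \<in> frontier U" using x U(2) by (simp add: frontier_def interior_open)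
      show ?thesis
        unfolding continuous_within tendsto_iff
      proof (intro allI impI)
        fix e :: real assume e: "0 < e"
        obtain g where g: "continuous_on (closure U) g" "mean_value_property U g" "\<And>x. x \<in> frontier U \<Longrightarrow> f x \<le> g x" "g x \<le> f x + e / 2"
          using barrier[OF xf, of "e/2"] e by auto
        have "(f \<longlongrightarrow> f x) (at x within closure U)" "(g \<longlongrightarrow> g x) (at x within closure U)"
          using f(1) g(1) x unfolding continuous_on by auto
        then have "\<forall>\<^sub>F y in at x within closure U. dist (f y) (f x) < e" "\<forall>\<^sub>F y in at x within closure U. dist (g y) (g x) < e / 2"
          using tendstoD[of f _ _ e] tendstoD[of g _ _ "e / 2"] half_gt_zero[OF e] e by blast+
        moreover have "\<forall>\<^sub>F y in at x within closure U. y \<in> closure U" by (simp add: eventually_at_filter)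
        ultimately show "\<forall>\<^sub>F y in at x within closure U. dist (u y) (u x) < e"
        proof eventually_elim
          case (elim y)
          have "f y \<le> u y" "u y \<le> g y" using ge le[OF g(1,2,3)] elim(3) by auto
          with elim(1,2) g(4) show ?case unfolding ubd[OF xf] dist_real_def by linarith
        qed
      qed
    qed
  qed
  moreover from this have "mean_value_property U u" using loc by (intro mean_value_property_of_local) blast+
  ultimately show ?thesis using ubd unfolding dirichlet_solvable_def by blast
qed

section \<open>Barriers on strongly convex domains\<close>

lemma strongly_convex_segment:
  assumes "strongly_convex \<Omega>" "x \<in> closure \<Omega>" "y \<in> closure \<Omega>" "x \<noteq> y" "0 < a" "0 < b" "a + b = 1"
  shows "a *\<^sub>R x + b *\<^sub>R y \<in> \<Omega>"
proof -
  let ?c = "\<lambda>z. if z = x then a else b"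
  have "(\<Sum>z\<in>{x, y}. ?c z *\<^sub>R z) \<in> \<Omega>"
    using assms(1)[unfolded strongly_convex_def, rule_format, of "{x, y}" ?c] assms(2-) by auto
  then show ?thesis using assms(4) by auto
qed

lemma strongly_convex_imp_convex:
  assumes "strongly_convex \<Omega>" shows "convex \<Omega>"
proof (rule convexI)
  fix x y a b assume *: "x \<in> \<Omega>" "y \<in> \<Omega>" "0 \<le> a" "0 \<le> b" "a + b = (1::real)"
  show "a *\<^sub>R x + b *\<^sub>R y \<in> \<Omega>"
  proof (cases "x = y \<or> a = 0 \<or> b = 0")
    case True
    then show ?thesis using * by (auto simp: scaleR_add_left[symmetric])
  next
    case False
    then show ?thesis using * closure_subset by (intro strongly_convex_segment[OF assms]) auto
  qed
qed

text \<open>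
  This is where strong convexity enters. A supporting hyperplane at \<open>\<xi>\<close> cannot contain a second point of the closure,
  since the midpoint would be a point of the open set \<open>\<Omega>\<close> on the hyperplane.
\<close>
lemma strongly_convex_strict_support:
  fixes \<Omega> :: "'a::euclidean_space set"
  assumes sc: "strongly_convex \<Omega>" and op: "open \<Omega>" and \<xi>: "\<xi> \<in> frontier \<Omega>"
  obtains a where "\<And>x. x \<in> closure \<Omega> \<Longrightarrow> x \<noteq> \<xi> \<Longrightarrow> 0 < a \<bullet> (x - \<xi>)"
proof -
  have \<xi>': "\<xi> \<in> closure \<Omega>" "\<xi> \<notin> \<Omega>" using \<xi> op by (auto simp: frontier_def interior_open)
  then have "\<Omega> \<noteq> {}" by auto
  with \<xi>' obtain a b where ab: "a \<noteq> 0" "\<forall>x\<in>\<Omega>. a \<bullet> x \<le> b" "\<forall>x\<in>{\<xi>}. b \<le> a \<bullet> x"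
    using separating_hyperplane_sets[OF strongly_convex_imp_convex[OF sc], of "{\<xi>}"] by auto
  then have le: "a \<bullet> x \<le> a \<bullet> \<xi>" if "x \<in> \<Omega>" for x using that by force
  have lt: "a \<bullet> x < a \<bullet> \<xi>" if x: "x \<in> \<Omega>" for x
  proof -
    obtain r where r: "0 < r" "ball x r \<subseteq> \<Omega>" using openE[OF op x] by metis
    let ?y = "x + (r / (2 * norm a)) *\<^sub>R a"
    have "?y \<in> ball x r" using r ab(1) by (simp add: dist_norm)
    then have "a \<bullet> ?y \<le> a \<bullet> \<xi>" using r le by blast
    moreover have "0 < (r / (2 * norm a)) * (a \<bullet> a)" using r ab(1) by simp
    ultimately show ?thesis by (simp add: inner_add_right)
  qed
  have le': "a \<bullet> x \<le> a \<bullet> \<xi>" if "x \<in> closure \<Omega>" for x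
  proof -
    have "closure \<Omega> \<subseteq> {x. a \<bullet> x \<le> a \<bullet> \<xi>}"
      using le by (intro closure_minimal closed_halfspace_le) auto
    then show ?thesis using that by blast
  qed
  have "a \<bullet> x < a \<bullet> \<xi>" if x: "x \<in> closure \<Omega>" "x \<noteq> \<xi>" for x
  proof -
    have "(1/2) *\<^sub>R x + (1/2) *\<^sub>R \<xi> \<in> \<Omega>" using x \<xi>' by (intro strongly_convex_segment[OF sc]) auto
    from lt[OF this] show ?thesis by (simp add: inner_add_right)
  qed
  then show thesis by (intro that[of "- a"]) (simp add: inner_diff_right)
qed

text \<open>
  The barrier is affine, namely \<open>f \<xi> + e\<close> plus a large multiple of the strictly supporting functional at \<open>\<xi>\<close>.
  Close to \<open>\<xi>\<close> the constant dominates \<open>f\<close>; elsewhere the functional is bounded away from zero.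
\<close>
lemma strongly_convex_barrier:
  fixes \<Omega> :: "'a::euclidean_space set"
  assumes sc: "strongly_convex \<Omega>" and op: "open \<Omega>" and bd: "bounded \<Omega>" and \<xi>: "\<xi> \<in> frontier \<Omega>"
    and f: "continuous_on (closure \<Omega>) f" and e: "0 < e"
  shows "\<exists>g. continuous_on (closure \<Omega>) g \<and> mean_value_property \<Omega> g \<and> (\<forall>x\<in>frontier \<Omega>. f x \<le> g x) \<and> g \<xi> \<le> f \<xi> + e"
proof -
  obtain a where a: "\<And>x. x \<in> closure \<Omega> \<Longrightarrow> x \<noteq> \<xi> \<Longrightarrow> 0 < a \<bullet> (x - \<xi>)"
    using strongly_convex_strict_support[OF sc op \<xi>] by blast
  have comp: "compact (closure \<Omega>)" using bd by (simp add: compact_closure)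
  then have "compact (f ` closure \<Omega>)" using f by (intro compact_continuous_image)
  then obtain M where M: "\<And>x. x \<in> closure \<Omega> \<Longrightarrow> \<bar>f x\<bar> \<le> M"
    using compact_imp_bounded bounded_iff by (metis imageI real_norm_def)
  have \<xi>': "\<xi> \<in> closure \<Omega>" using \<xi> by (simp add: frontier_def)
  have M0: "0 \<le> M" using M[OF \<xi>'] by linarith
  define K where "K = closure \<Omega> \<inter> f -` {f \<xi> + e ..}"
  have "closed K" unfolding K_def using f by (intro continuous_closed_preimage) auto
  then have K: "compact K" using compact_Int_closed[OF comp, of K] unfolding K_def by (simp add: Int_assoc[symmetric])
  obtain \<mu> where \<mu>: "0 < \<mu>" "\<And>x. x \<in> K \<Longrightarrow> \<mu> \<le> a \<bullet> (x - \<xi>)"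
  proof (cases "K = {}")
    case True
    then show ?thesis using that[of 1] by simp
  next
    case False
    have "continuous_on K (\<lambda>x. a \<bullet> (x - \<xi>))" by (intro continuous_intros)
    then obtain y where y: "y \<in> K" "\<And>x. x \<in> K \<Longrightarrow> a \<bullet> (y - \<xi>) \<le> a \<bullet> (x - \<xi>)"
      using continuous_attains_inf[OF K False] by metis
    moreover have "y \<noteq> \<xi>" "y \<in> closure \<Omega>" using y(1) e by (auto simp: K_def)
    ultimately show ?thesis using that[of "a \<bullet> (y - \<xi>)"] a by blast
  qed
  \<comment> \<open>\<open>f x - f \<xi>\<close> is at most \<open>2 M\<close>, while the functional is at least \<open>\<mu>\<close> on \<open>K\<close>\<close>
  define g where "g = (\<lambda>x. (f \<xi> + e) + (2 * M / \<mu>) * (a \<bullet> (x - \<xi>)))"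
  have C2: "has_laplacian g (\<lambda>x. 0 + (2 * M / \<mu>) *\<^sub>R a) (\<lambda>_. 0)"
    using has_laplacian_add[OF has_laplacian_const[of "f \<xi> + e"] has_laplacian_cmult[OF has_laplacian_inner[of a \<xi>], of "2 * M / \<mu>"]]
    by (simp add: g_def)
  have "f x \<le> g x" if x: "x \<in> closure \<Omega>" for x
  proof (cases "x \<in> K")
    case True
    then have "1 \<le> (a \<bullet> (x - \<xi>)) / \<mu>" using \<mu> by simp
    then have "2 * M * 1 \<le> 2 * M * ((a \<bullet> (x - \<xi>)) / \<mu>)" using M0 by (intro mult_left_mono) auto
    then show ?thesis using M[OF x] M[OF \<xi>'] e by (simp add: g_def)
  next
    case False
    then have "f x < f \<xi> + e" using x by (simp add: K_def)
    moreover have "0 \<le> a \<bullet> (x - \<xi>)" using a[OF x] by (cases "x = \<xi>") auto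
    then have "0 \<le> (2 * M / \<mu>) * (a \<bullet> (x - \<xi>))" using M0 \<mu> by (intro mult_nonneg_nonneg) auto
    ultimately show ?thesis by (simp add: g_def)
  qed
  then have "\<forall>x\<in>frontier \<Omega>. f x \<le> g x" by (simp add: frontier_def)
  moreover have "g \<xi> \<le> f \<xi> + e" by (simp add: g_def)
  ultimately show ?thesis using laplacian_zero_mean_value_property[OF C2] has_laplacian_continuous[OF C2] by blast
qed

lemma bounded_measurable_ball_continuous: "continuous_on UNIV u \<Longrightarrow> bounded_measurable_on (ball x r) u"
  by (intro bounded_measurable_continuous_closure) (auto intro: continuous_on_subset)

text \<open>
  The exponential is convex, so it lies above its tangent at \<open>x\<close>, an affine function whose mean is its value at the centre.
\<close>
lemma exp_inner_subharmonic:
  assumes "open S" shows "subharmonic_on S (\<lambda>x. exp (a \<bullet> x))"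
proof -
  have "exp (a \<bullet> x) \<le> weighted_mean 0 x r (\<lambda>y. exp (a \<bullet> y))" if r: "0 < r" for x r
  proof -
    let ?l = "\<lambda>y. exp (a \<bullet> x) * (1 + a \<bullet> (y - x))"
    have C2: "has_laplacian ?l (\<lambda>y. exp (a \<bullet> x) *\<^sub>R (0 + a)) (\<lambda>_. 0)"
      using has_laplacian_cmult[OF has_laplacian_add[OF has_laplacian_const[of 1] has_laplacian_inner[of a x]], of "exp (a \<bullet> x)"] by simp
    have "exp (a \<bullet> x) = weighted_mean 0 x r ?l" using laplacian_zero_weighted_mean[OF C2, of 0 x r] by simp
    also have "\<dots> \<le> weighted_mean 0 x r (\<lambda>y. exp (a \<bullet> y))"
    proof (rule weighted_mean_mono[OF r])
      show "exp (a \<bullet> x) * (1 + a \<bullet> (y - x)) \<le> exp (a \<bullet> y)" for y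
      proof -
        have "exp (a \<bullet> x) * (1 + a \<bullet> (y - x)) \<le> exp (a \<bullet> x) * exp (a \<bullet> (y - x))"
          by (intro mult_left_mono exp_ge_add_one_self) auto
        then show ?thesis by (simp add: exp_add[symmetric] inner_diff_right)
      qed
    qed (auto intro!: bounded_measurable_ball_continuous continuous_intros)
    finally show ?thesis .
  qed
  then show ?thesis unfolding subharmonic_on_def using openE[OF assms] by metis
qed

lemma dirichlet_strongly_convex:
  fixes \<Omega> :: "'a::euclidean_space set"
  assumes "strongly_convex \<Omega>" "open \<Omega>" "bounded \<Omega>" "\<Omega> \<noteq> {}" "continuous_on (frontier \<Omega>) f"
  shows "dirichlet_solvable \<Omega> f"
proof (rule dirichlet_from_exponentials[OF assms(3,2) _ assms(5)])
  fix a
  have "continuous_on (closure \<Omega>) (\<lambda>x. exp (a \<bullet> x))" by (intro continuous_intros)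
  then show "dirichlet_solvable \<Omega> (\<lambda>x. exp (a \<bullet> x))"
    by (intro perron_dirichlet assms exp_inner_subharmonic strongly_convex_barrier)
qed

section \<open>Smoothness of functions with the mean value property\<close>

lemma DERIV_eventually_eq:
  assumes "(g has_field_derivative D) (at x)" "\<forall>\<^sub>F t in nhds x. f t = g t"
  shows "(f has_field_derivative D) (at x)"
  using DERIV_cong_ev[OF refl assms(2) refl] assms(1) by simp

lemma has_real_derivative_pos_part_power:
  assumes "2 \<le> m"
  shows "((\<lambda>t::real. (max 0 t) ^ m) has_field_derivative m * (max 0 t) ^ (m - 1)) (at t)"
proof -
  consider "t < 0" | "t = 0" | "0 < t" by linarith
  then show ?thesis
  proof cases
    case 1
    have "\<forall>\<^sub>F s in nhds t. s \<in> {..<0}" using 1 by (intro eventually_nhds_in_open) auto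
    then have "\<forall>\<^sub>F s in nhds t. (max 0 s) ^ m = 0"
      by eventually_elim (use assms in \<open>auto simp: max_def\<close>)
    then have "((\<lambda>t. (max 0 t) ^ m) has_field_derivative 0) (at t)"
      using DERIV_cong_ev[OF refl _ refl, of "\<lambda>t. (max 0 t) ^ m" "\<lambda>_. 0" t 0] by simp
    moreover have "real m * (max 0 t) ^ (m - 1) = 0" using 1 assms by (simp add: max_absorb1)
    ultimately show ?thesis by (simp only:)
  next
    case 2
    have "((\<lambda>h. (max 0 (0 + h)) ^ m / h) \<longlongrightarrow> 0) (at (0::real))"
    proof (rule Lim_null_comparison)
      have "((\<lambda>h::real. \<bar>h\<bar> ^ (m - 1)) \<longlongrightarrow> \<bar>0\<bar> ^ (m - 1)) (at 0)" by (intro tendsto_intros)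
      moreover have "\<bar>0::real\<bar> ^ (m - 1) = 0" using assms by auto
      ultimately show "((\<lambda>h::real. \<bar>h\<bar> ^ (m - 1)) \<longlongrightarrow> 0) (at 0)" by (simp only:)
      have "norm ((max 0 (0 + h)) ^ m / h) \<le> \<bar>h\<bar> ^ (m - 1)" for h :: real
      proof (cases "0 < h")
        case True
        then show ?thesis using assms by (cases m) auto
      next
        case False
        then have z: "(max 0 (0 + h)) ^ m = 0" using assms by (simp add: max_absorb1)
        show ?thesis unfolding z by simp
      qed
      then show "\<forall>\<^sub>F h in at 0. norm ((max 0 (0 + h)) ^ m / h) \<le> \<bar>h\<bar> ^ (m - 1)" by simp
    qed
    moreover have z: "(0::real) ^ m = 0" "(0::real) ^ (m - 1) = 0" using assms by auto
    ultimately show ?thesis by (simp only: DERIV_def 2 max.idem z mult_zero_right diff_zero)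
  next
    case 3
    have "\<forall>\<^sub>F s in nhds t. s \<in> {0<..}" using 3 by (intro eventually_nhds_in_open) auto
    then have "\<forall>\<^sub>F s in nhds t. (max 0 s) ^ m = s ^ m"
      by eventually_elim auto
    then have "((\<lambda>t. (max 0 t) ^ m) has_field_derivative m * t ^ (m - 1)) (at t)"
      using DERIV_cong_ev[OF refl _ refl, of "\<lambda>t. (max 0 t) ^ m" "\<lambda>t. t ^ m" t "m * t ^ (m - 1)"]
        DERIV_pow[of m t UNIV] by simp
    then show ?thesis using 3 by simp
  qed
qed

text \<open>
  Integration over a box inside the domain, where \<open>u\<close> is continuous, makes differentiation under the integral sign available.
\<close>
definition box_convolution :: "'a::euclidean_space \<Rightarrow> 'a \<Rightarrow> ('a \<Rightarrow> real) \<Rightarrow> ('a \<Rightarrow> real) \<Rightarrow> 'a \<Rightarrow> real" where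
  "box_convolution l h u K x = integral (cbox l h) (\<lambda>y. K (y - x) * u y)"

lemma box_convolution_integrand_continuous:
  fixes K u :: "'a::euclidean_space \<Rightarrow> real"
  assumes "continuous_on UNIV K" "continuous_on (cbox l h) u"
  shows "continuous_on (UNIV \<times> cbox l h) (\<lambda>(x, y). K (y - x) * u y)"
  unfolding split_beta
  by (intro continuous_on_compose2[OF assms(1)] continuous_on_compose2[OF assms(2)] continuous_intros) auto

lemma box_convolution_integrable:
  fixes K u :: "'a::euclidean_space \<Rightarrow> real"
  assumes "continuous_on UNIV K" "continuous_on (cbox l h) u"
  shows "(\<lambda>y. K (y - x) * u y) integrable_on cbox l h"
  by (intro integrable_continuous continuous_intros continuous_on_compose2[OF assms(1)] assms(2)) auto

lemma box_convolution_continuous: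
  assumes "continuous_on UNIV K" "continuous_on (cbox l h) u"
  shows "continuous_on UNIV (box_convolution l h u K)"
  unfolding box_convolution_def by (rule integral_continuous_on_param[OF box_convolution_integrand_continuous[OF assms]])

lemma box_convolution_deriv:
  assumes K: "continuous_on UNIV K" "continuous_on UNIV K'" and u: "continuous_on (cbox l h) u"
    and d: "\<And>z \<tau>. ((\<lambda>t. K (z + t *\<^sub>R b)) has_field_derivative K' (z + \<tau> *\<^sub>R b)) (at \<tau>)"
  shows "((\<lambda>t. box_convolution l h u K (x + t *\<^sub>R b)) has_field_derivative - box_convolution l h u K' (x + \<tau> *\<^sub>R b)) (at \<tau>)"
proof -
  have "((\<lambda>t. integral (cbox l h) (\<lambda>y. K (y - (x + t *\<^sub>R b)) * u y)) has_field_derivative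
      integral (cbox l h) (\<lambda>y. - K' (y - (x + \<tau> *\<^sub>R b)) * u y)) (at \<tau> within UNIV)"
  proof (rule leibniz_rule_field_derivative)
    fix \<tau> y
    have "((\<lambda>t. K ((y - x) + (- t) *\<^sub>R b)) has_field_derivative K' ((y - x) + (- \<tau>) *\<^sub>R b) * (-1)) (at \<tau>)"
      by (rule DERIV_chain2[OF d]) (auto intro!: derivative_eq_intros)
    then have "((\<lambda>t. K (y - (x + t *\<^sub>R b))) has_field_derivative - K' (y - (x + \<tau> *\<^sub>R b))) (at \<tau>)"
      by (simp add: algebra_simps)
    then show "((\<lambda>t. K (y - (x + t *\<^sub>R b)) * u y) has_field_derivative - K' (y - (x + \<tau> *\<^sub>R b)) * u y) (at \<tau>)"
      by (rule DERIV_cmult_right)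
  next
    show "(\<lambda>y. K (y - (x + t *\<^sub>R b)) * u y) integrable_on cbox l h" for t
      by (rule box_convolution_integrable[OF K(1) u])
    show "continuous_on (UNIV \<times> cbox l h) (\<lambda>(t, y). - K' (y - (x + t *\<^sub>R b)) * u y)"
      unfolding split_beta
      by (intro continuous_on_compose2[OF K(2)] continuous_on_compose2[OF u] continuous_intros) auto
  qed auto
  then show ?thesis by (simp add: box_convolution_def)
qed

text \<open>
  The kernel of exponent \<open>m\<close> rescaled to radius \<open>r\<close>, without normalisation. It is of class \<open>C\<^sup>2\<close> for \<open>m = 3\<close>.
\<close>
definition bump :: "real \<Rightarrow> nat \<Rightarrow> 'a::euclidean_space \<Rightarrow> real" where
  "bump r m z = (max 0 (r\<^sup>2 - (norm z)\<^sup>2)) ^ m"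

lemma bump_continuous: "continuous_on A (bump r m)"
  unfolding bump_def by (intro continuous_intros)

lemma bump_deriv:
  assumes "2 \<le> m"
  shows "((\<lambda>t. bump r m (z + t *\<^sub>R b)) has_field_derivative
    - 2 * real m * ((z + \<tau> *\<^sub>R b) \<bullet> b) * bump r (m - 1) (z + \<tau> *\<^sub>R b)) (at \<tau>)"
proof -
  have "((\<lambda>t. r\<^sup>2 - (norm (z + t *\<^sub>R b))\<^sup>2) has_field_derivative -2 * ((z + \<tau> *\<^sub>R b) \<bullet> b)) (at \<tau>)"
    unfolding power2_norm_eq_inner inner_add_left inner_add_right inner_scaleR_left inner_scaleR_right
    by (auto intro!: derivative_eq_intros simp: inner_commute algebra_simps)
  from DERIV_chain2[OF has_real_derivative_pos_part_power[OF assms] this]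
  show ?thesis unfolding bump_def by (rule DERIV_cong) simp
qed

definition bump_mass :: "real \<Rightarrow> nat \<Rightarrow> 'a::euclidean_space itself \<Rightarrow> real" where
  "bump_mass r m T = r ^ (2 * m) * (r ^ DIM('a) * (\<integral>z. ball_kernel m (z::'a) \<partial>lborel))"

lemma bump_mass_pos: "0 < r \<Longrightarrow> 0 < bump_mass r m T"
  unfolding bump_mass_def by (intro mult_pos_pos zero_less_power ball_kernel_integral_pos)

lemma box_convolution_bump:
  fixes u :: "'a::euclidean_space \<Rightarrow> real"
  assumes r: "0 < r" and m: "m \<noteq> 0" and sub: "ball x r \<subseteq> cbox l h"
    and u: "continuous_on (cbox l h) u" "mean_value_property (cbox l h) u"
  shows "box_convolution l h u (bump r m) x = bump_mass r m TYPE('a) * u x"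
proof -
  have k: "bump r m (y - x) = r ^ (2 * m) * ball_kernel m ((1/r) *\<^sub>R (y - x))" for y
  proof -
    have "r\<^sup>2 - (norm (y - x))\<^sup>2 = r\<^sup>2 * (1 - (norm ((1/r) *\<^sub>R (y - x)))\<^sup>2)"
      using r by (simp add: power_divide right_diff_distrib)
    then have "max 0 (r\<^sup>2 - (norm (y - x))\<^sup>2) = r\<^sup>2 * max 0 (1 - (norm ((1/r) *\<^sub>R (y - x)))\<^sup>2)"
      using r by (simp add: max_mult_distrib_left)
    then show ?thesis unfolding bump_def ball_kernel_eq_max[OF m] by (simp add: power_mult_distrib power_mult)
  qed
  have supp: "bump r m (y - x) = 0" if "y \<notin> ball x r" for y
  proof -
    have "r\<^sup>2 \<le> (norm (y - x))\<^sup>2" using that r by (intro power_mono) (auto simp: dist_norm norm_minus_commute)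
    then show ?thesis using m by (simp add: bump_def)
  qed
  have bm: "bounded_measurable_on (ball x r) u"
  proof (rule bounded_measurable_continuous_closure)
    have "closure (ball x r) \<subseteq> cbox l h" using sub by (intro closure_minimal) auto
    then show "continuous_on (closure (ball x r)) u" by (rule continuous_on_subset[OF u(1)])
  qed auto
  have "box_convolution l h u (bump r m) x = (\<integral>y. bump r m (y - x) * u y \<partial>lborel)"
    unfolding box_convolution_def
  proof (rule lborel_integral_eq_integral_on(2)[symmetric])
    show "continuous_on (cbox l h) (\<lambda>y. bump r m (y - x) * u y)"
      by (intro continuous_intros u(1) continuous_on_compose2[OF bump_continuous[of UNIV]]) auto
    show "bump r m (y - x) * u y = 0" if "y \<notin> cbox l h" for y
      using supp[of y] sub that by (cases "y \<in> ball x r") auto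
  qed
  also have "\<dots> = r ^ (2 * m) * (\<integral>y. ball_kernel m ((1/r) *\<^sub>R (y - x)) * u y \<partial>lborel)"
    by (simp add: k mult.assoc)
  also have "(\<integral>y. ball_kernel m ((1/r) *\<^sub>R (y - x)) * u y \<partial>lborel)
     = weighted_mean m x r u * (r ^ DIM('a) * (\<integral>z. ball_kernel m (z::'a) \<partial>lborel))"
    using r ball_kernel_integral_pos[of m, where 'a='a] by (simp add: weighted_mean_conv[OF r bm])
  also have "weighted_mean m x r u = u x" using mean_value_propertyD[OF u(2) r sub] .
  finally show ?thesis by (simp add: bump_mass_def)
qed

text \<open>
  The Laplacian of \<open>bump r 3\<close> is \<open>24 r\<^sup>2 bump r 1 - (24 + 6 n) bump r 2\<close>, a combination of the kernels of exponent 1 and 2.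
  Convolving it with \<open>u\<close> therefore multiplies \<open>u\<close> by a constant, and this is that constant relative to
  the mass of \<open>bump r 3\<close>.
\<close>
definition bump_laplacian_const :: "real \<Rightarrow> 'a::euclidean_space itself \<Rightarrow> real" where
  "bump_laplacian_const r T = (24 * r\<^sup>2 * bump_mass r 1 T - (24 + 6 * DIM('a)) * bump_mass r 2 T) / bump_mass r 3 T"

lemma mean_value_property_local_derivs:
  fixes u :: "'a::euclidean_space \<Rightarrow> real"
  assumes r: "0 < r" and sub: "ball x0 (2 * r) \<subseteq> cbox l h"
    and u: "continuous_on (cbox l h) u" "mean_value_property (cbox l h) u"
  shows "\<exists>P Q. (\<forall>b. continuous_on UNIV (P b)) \<and> (\<forall>b c. continuous_on UNIV (Q b c))
      \<and> (\<forall>b. \<forall>x\<in>ball x0 r. ((\<lambda>t. u (x + t *\<^sub>R b)) has_field_derivative P b x) (at 0))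
      \<and> (\<forall>b c x. ((\<lambda>t. P b (x + t *\<^sub>R c)) has_field_derivative Q b c x) (at 0))
      \<and> (\<forall>x\<in>ball x0 r. (\<Sum>b\<in>Basis. Q b b x) = bump_laplacian_const r TYPE('a) * u x)"
proof -
  define T where "T = bump_mass r 3 TYPE('a)"
  have T: "0 < T" unfolding T_def using bump_mass_pos[OF r] .
  \<comment> \<open>the first and second directional derivatives of \<open>bump r 3\<close>\<close>
  define K1 where "K1 = (\<lambda>b z::'a. -6 * (z \<bullet> b) * bump r 2 z)"
  define K2 where "K2 = (\<lambda>b c z::'a. 24 * (z \<bullet> b) * (z \<bullet> c) * bump r 1 z - 6 * (c \<bullet> b) * bump r 2 z)"
  have cK: "continuous_on UNIV (K1 b)" "continuous_on UNIV (K2 b c)" for b c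
    unfolding K1_def K2_def by (intro continuous_intros bump_continuous)+
  have d1: "((\<lambda>t. bump r 3 (z + t *\<^sub>R b)) has_field_derivative K1 b (z + \<tau> *\<^sub>R b)) (at \<tau>)" for b z :: 'a and \<tau>
    using bump_deriv[of 3 r z b \<tau>] by (simp add: K1_def)
  have d2: "((\<lambda>t. K1 b (z + t *\<^sub>R c)) has_field_derivative K2 b c (z + \<tau> *\<^sub>R c)) (at \<tau>)" for b c z :: 'a and \<tau>
  proof -
    have "((\<lambda>t. -6 * ((z + t *\<^sub>R c) \<bullet> b)) has_field_derivative -6 * (c \<bullet> b)) (at \<tau>)"
      unfolding inner_add_left inner_scaleR_left by (auto intro!: derivative_eq_intros)
    from DERIV_mult[OF this bump_deriv[of 2 r z c \<tau>]]
    show ?thesis unfolding K1_def by (rule DERIV_cong) (simp_all add: K2_def algebra_simps)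
  qed
  define P where "P = (\<lambda>b x. - (1/T) * box_convolution l h u (K1 b) x)"
  define Q where "Q = (\<lambda>b c x. (1/T) * box_convolution l h u (K2 b c) x)"
  have small: "ball x r \<subseteq> cbox l h" if "x \<in> ball x0 r" for x
  proof
    fix y assume "y \<in> ball x r"
    then have "y \<in> ball x0 (2 * r)" using that dist_triangle[of x0 y x] by simp
    then show "y \<in> cbox l h" using sub by blast
  qed
  have uv: "u x = (1/T) * box_convolution l h u (bump r 3) x" if "x \<in> ball x0 r" for x
    using box_convolution_bump[OF r _ small[OF that] u, of 3] T by (simp add: T_def)
  show ?thesis
  proof (intro exI[of _ P] exI[of _ Q] conjI allI ballI)
    show "continuous_on UNIV (P b)" for b
      unfolding P_def by (intro continuous_intros box_convolution_continuous cK u)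
    show "continuous_on UNIV (Q b c)" for b c
      unfolding Q_def by (intro continuous_intros box_convolution_continuous cK u)
    show "((\<lambda>t. P b (x + t *\<^sub>R c)) has_field_derivative Q b c x) (at 0)" for b c x
      using DERIV_cmult[OF box_convolution_deriv[OF cK(1)[of b] cK(2)[of b c] u(1) d2, of x 0], of "- (1/T)"]
      by (simp add: P_def Q_def)
    fix x assume x: "x \<in> ball x0 r"
    show "((\<lambda>t. u (x + t *\<^sub>R b)) has_field_derivative P b x) (at 0)" for b
    proof -
      have "((\<lambda>t. (1/T) * box_convolution l h u (bump r 3) (x + t *\<^sub>R b)) has_field_derivative P b x) (at 0)"
        using DERIV_cmult[OF box_convolution_deriv[OF bump_continuous cK(1)[of b] u(1) d1, of x 0], of "1/T"]
        by (simp add: P_def)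
      moreover have "\<forall>\<^sub>F t in nhds 0. u (x + t *\<^sub>R b) = (1/T) * box_convolution l h u (bump r 3) (x + t *\<^sub>R b)"
      proof -
        have "open ((\<lambda>t. x + t *\<^sub>R b) -` ball x0 r)"
          by (intro open_vimage continuous_intros) auto
        then have "\<forall>\<^sub>F t in nhds 0. t \<in> (\<lambda>t. x + t *\<^sub>R b) -` ball x0 r"
          using x by (intro eventually_nhds_in_open) auto
        then show ?thesis by eventually_elim (use uv in auto)
      qed
      ultimately show ?thesis by (rule DERIV_eventually_eq)
    qed
    have sumK: "(\<Sum>b\<in>Basis. K2 b b z) = 24 * r\<^sup>2 * bump r 1 z - (24 + 6 * DIM('a)) * bump r 2 z" for z
    proof -
      have "(\<Sum>b\<in>Basis. K2 b b z) = (\<Sum>b\<in>Basis. (24 * bump r 1 z) * ((z \<bullet> b) * (z \<bullet> b)) - 6 * bump r 2 z)"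
        unfolding K2_def by (intro sum.cong) (auto simp: inner_Basis)
      also have "\<dots> = 24 * bump r 1 z * (z \<bullet> z) - 6 * DIM('a) * bump r 2 z"
        unfolding sum_subtractf sum_distrib_left[symmetric] euclidean_inner[symmetric] by simp
      also have "bump r 1 z * (z \<bullet> z) = r\<^sup>2 * bump r 1 z - bump r 2 z"
        unfolding bump_def power2_norm_eq_inner
        by (cases "r\<^sup>2 \<le> z \<bullet> z") (auto simp: max_def power2_eq_square algebra_simps)
      then have "24 * bump r 1 z * (z \<bullet> z) = 24 * (r\<^sup>2 * bump r 1 z - bump r 2 z)" by simp
      finally show ?thesis by (simp add: algebra_simps)
    qed
    have int: "(\<lambda>y. K (y - x) * u y) integrable_on cbox l h" if "continuous_on UNIV K" for K
      by (rule box_convolution_integrable[OF that u(1)])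
    have "(\<Sum>b\<in>Basis. box_convolution l h u (K2 b b) x) = integral (cbox l h) (\<lambda>y. \<Sum>b\<in>Basis. K2 b b (y - x) * u y)"
      unfolding box_convolution_def by (rule integral_sum[symmetric]) (auto intro!: int cK)
    also have "\<dots> = integral (cbox l h) (\<lambda>y. (24 * r\<^sup>2) * (bump r 1 (y - x) * u y) - (24 + 6 * DIM('a)) * (bump r 2 (y - x) * u y))"
      unfolding sum_distrib_right[symmetric] sumK by (simp add: algebra_simps)
    also have "\<dots> = 24 * r\<^sup>2 * box_convolution l h u (bump r 1) x - (24 + 6 * DIM('a)) * box_convolution l h u (bump r 2) x"
      unfolding box_convolution_def
      using int[OF bump_continuous, of r 1] int[OF bump_continuous, of r 2]
      by (subst integral_diff) (simp_all only: integrable_on_mult_right integral_mult_right)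
    also have "\<dots> = (24 * r\<^sup>2 * bump_mass r 1 TYPE('a) - (24 + 6 * DIM('a)) * bump_mass r 2 TYPE('a)) * u x"
      using box_convolution_bump[OF r _ small[OF x] u, of 1] box_convolution_bump[OF r _ small[OF x] u, of 2]
      by (simp add: algebra_simps)
    finally show "(\<Sum>b\<in>Basis. Q b b x) = bump_laplacian_const r TYPE('a) * u x"
      unfolding Q_def sum_distrib_left[symmetric] by (simp add: bump_laplacian_const_def T_def)
  qed
qed

text \<open>
  The constant does not depend on \<open>u\<close>, and for \<open>u = 1\<close> all derivatives vanish.
\<close>
lemma bump_laplacian_const_eq_0:
  assumes "0 < r" shows "bump_laplacian_const r TYPE('a::euclidean_space) = 0"
proof -
  have sub: "ball 0 (2 * r) \<subseteq> cbox (- ((2 * r) *\<^sub>R One)) ((2 * r) *\<^sub>R One :: 'a)"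
    using norm_gt_of_not_in_cbox[of _ "2 * r"] by force
  have "continuous_on (cbox (- ((2 * r) *\<^sub>R One)) ((2 * r) *\<^sub>R One :: 'a)) (\<lambda>_. 1::real)" by simp
  from mean_value_property_local_derivs[OF assms sub this laplacian_zero_mean_value_property[OF has_laplacian_const]]
  obtain P Q where
    PQ: "\<And>b x. x \<in> ball (0::'a) r \<Longrightarrow> ((\<lambda>t. 1) has_field_derivative P b x) (at 0)"
    "\<And>b c x. ((\<lambda>t. P b (x + t *\<^sub>R c)) has_field_derivative Q b c x) (at 0)"
    "\<And>x. x \<in> ball 0 r \<Longrightarrow> (\<Sum>b\<in>Basis. Q b b x) = bump_laplacian_const r TYPE('a) * 1"
    by (elim exE conjE) blast
  have P0: "P b x = 0" if "x \<in> ball 0 r" for b x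
    using DERIV_unique[OF PQ(1)[OF that] DERIV_const] .
  have "Q b b 0 = 0" for b :: 'a
  proof -
    have "open ((\<lambda>t. 0 + t *\<^sub>R b) -` ball 0 r)"
      by (intro open_vimage continuous_intros) auto
    then have "\<forall>\<^sub>F t in nhds 0. t \<in> (\<lambda>t. 0 + t *\<^sub>R b) -` ball 0 r"
      using assms by (intro eventually_nhds_in_open) auto
    then have "\<forall>\<^sub>F t in nhds 0. 0 = P b (0 + t *\<^sub>R b)" by eventually_elim (use P0 in auto)
    then have "((\<lambda>t::real. 0) has_field_derivative Q b b 0) (at 0)"
      by (rule DERIV_eventually_eq[OF PQ(2)])
    then show ?thesis using DERIV_unique DERIV_const by blast
  qed
  then show ?thesis using PQ(3)[of 0] assms by simp
qed

text \<open>
  Locally \<open>u\<close> is a multiple of its convolution with \<open>bump r 3\<close>, which is of class \<open>C\<^sup>2\<close>, and its Laplacian is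
  \<open>bump_laplacian_const\<close> times \<open>u\<close>, that is, zero.
\<close>
lemma mean_value_property_imp_harmonic_on:
  fixes u :: "'a::euclidean_space \<Rightarrow> real"
  assumes \<Omega>: "open \<Omega>" and u: "continuous_on \<Omega> u" "mean_value_property \<Omega> u"
  shows "harmonic_on u \<Omega>"
proof -
  have loc: "\<exists>r P Q. 0 < r \<and> (\<forall>b. continuous_on UNIV (P b)) \<and> (\<forall>b c. continuous_on UNIV (Q b c))
      \<and> (\<forall>b. \<forall>x\<in>ball x0 r. ((\<lambda>t. u (x + t *\<^sub>R b)) has_field_derivative P b x) (at 0))
      \<and> (\<forall>b c x. ((\<lambda>t. P b (x + t *\<^sub>R c)) has_field_derivative Q b c x) (at 0))
      \<and> (\<forall>x\<in>ball x0 r. (\<Sum>b\<in>Basis. Q b b x) = 0)" if x0: "x0 \<in> \<Omega>" for x0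
  proof -
    obtain l h where lh: "cbox l h \<subseteq> \<Omega>" "x0 \<in> box l h" by (rule open_contains_cbox[OF \<Omega> x0])
    obtain \<rho> where \<rho>: "0 < \<rho>" "ball x0 \<rho> \<subseteq> box l h" using openE[OF open_box lh(2)] by metis
    have r: "0 < \<rho> / 2" and sub: "ball x0 (2 * (\<rho> / 2)) \<subseteq> cbox l h" using \<rho> box_subset_cbox[of l h] by auto
    from mean_value_property_local_derivs[OF r sub continuous_on_subset[OF u(1) lh(1)] mean_value_property_subset[OF u(2) lh(1)]]
    show ?thesis
      unfolding bump_laplacian_const_eq_0[OF r] mult_zero_left using r by blast
  qed
  have first: "\<exists>r>0. \<exists>P Q. (\<forall>b. continuous_on UNIV (P b)) \<and> (\<forall>b c. continuous_on UNIV (Q b c))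
      \<and> (\<forall>b. \<forall>x\<in>ball x0 r. ((\<lambda>t. u (x + t *\<^sub>R b)) has_field_derivative P b x) (at 0))
      \<and> (\<forall>b. \<forall>x\<in>ball x0 r. partial_deriv b u x = P b x)
      \<and> (\<forall>b c. \<forall>x\<in>ball x0 r. ((\<lambda>t. partial_deriv b u (x + t *\<^sub>R c)) has_field_derivative Q b c x) (at 0))
      \<and> (\<forall>b c. \<forall>x\<in>ball x0 r. partial_deriv c (partial_deriv b u) x = Q b c x)
      \<and> (\<forall>x\<in>ball x0 r. (\<Sum>b\<in>Basis. Q b b x) = 0)" if x0: "x0 \<in> \<Omega>" for x0
  proof -
    obtain r P Q where r: "0 < r" and PQ: "\<And>b. continuous_on UNIV (P b)" "\<And>b c. continuous_on UNIV (Q b c)"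
      "\<And>b x. x \<in> ball x0 r \<Longrightarrow> ((\<lambda>t. u (x + t *\<^sub>R b)) has_field_derivative P b x) (at 0)"
      "\<And>b c x. ((\<lambda>t. P b (x + t *\<^sub>R c)) has_field_derivative Q b c x) (at 0)"
      "\<And>x. x \<in> ball x0 r \<Longrightarrow> (\<Sum>b\<in>Basis. Q b b x) = 0"
      using loc[OF x0] by (elim exE conjE) blast
    have pd: "partial_deriv b u x = P b x" if "x \<in> ball x0 r" for b x
      unfolding partial_deriv_def by (rule DERIV_imp_deriv[OF PQ(3)[OF that]])
    have pd2: "((\<lambda>t. partial_deriv b u (x + t *\<^sub>R c)) has_field_derivative Q b c x) (at 0)" if "x \<in> ball x0 r" for b c x
    proof -
      have "open ((\<lambda>t. x + t *\<^sub>R c) -` ball x0 r)"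
        by (intro open_vimage continuous_intros) auto
      then have "\<forall>\<^sub>F t in nhds 0. t \<in> (\<lambda>t. x + t *\<^sub>R c) -` ball x0 r"
        using that by (intro eventually_nhds_in_open) auto
      then have "\<forall>\<^sub>F t in nhds 0. partial_deriv b u (x + t *\<^sub>R c) = P b (x + t *\<^sub>R c)"
        by eventually_elim (use pd in auto)
      then show ?thesis by (rule DERIV_eventually_eq[OF PQ(4)])
    qed
    have pd3: "partial_deriv c (partial_deriv b u) x = Q b c x" if "x \<in> ball x0 r" for b c x
      unfolding partial_deriv_def[of c] by (rule DERIV_imp_deriv[OF pd2[OF that]])
    show ?thesis
      by (rule exI[of _ r], rule conjI[OF r], rule exI[of _ P], rule exI[of _ Q])
         (intro conjI allI ballI PQ pd pd2 pd3)
  qed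
  have cont: "continuous_on \<Omega> g"
    if "\<And>x0. x0 \<in> \<Omega> \<Longrightarrow> \<exists>r>0. \<exists>F. continuous_on UNIV F \<and> (\<forall>x\<in>ball x0 r. g x = F x)" for g :: "'a \<Rightarrow> real"
  proof (rule continuous_at_imp_continuous_on, rule ballI)
    fix x0 assume "x0 \<in> \<Omega>"
    then obtain r F where rF: "0 < r" "continuous_on UNIV F" "\<forall>x\<in>ball x0 r. g x = F x" using \<open>\<And>x0. x0 \<in> \<Omega> \<Longrightarrow> \<exists>r>0. \<exists>F. continuous_on UNIV F \<and> (\<forall>x\<in>ball x0 r. g x = F x)\<close> by metis
    have "continuous_on (ball x0 r) g"
      by (rule continuous_on_eq[OF continuous_on_subset[OF rF(2)]]) (use rF in auto)
    then show "isCont g x0" using rF(1) continuous_on_eq_continuous_at[OF open_ball, of x0 r g] by (metis centre_in_ball)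
  qed
  have c1: "continuous_on \<Omega> (partial_deriv b u)" for b
  proof (rule cont)
    fix x0 assume "x0 \<in> \<Omega>"
    from first[OF this] show "\<exists>r>0. \<exists>F. continuous_on UNIV F \<and> (\<forall>x\<in>ball x0 r. partial_deriv b u x = F x)"
      by (elim exE conjE) blast
  qed
  have c2: "continuous_on \<Omega> (partial_deriv c (partial_deriv b u))" for b c
  proof (rule cont)
    fix x0 assume "x0 \<in> \<Omega>"
    from first[OF this] show "\<exists>r>0. \<exists>F. continuous_on UNIV F \<and> (\<forall>x\<in>ball x0 r. partial_deriv c (partial_deriv b u) x = F x)"
      by (elim exE conjE) blast
  qed
  have "(\<lambda>t. u (x + t *\<^sub>R b)) differentiable at 0 \<and> (\<lambda>t. partial_deriv b u (x + t *\<^sub>R c)) differentiable at 0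
      \<and> laplacian u x = 0" if "x \<in> \<Omega>" for x b c
    using first[OF that]
  proof (elim exE conjE)
    fix r P Q
    assume r: "0 < r" and P: "\<forall>b. \<forall>x'\<in>ball x r. ((\<lambda>t. u (x' + t *\<^sub>R b)) has_field_derivative P b x') (at 0)"
      and Q: "\<forall>b c. \<forall>x'\<in>ball x r. ((\<lambda>t. partial_deriv b u (x' + t *\<^sub>R c)) has_field_derivative Q b c x') (at 0)"
      and pd: "\<forall>b c. \<forall>x'\<in>ball x r. partial_deriv c (partial_deriv b u) x' = Q b c x'"
      and sum: "\<forall>x'\<in>ball x r. (\<Sum>b\<in>Basis. Q b b x') = 0"
    have x: "x \<in> ball x r" using r by simp
    show ?thesis
      unfolding real_differentiable_def laplacian_def
      using P[rule_format, OF x, of b] Q[rule_format, OF x, of b c] pd sum x by auto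
  qed
  note d = this
  show ?thesis
    unfolding harmonic_on_def numeral_2_eq_2 using u(1) c1 c2 d by simp
qed

section \<open>Iterating the averaging map\<close>

text \<open>
  \<open>|y|\<^sup>2\<close> exceeds its tangent at \<open>x\<close> by \<open>|y - x|\<^sup>2\<close>, which has positive mean.
\<close>
lemma sqnorm_less_weighted_mean:
  fixes x :: "'a::euclidean_space"
  assumes r: "0 < r"
  shows "x \<bullet> x < weighted_mean 0 x r (\<lambda>y. y \<bullet> y)"
proof -
  let ?l = "\<lambda>y. x \<bullet> x + 2 * (x \<bullet> (y - x))"
  have C2: "has_laplacian ?l (\<lambda>y. 0 + 2 *\<^sub>R x) (\<lambda>_. 0)"
    using has_laplacian_add[OF has_laplacian_const[of "x \<bullet> x"] has_laplacian_cmult[OF has_laplacian_inner[of x x], of 2]] by simp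
  have bm: "bounded_measurable_on (ball x r) ?l" "bounded_measurable_on (ball x r) (\<lambda>y. y \<bullet> y)"
    by (intro bounded_measurable_ball_continuous continuous_intros)+
  have eq: "?l y - y \<bullet> y = - (norm (y - x))\<^sup>2" for y
    unfolding power2_norm_eq_inner by (simp add: inner_diff_left inner_diff_right inner_commute)
  obtain e :: 'a where e: "e \<in> Basis" using nonempty_Basis by blast
  have "weighted_mean 0 x r (\<lambda>y. ?l y - y \<bullet> y) < 0"
  proof (rule weighted_mean_less_of_continuous[OF r])
    show "bounded_measurable_on (ball x r) (\<lambda>y. ?l y - y \<bullet> y)" "continuous_on (ball x r) (\<lambda>y. ?l y - y \<bullet> y)"
      by (intro bounded_measurable_ball_continuous continuous_intros)+
    show "?l y - y \<bullet> y \<le> 0" for y unfolding eq by simp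
    show "x + (r / 2) *\<^sub>R e \<in> ball x r" using r e by (simp add: dist_norm)
    show "?l (x + (r / 2) *\<^sub>R e) - (x + (r / 2) *\<^sub>R e) \<bullet> (x + (r / 2) *\<^sub>R e) < 0"
      unfolding eq using r e by simp
  qed
  then show ?thesis
    using weighted_mean_diff[OF r bm, of 0] laplacian_zero_weighted_mean[OF C2, of 0 x r] by simp
qed

locale averaging_domain =
  fixes \<Omega> :: "'a::euclidean_space set" and \<delta> :: "'a \<Rightarrow> real"
  assumes op: "open \<Omega>" and bd: "bounded \<Omega>" and \<delta>_cont: "continuous_on \<Omega> \<delta>"
    and adm: "admissible \<Omega> \<delta>"
begin

abbreviation "\<sigma> \<equiv> averaging \<Omega> \<delta>"

lemma \<delta>_pos: "x \<in> \<Omega> \<Longrightarrow> 0 < \<delta> x" and \<delta>_ball: "x \<in> \<Omega> \<Longrightarrow> ball x (\<delta> x) \<subseteq> \<Omega>"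
  using adm by (auto simp: admissible_def)

lemma compact_cl: "compact (closure \<Omega>)"
  using bd by (simp add: compact_closure)

lemma frontier_eq: "x \<in> frontier \<Omega> \<longleftrightarrow> x \<in> closure \<Omega> \<and> x \<notin> \<Omega>"
  using op by (simp add: frontier_def interior_open)

lemma bounded_by:
  fixes f :: "'a \<Rightarrow> real"
  assumes "continuous_on (closure \<Omega>) f"
  obtains M where "0 < M" "\<And>x. x \<in> closure \<Omega> \<Longrightarrow> \<bar>f x\<bar> \<le> M"
proof -
  have "bounded (f ` closure \<Omega>)"
    using assms compact_cl by (intro compact_imp_bounded compact_continuous_image)
  then obtain M where "0 < M" "\<forall>y\<in>f ` closure \<Omega>. norm y \<le> M" by (metis bounded_pos)
  then show thesis by (intro that[of M]) auto
qed

lemma bounded_measurable_ball: "continuous_on (closure \<Omega>) f \<Longrightarrow> x \<in> \<Omega> \<Longrightarrow> bounded_measurable_on (ball x (\<delta> x)) f"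
  using bounded_measurable_subset[OF bounded_measurable_continuous_closure[OF _ bd op] \<delta>_ball] by simp

lemma averaging_inside:
  "continuous_on (closure \<Omega>) f \<Longrightarrow> x \<in> \<Omega> \<Longrightarrow> \<sigma> f x = weighted_mean 0 x (\<delta> x) f"
  by (intro averaging_eq_weighted_mean bounded_measurable_ball \<delta>_pos)

lemma averaging_outside: "x \<notin> \<Omega> \<Longrightarrow> \<sigma> f x = f x"
  by (simp add: averaging_def)

lemma averaging_continuous_inside:
  assumes f: "continuous_on (closure \<Omega>) f"
  shows "continuous_on \<Omega> (\<sigma> f)"
  unfolding continuous_on_sequentially o_def
proof (intro allI ballI impI, elim conjE)
  fix X :: "nat \<Rightarrow> 'a" and a assume X: "\<forall>n. X n \<in> \<Omega>" "X \<longlonglongrightarrow> a" and a: "a \<in> \<Omega>"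
  obtain M where M: "\<And>x. x \<in> closure \<Omega> \<Longrightarrow> \<bar>f x\<bar> \<le> M" using bounded_by[OF f] by metis
  have mem: "x + \<delta> x *\<^sub>R z \<in> closure \<Omega>" if "x \<in> \<Omega>" "z \<in> ball 0 1" for x z
    using affine_unit_ball[OF \<delta>_pos[OF that(1)], of x z] that \<delta>_ball[OF that(1)] closure_subset by blast
  have "(\<lambda>n. weighted_mean 0 (X n) (\<delta> (X n)) f) \<longlonglongrightarrow> weighted_mean 0 a (\<delta> a) f"
  proof (rule weighted_mean_tendsto[where C=M and u="\<lambda>_. f"])
    show "(\<lambda>z. indicator (ball 0 1) z * f (X n + \<delta> (X n) *\<^sub>R z)) \<in> borel_measurable borel" for n
      using X(1) by (intro bounded_measurable_measurable bounded_measurable_affine \<delta>_pos bounded_measurable_ball f) auto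
    show "(\<lambda>z. indicator (ball 0 1) z * f (a + \<delta> a *\<^sub>R z)) \<in> borel_measurable borel"
      by (intro bounded_measurable_measurable bounded_measurable_affine \<delta>_pos bounded_measurable_ball f a)
    fix z :: 'a assume z: "z \<in> ball 0 1"
    show "\<bar>f (X n + \<delta> (X n) *\<^sub>R z)\<bar> \<le> M" for n using M mem X(1) z by blast
    have "(\<lambda>n. \<delta> (X n)) \<longlonglongrightarrow> \<delta> a"
      by (rule continuous_on_tendsto_compose[OF \<delta>_cont X(2) a]) (use X(1) in auto)
    then have "(\<lambda>n. X n + \<delta> (X n) *\<^sub>R z) \<longlonglongrightarrow> a + \<delta> a *\<^sub>R z" by (intro tendsto_intros X(2))
    then show "(\<lambda>n. f (X n + \<delta> (X n) *\<^sub>R z)) \<longlonglongrightarrow> f (a + \<delta> a *\<^sub>R z)"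
      by (rule continuous_on_tendsto_compose[OF f]) (use mem X(1) a z in auto)
  qed
  then show "(\<lambda>n. \<sigma> f (X n)) \<longlonglongrightarrow> \<sigma> f a" using X(1) a by (simp add: averaging_inside[OF f])
qed

text \<open>
  At a frontier point \<open>\<xi>\<close> the radius satisfies \<open>\<delta> y \<le> |y - \<xi>|\<close>, because \<open>\<xi>\<close> lies outside \<open>\<Omega>\<close>. So the balls shrink to \<open>\<xi>\<close>.
\<close>
lemma averaging_continuous:
  assumes f: "continuous_on (closure \<Omega>) f"
  shows "continuous_on (closure \<Omega>) (\<sigma> f)"
  unfolding continuous_on_eq_continuous_within
proof
  fix x assume x: "x \<in> closure \<Omega>"
  show "continuous (at x within closure \<Omega>) (\<sigma> f)"
  proof (cases "x \<in> \<Omega>")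
    case True
    then show ?thesis
      using averaging_continuous_inside[OF f] continuous_on_eq_continuous_at[OF op, of "\<sigma> f"]
        continuous_at_imp_continuous_within by blast
  next
    case False
    show ?thesis
      unfolding continuous_within_eps_delta
    proof (intro allI impI)
      fix e :: real assume e: "0 < e"
      then obtain d where d: "0 < d" "\<And>y. y \<in> closure \<Omega> \<Longrightarrow> dist y x < d \<Longrightarrow> dist (f y) (f x) < e / 2"
        using f x unfolding continuous_on_iff by (meson half_gt_zero)
      have "dist (\<sigma> f y) (\<sigma> f x) < e" if y: "y \<in> closure \<Omega>" "dist y x < d / 2" for y
      proof (cases "y \<in> \<Omega>")
        case True
        have \<delta>y: "\<delta> y \<le> dist y x" using \<delta>_ball[OF True] False by (meson mem_ball not_le subsetD)
        have cl: "z \<in> closure \<Omega>" if "z \<in> ball y (\<delta> y)" for z using that \<delta>_ball[OF True] closure_subset by blast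
        have "\<bar>weighted_mean 0 y (\<delta> y) f - weighted_mean 0 y (\<delta> y) (\<lambda>_. f x)\<bar> \<le> e / 2"
        proof (rule weighted_mean_close[OF \<delta>_pos[OF True] bounded_measurable_ball[OF f True]])
          show "bounded_measurable_on (ball y (\<delta> y)) (\<lambda>_. f x)" by (intro bounded_measurable_const) auto
          fix z assume z: "z \<in> ball y (\<delta> y)"
          have "dist z x < d" using z \<delta>y y(2) dist_triangle[of z x y] by (simp add: dist_commute)
          then show "\<bar>f z - f x\<bar> \<le> e / 2" using d(2)[OF cl[OF z]] by (simp add: dist_real_def)
        qed
        then show ?thesis
          using e by (simp add: averaging_inside[OF f True] averaging_outside[OF False] weighted_mean_const dist_real_def)
      next
        case y': False
        then show ?thesis
          using d(2)[OF y(1)] y(2) d(1) e by (simp add: averaging_outside False)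
      qed
      then show "\<exists>d>0. \<forall>y\<in>closure \<Omega>. dist y x < d \<longrightarrow> dist (\<sigma> f y) (\<sigma> f x) < e"
        using d(1) by (intro exI[of _ "d / 2"]) auto
    qed
  qed
qed

lemma iterate_continuous: "continuous_on (closure \<Omega>) f \<Longrightarrow> continuous_on (closure \<Omega>) ((\<sigma> ^^ k) f)"
  by (induction k) (auto intro: averaging_continuous)

lemma averaging_mono:
  assumes f: "continuous_on (closure \<Omega>) f" and g: "continuous_on (closure \<Omega>) g"
    and le: "\<And>x. x \<in> closure \<Omega> \<Longrightarrow> f x \<le> g x" and x: "x \<in> closure \<Omega>"
  shows "\<sigma> f x \<le> \<sigma> g x"
proof (cases "x \<in> \<Omega>")
  case True
  have "f y \<le> g y" if "y \<in> ball x (\<delta> x)" for y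
    using le that \<delta>_ball[OF True] closure_subset by blast
  then show ?thesis
    unfolding averaging_inside[OF f True] averaging_inside[OF g True]
    by (intro weighted_mean_mono \<delta>_pos bounded_measurable_ball f g True)
qed (use le x in \<open>simp add: averaging_outside\<close>)

lemma iterate_mono:
  assumes f: "continuous_on (closure \<Omega>) f" and g: "continuous_on (closure \<Omega>) g"
    and le: "\<And>x. x \<in> closure \<Omega> \<Longrightarrow> f x \<le> g x" and x: "x \<in> closure \<Omega>"
  shows "(\<sigma> ^^ k) f x \<le> (\<sigma> ^^ k) g x"
  using x
proof (induction k arbitrary: x)
  case (Suc k)
  then show ?case by (simp add: averaging_mono iterate_continuous f g)
qed (use le in simp)

lemma averaging_lincomb:
  assumes f: "continuous_on (closure \<Omega>) f" and g: "continuous_on (closure \<Omega>) g"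
    and h: "continuous_on (closure \<Omega>) h"
    and eq: "\<And>x. x \<in> closure \<Omega> \<Longrightarrow> h x = a * f x + b * g x" and x: "x \<in> closure \<Omega>"
  shows "\<sigma> h x = a * \<sigma> f x + b * \<sigma> g x"
proof (cases "x \<in> \<Omega>")
  case True
  have "weighted_mean 0 x (\<delta> x) h = weighted_mean 0 x (\<delta> x) (\<lambda>y. a * f y + b * g y)"
    using eq \<delta>_ball[OF True] closure_subset by (intro weighted_mean_cong \<delta>_pos True) blast
  also have "\<dots> = a * weighted_mean 0 x (\<delta> x) f + b * weighted_mean 0 x (\<delta> x) g"
    by (subst weighted_mean_add) (auto intro: \<delta>_pos True bounded_measurable_cmult bounded_measurable_ball f g simp: weighted_mean_cmult)
  finally show ?thesis by (simp add: averaging_inside True f g h)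
qed (use eq x in \<open>simp add: averaging_outside\<close>)

lemma iterate_lincomb:
  assumes f: "continuous_on (closure \<Omega>) f" and g: "continuous_on (closure \<Omega>) g"
    and x: "x \<in> closure \<Omega>"
  shows "(\<sigma> ^^ k) (\<lambda>x. a * f x + b * g x) x = a * (\<sigma> ^^ k) f x + b * (\<sigma> ^^ k) g x"
  using x
proof (induction k arbitrary: x)
  case (Suc k)
  have "continuous_on (closure \<Omega>) (\<lambda>x. a * f x + b * g x)" by (intro continuous_intros f g)
  then show ?case
    using averaging_lincomb[OF iterate_continuous[OF f] iterate_continuous[OF g] iterate_continuous Suc.IH Suc.prems]
    by simp
qed simp

lemma averaging_const: "x \<in> closure \<Omega> \<Longrightarrow> \<sigma> (\<lambda>_. c) x = c"
  by (cases "x \<in> \<Omega>") (auto simp: averaging_inside weighted_mean_const averaging_outside)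

lemma averaging_mean_value_property:
  assumes u: "continuous_on (closure \<Omega>) u" "mean_value_property \<Omega> u" shows "\<sigma> u x = u x"
proof (cases "x \<in> \<Omega>")
  case True
  then show ?thesis
    using averaging_inside[OF u(1) True] mean_value_propertyD[OF u(2) \<delta>_pos[OF True] \<delta>_ball[OF True], of 0] by simp
qed (rule averaging_outside)

lemma iterate_mean_value_property:
  assumes u: "continuous_on (closure \<Omega>) u" "mean_value_property \<Omega> u" shows "(\<sigma> ^^ k) u = u"
proof (induction k)
  case (Suc k)
  then show ?case using averaging_mean_value_property[OF u] by (simp add: fun_eq_iff[of "\<sigma> u"])
qed simp

text \<open>
  On the compact set where \<open>s \<ge> \<epsilon>\<close> the averaging map decreases \<open>s\<close> by a fixed proportion \<open>\<theta>\<close>, and elsewhere it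
  does not increase \<open>s\<close>. Hence \<open>\<sigma> s \<le> (1 - \<theta>) s + \<theta> \<epsilon>\<close> on the whole closure, and iterating this
  inequality gives \<open>\<sigma>\<^sup>k s \<le> (1 - \<theta>)\<^sup>k s + \<epsilon>\<close>.
\<close>
lemma strict_supersolution_decay:
  assumes s: "continuous_on (closure \<Omega>) s" and pos: "\<And>x. x \<in> closure \<Omega> \<Longrightarrow> 0 \<le> s x"
    and zero: "\<And>x. x \<in> frontier \<Omega> \<Longrightarrow> s x = 0"
    and less: "\<And>x. x \<in> \<Omega> \<Longrightarrow> \<sigma> s x < s x" and \<eta>: "0 < \<eta>"
  shows "\<forall>\<^sub>F k in sequentially. \<forall>x\<in>closure \<Omega>. (\<sigma> ^^ k) s x < \<eta>"
proof -
  define \<epsilon> where "\<epsilon> = \<eta> / 2"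
  have \<epsilon>: "0 < \<epsilon>" using \<eta> by (simp add: \<epsilon>_def)
  obtain M where M: "0 < M" "\<And>x. x \<in> closure \<Omega> \<Longrightarrow> s x \<le> M" 
    using bounded_by[OF s] abs_le_D1 by metis
  define K where "K = closure \<Omega> \<inter> s -` {\<epsilon>..}"
  have "closed K" unfolding K_def using s by (intro continuous_closed_preimage) auto
  then have K: "compact K" using compact_Int_closed[OF compact_cl, of K] by (simp add: K_def Int_assoc[symmetric])
  have K\<Omega>: "K \<subseteq> \<Omega>" using zero \<epsilon> frontier_eq by (force simp: K_def)
  obtain d where d: "0 < d" "\<And>x. x \<in> K \<Longrightarrow> d \<le> s x - \<sigma> s x"
  proof (cases "K = {}")
    case True
    then show ?thesis using that[of 1] by simp
  next
    case False
    have "continuous_on K (\<lambda>x. s x - \<sigma> s x)"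
      by (rule continuous_on_subset[of "closure \<Omega>"]) (auto simp: K_def intro!: continuous_intros s averaging_continuous)
    from continuous_attains_inf[OF K False this] obtain y where y: "y \<in> K" "\<And>x. x \<in> K \<Longrightarrow> s y - \<sigma> s y \<le> s x - \<sigma> s x"
      by blast
    have "0 < s y - \<sigma> s y" using less[of y] y(1) K\<Omega> by auto
    then show ?thesis using y(2) by (rule that)
  qed
  \<comment> \<open>bounding \<open>\<theta>\<close> by \<open>1/2\<close> keeps \<open>1 - \<theta>\<close> a nonnegative factor; \<open>\<theta> s \<le> \<theta> M \<le> d\<close> on \<open>K\<close>\<close>
  define \<theta> where "\<theta> = min (1/2) (d / M)"
  have \<theta>: "0 < \<theta>" "\<theta> \<le> 1/2" "\<theta> * M \<le> d" using d M by (auto simp: \<theta>_def min_def field_simps)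
  have step: "\<sigma> s x \<le> (1 - \<theta>) * s x + \<theta> * \<epsilon>" if x: "x \<in> closure \<Omega>" for x
  proof (cases "x \<in> K")
    case True
    have "\<theta> * s x \<le> \<theta> * M" using M(2)[OF x] \<theta>(1) by (intro mult_left_mono) auto
    moreover have "0 \<le> \<theta> * \<epsilon>" using \<theta>(1) \<epsilon> by simp
    ultimately show ?thesis using d(2)[OF True] \<theta>(3) unfolding left_diff_distrib mult_1_left by linarith
  next
    case False
    then have "s x \<le> \<epsilon>" using x by (simp add: K_def)
    then have "\<theta> * s x \<le> \<theta> * \<epsilon>" using \<theta>(1) by (intro mult_left_mono) auto
    moreover have "\<sigma> s x \<le> s x"
      using less[of x] averaging_outside[of x s] by (cases "x \<in> \<Omega>") auto
    ultimately show ?thesis unfolding left_diff_distrib mult_1_left by linarith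
  qed
  have iter: "(\<sigma> ^^ k) s x \<le> (1 - \<theta>) ^ k * s x + (1 - (1 - \<theta>) ^ k) * \<epsilon>" if "x \<in> closure \<Omega>" for k x
    using that
  proof (induction k arbitrary: x)
    case (Suc k)
    let ?a = "(1 - \<theta>) ^ k"
    let ?g = "\<lambda>x. ?a * s x + (1 - ?a) * \<epsilon>"
    have g: "continuous_on (closure \<Omega>) ?g" by (intro continuous_intros s)
    have "(\<sigma> ^^ Suc k) s x \<le> \<sigma> ?g x"
      using averaging_mono[OF iterate_continuous[OF s] g Suc.IH Suc.prems] by simp
    also have "\<dots> = ?a * \<sigma> s x + (1 - ?a) * \<epsilon>"
      using averaging_lincomb[OF s continuous_on_const[of _ 1] g _ Suc.prems, of ?a "(1 - ?a) * \<epsilon>"]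
        averaging_const[OF Suc.prems, of 1] by simp
    also have "\<dots> \<le> ?a * ((1 - \<theta>) * s x + \<theta> * \<epsilon>) + (1 - ?a) * \<epsilon>"
      using step[OF Suc.prems] \<theta> by (intro add_right_mono mult_left_mono) auto
    also have "\<dots> = (1 - \<theta>) ^ Suc k * s x + (1 - (1 - \<theta>) ^ Suc k) * \<epsilon>"
      by (simp add: algebra_simps)
    finally show ?case .
  qed simp
  have "(\<lambda>k. (1 - \<theta>) ^ k * M) \<longlonglongrightarrow> 0 * M"
    using \<theta> by (intro tendsto_intros LIMSEQ_realpow_zero) auto
  then have "\<forall>\<^sub>F k in sequentially. (1 - \<theta>) ^ k * M < \<epsilon>"
    using \<epsilon> order_tendstoD(2) by fastforce
  then show ?thesis
  proof eventually_elim
    case (elim k)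
    show ?case
    proof
      fix x assume x: "x \<in> closure \<Omega>"
      have a: "0 \<le> (1 - \<theta>) ^ k" using \<theta> by simp
      then have "(1 - \<theta>) ^ k * s x \<le> (1 - \<theta>) ^ k * M" using M(2)[OF x] by (intro mult_left_mono)
      moreover have "(1 - (1 - \<theta>) ^ k) * \<epsilon> \<le> 1 * \<epsilon>" using a \<epsilon> by (intro mult_right_mono) auto
      ultimately show "(\<sigma> ^^ k) s x < \<eta>" using iter[OF x, of k] elim by (simp add: \<epsilon>_def)
    qed
  qed
qed

text \<open>
  A function that vanishes on the frontier is, up to a small constant, dominated by a multiple of \<open>s\<close>, and so are its iterates.
\<close>
lemma iterate_vanishing_boundary:
  assumes s: "continuous_on (closure \<Omega>) s" and pos: "\<And>x. x \<in> closure \<Omega> \<Longrightarrow> 0 \<le> s x"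
    and zero: "\<And>x. x \<in> frontier \<Omega> \<Longrightarrow> s x = 0"
    and less: "\<And>x. x \<in> \<Omega> \<Longrightarrow> \<sigma> s x < s x"
    and g: "continuous_on (closure \<Omega>) g" and g0: "\<And>x. x \<in> frontier \<Omega> \<Longrightarrow> g x = 0"
  shows "uniform_limit (closure \<Omega>) (\<lambda>k. (\<sigma> ^^ k) g) (\<lambda>_. 0) sequentially"
proof (rule uniform_limitI)
  fix e :: real assume e: "0 < e"
  obtain G where G: "0 < G" "\<And>x. x \<in> closure \<Omega> \<Longrightarrow> \<bar>g x\<bar> \<le> G" using bounded_by[OF g] by metis
  have spos: "0 < s x" if "x \<in> \<Omega>" for x
  proof -
    have "x \<in> closure \<Omega>" using that closure_subset by blast
    then have "0 \<le> \<sigma> s x"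
      using averaging_mono[OF continuous_on_const[of _ 0] s pos, of x] averaging_const[of x 0] by simp
    then show ?thesis using less[OF that] by simp
  qed
  define K where "K = closure \<Omega> \<inter> (\<lambda>x. \<bar>g x\<bar>) -` {e / 2..}"
  have "closed K" unfolding K_def using g by (intro continuous_closed_preimage continuous_intros) auto
  then have K: "compact K" using compact_Int_closed[OF compact_cl, of K] by (simp add: K_def Int_assoc[symmetric])
  have K\<Omega>: "K \<subseteq> \<Omega>" using g0 e frontier_eq by (force simp: K_def)
  obtain m where m: "0 < m" "\<And>x. x \<in> K \<Longrightarrow> m \<le> s x"
  proof (cases "K = {}")
    case True
    then show ?thesis using that[of 1] by simp
  next
    case False
    have "continuous_on K s" by (rule continuous_on_subset[OF s]) (auto simp: K_def)
    from continuous_attains_inf[OF K False this] obtain y where y: "y \<in> K" "\<And>x. x \<in> K \<Longrightarrow> s y \<le> s x"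
      by blast
    have "0 < s y" using spos y(1) K\<Omega> by auto
    then show ?thesis using y(2) by (rule that)
  qed
  define c where "c = G / m"
  have c: "0 < c" using G m by (simp add: c_def)
  have dom: "\<bar>g x\<bar> \<le> c * s x + (e / 2) * 1" if x: "x \<in> closure \<Omega>" for x
  proof (cases "x \<in> K")
    case True
    have "G \<le> c * s x" using m(2)[OF True] m(1) G(1) by (simp add: c_def field_simps)
    then show ?thesis using G(2)[OF x] e by simp
  next
    case False
    then have "\<bar>g x\<bar> < e / 2" using x by (simp add: K_def not_le)
    moreover have "0 \<le> c * s x" using c pos[OF x] by simp
    ultimately show ?thesis by simp
  qed
  have iter: "\<bar>(\<sigma> ^^ k) g x\<bar> \<le> c * (\<sigma> ^^ k) s x + e / 2" if x: "x \<in> closure \<Omega>" for k x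
  proof -
    let ?h = "\<lambda>x. c * s x + (e / 2) * 1"
    have h: "continuous_on (closure \<Omega>) ?h" by (intro continuous_intros s)
    have one: "(\<sigma> ^^ k) (\<lambda>_. 1) x = 1"
      using iterate_mean_value_property[OF continuous_on_const laplacian_zero_mean_value_property[OF has_laplacian_const]] by metis
    have hk: "(\<sigma> ^^ k) ?h x = c * (\<sigma> ^^ k) s x + e / 2"
      using iterate_lincomb[OF s continuous_on_const[of _ 1] x, of k c "e / 2"] one by simp
    have neg: "(\<sigma> ^^ k) (\<lambda>x. (-1) * g x + 0 * g x) x = - (\<sigma> ^^ k) g x"
      using iterate_lincomb[OF g g x, of k "-1" 0] by simp
    have "(\<sigma> ^^ k) g x \<le> (\<sigma> ^^ k) ?h x"
      using dom by (intro iterate_mono g h x) (auto simp: abs_le_iff)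
    moreover have "(\<sigma> ^^ k) (\<lambda>x. (-1) * g x + 0 * g x) x \<le> (\<sigma> ^^ k) ?h x"
    proof (rule iterate_mono[OF _ h _ x])
      show "continuous_on (closure \<Omega>) (\<lambda>x. (-1) * g x + 0 * g x)" by (intro continuous_intros g)
      show "(-1) * g y + 0 * g y \<le> ?h y" if "y \<in> closure \<Omega>" for y using dom[OF that] by (simp add: abs_le_iff)
    qed
    ultimately show ?thesis unfolding hk neg by linarith
  qed
  have "0 < e / 2 / c" using e c by simp
  then have "\<forall>\<^sub>F k in sequentially. \<forall>x\<in>closure \<Omega>. (\<sigma> ^^ k) s x < e / 2 / c"
    by (intro strict_supersolution_decay s pos zero less)
  then show "\<forall>\<^sub>F k in sequentially. \<forall>x\<in>closure \<Omega>. dist ((\<sigma> ^^ k) g x) 0 < e"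
  proof eventually_elim
    case (elim k)
    show ?case
    proof
      fix x assume x: "x \<in> closure \<Omega>"
      have "c * (\<sigma> ^^ k) s x < e / 2" using elim x c by (simp add: field_simps)
      then show "dist ((\<sigma> ^^ k) g x) 0 < e" using iter[OF x, of k] by simp
    qed
  qed
qed

text \<open>
  The difference \<open>f - u\<close> vanishes on the frontier and \<open>u\<close> is fixed by the averaging map. A strict
  supersolution that vanishes on the frontier is \<open>v - |x|\<^sup>2\<close>, where \<open>v\<close> solves the Dirichlet problem with boundary values \<open>|x|\<^sup>2\<close>.
\<close>
lemma iterate_converges_to_solution:
  assumes q: "dirichlet_solvable \<Omega> (\<lambda>x. x \<bullet> x)"
    and f: "continuous_on (closure \<Omega>) f"
    and u: "continuous_on (closure \<Omega>) u" "mean_value_property \<Omega> u" "\<And>x. x \<in> frontier \<Omega> \<Longrightarrow> u x = f x"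
  shows "uniform_limit (closure \<Omega>) (\<lambda>k. (\<sigma> ^^ k) f) u sequentially"
proof -
  obtain v where v: "continuous_on (closure \<Omega>) v" "mean_value_property \<Omega> v" "\<And>x. x \<in> frontier \<Omega> \<Longrightarrow> v x = x \<bullet> x"
    using q unfolding dirichlet_solvable_def by blast
  have sq: "continuous_on (closure \<Omega>) (\<lambda>x. x \<bullet> x)" by (intro continuous_intros)
  have "subharmonic_on \<Omega> (\<lambda>x. x \<bullet> x)"
    unfolding subharmonic_on_def using openE[OF op] sqnorm_less_weighted_mean less_imp_le by metis
  note le = subharmonic_le_mean_value_property[OF bd op sq this v(1,2)]
  let ?s = "\<lambda>x. v x - x \<bullet> x"
  have lim: "uniform_limit (closure \<Omega>) (\<lambda>k. (\<sigma> ^^ k) (\<lambda>x. f x - u x)) (\<lambda>_. 0) sequentially"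
  proof (rule iterate_vanishing_boundary[of ?s])
    show s: "continuous_on (closure \<Omega>) ?s" by (intro continuous_intros v)
    show "0 \<le> ?s x" if "x \<in> closure \<Omega>" for x using le[OF _ that] v(3) by simp
    show "?s x = 0" if "x \<in> frontier \<Omega>" for x using v(3)[OF that] by simp
    show "\<sigma> ?s x < ?s x" if x: "x \<in> \<Omega>" for x
    proof -
      have "\<sigma> ?s x = \<sigma> v x - \<sigma> (\<lambda>x. x \<bullet> x) x"
        unfolding averaging_inside[OF s x] averaging_inside[OF v(1) x] averaging_inside[OF sq x]
        by (intro weighted_mean_diff \<delta>_pos bounded_measurable_ball v sq x)
      moreover have "x \<bullet> x < \<sigma> (\<lambda>x. x \<bullet> x) x"
        unfolding averaging_inside[OF sq x] by (rule sqnorm_less_weighted_mean[OF \<delta>_pos[OF x]])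
      ultimately show ?thesis using averaging_mean_value_property[OF v(1,2)] by simp
    qed
    show "continuous_on (closure \<Omega>) (\<lambda>x. f x - u x)" by (intro continuous_intros f u)
    show "f x - u x = 0" if "x \<in> frontier \<Omega>" for x using u(3)[OF that] by simp
  qed
  show ?thesis
  proof (rule uniform_limitI)
    fix e :: real assume "0 < e"
    from uniform_limitD[OF lim this]
    show "\<forall>\<^sub>F k in sequentially. \<forall>x\<in>closure \<Omega>. dist ((\<sigma> ^^ k) f x) (u x) < e"
    proof eventually_elim
      case (elim k)
      show ?case
      proof
        fix x assume x: "x \<in> closure \<Omega>"
        have "(\<sigma> ^^ k) (\<lambda>x. f x - u x) x = (\<sigma> ^^ k) f x - u x"
          using iterate_lincomb[OF f u(1) x, of k 1 "-1"] iterate_mean_value_property[OF u(1,2), of k] by simp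
        then show "dist ((\<sigma> ^^ k) f x) (u x) < e" using bspec[OF elim x] by (simp add: dist_real_def)
      qed
    qed
  qed
qed

end

theorem theorem3:
  fixes \<Omega> :: "(real ^ 'n) set"
    and \<delta> :: "real ^ 'n \<Rightarrow> real"
    and f :: "real ^ 'n \<Rightarrow> real"
  assumes "is_domain \<Omega>"
    and "bounded \<Omega>"
    and "strongly_convex \<Omega>"
    and "continuous_on \<Omega> \<delta>"
    and "admissible \<Omega> \<delta>"
    and "continuous_on (closure \<Omega>) f"
  shows "\<exists>u. uniform_limit (closure \<Omega>) (\<lambda>k. (averaging \<Omega> \<delta> ^^ k) f) u sequentially
           \<and> continuous_on (closure \<Omega>) u
           \<and> harmonic_on u \<Omega>
           \<and> (\<forall>x\<in>frontier \<Omega>. u x = f x)"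
proof -
  have op: "open \<Omega>" and ne: "\<Omega> \<noteq> {}" using assms(1) by (auto simp: is_domain_def)
  interpret averaging_domain \<Omega> \<delta>
    using op assms by unfold_locales
  have solvable: "dirichlet_solvable \<Omega> g" if "continuous_on (closure \<Omega>) g" for g
    by (rule dirichlet_strongly_convex[OF assms(3) op assms(2) ne continuous_on_subset[OF that]])
       (simp add: frontier_def)
  obtain u where u: "continuous_on (closure \<Omega>) u" "mean_value_property \<Omega> u" "\<And>x. x \<in> frontier \<Omega> \<Longrightarrow> u x = f x"
    using solvable[OF assms(6)] unfolding dirichlet_solvable_def by blast
  have "dirichlet_solvable \<Omega> (\<lambda>x. x \<bullet> x)" by (intro solvable continuous_intros)
  then have "uniform_limit (closure \<Omega>) (\<lambda>k. (averaging \<Omega> \<delta> ^^ k) f) u sequentially"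
    by (rule iterate_converges_to_solution[OF _ assms(6) u])
  moreover have "harmonic_on u \<Omega>"
    by (rule mean_value_property_imp_harmonic_on[OF op continuous_on_subset[OF u(1) closure_subset] u(2)])
  ultimately show ?thesis using u by blast
qed

end
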